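(* Let $\{c(r): r\in\mathbb{Z}\}$ be a real symmetric, positive definite sequence such that for some $K>1$, $\sum_{r\in\mathbb{Z}}|r^Kc(r)|<\infty$, and whose Fourier transform $f(\omega)=\sum_{r\in\mathbb{Z}}c(r)e^{ir\omega}$ satisfies $0<\inf_\omega f(\omega)\le\sup_\omega f(\omega)<\infty$. Let ${\bf g}_+=(g_\ell;\ell\ge0)'\in\ell_2^+$ and consider the semi-infinite system $$g_\ell=\sum_{j=0}^{\infty}h_jc(\ell-j),\qquad \ell\ge0,$$ with solution $(h_j;j\ge0)'=T(f)^{-1}{\bf g}_+$. Let $$H(\omega)=\sum_{j=0}^\infty h_je^{ij\omega}=\frac{\sum_{\ell=0}^{\infty}g_\ell\big(e^{i\ell\omega}+[\phi(\omega)^*]^{-1}\phi_\ell(\omega)^*\big)}{f(\omega)}$$ and, for each integer $p\ge1$, let $$H_p(\omega)=\frac{\sum_{\ell=0}^{\infty}g_\ell\big(e^{i\ell\omega}+[\phi^{(p)}(\omega)^*]^{-1}\phi^{(p)}_\ell(\omega)^*\big)}{f_p(\omega)},$$ where $\phi,\phi_\ell,\phi^{(p)},\phi^{(p)}_\ell,f_p$ are as defined in the context. Then there is a constant $C$, depending only on $f$ and $K$ (and not on $p$, ${\bf g}_+$ or $\omega$), such that $$\big|H(\omega)-H_p(\omega)\big|\le C\Big[p^{-K+1}\sup_s|g_s|+p^{-K}|G_+(\omega)|\Big],$$ where $G_+(\omega)=\sum_{\ell=0}^{\infty}g_\ell e^{i\ell\omega}$.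
   Context: $\ell_2^+$ is the space of square-summable sequences $(v_0,v_1,\ldots)'$. $T(f)=(c(t-\tau);t,\tau\ge0)$ is the semi-infinite Toeplitz operator on $\ell_2^+$, which is well known to be invertible on $\ell_2^+$ when $0<\inf_\omega f\le\sup_\omega f<\infty$. The superscript $*$ denotes complex conjugation. Spectral factorization: there are unique $\sigma^2>0$ and real square-summable sequences $(\psi_j)_{j\ge1}$, $(\phi_j)_{j\ge1}$ such that $\Psi(z)=1+\sum_{j\ge1}\psi_jz^j$ and $\Phi(z)=1-\sum_{j\ge1}\phi_jz^j$ satisfy $\Psi(z)\Phi(z)=1$ for $|z|<1$, and, with $\psi(\omega)=1+\sum_{j\ge1}\psi_je^{ij\omega}$ and $\phi(\omega)=1-\sum_{j\ge1}\phi_je^{ij\omega}=\psi(\omega)^{-1}$, one has $f(\omega)=\sigma^2|\psi(\omega)|^2=\sigma^2|\phi(\omega)|^{-2}$. For $\ell\ge0$, $\phi_\ell(\omega)=\sum_{s=1}^{\infty}\phi_{\ell+s}e^{is\omega}$. (If $\sum_r|r^Kc(r)|<\infty$, it is known that $\sum_{j\ge1}j^K|\phi_j|$ and $\sum_{j\ge1}j^K|\psi_j|$ are finite.) Best fitting AR$(p)$ approximation: for $p\ge1$, $(\phi_{p,1},\ldots,\phi_{p,p})'$ is the minimizer over $(a_1,\ldots,a_p)'\in\mathbb{R}^p$ of $$\frac{1}{2\pi}\int_0^{2\pi}\Big|1-\sum_{j=1}^pa_je^{ij\omega}\Big|^2f(\omega)\,d\omega,$$ which equals $\mathbb{E}|X_0-\sum_{j=1}^pa_jX_{-j}|^2$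 for a zero mean stationary process $\{X_t\}$ with autocovariance $c$; $\sigma_p^2$ is the minimum value. Put $\phi^{(p)}(\omega)=1-\sum_{j=1}^p\phi_{p,j}e^{ij\omega}$ (the zeros of $1-\sum_{j=1}^p\phi_{p,j}z^j$ lie outside the closed unit disc), $f_p(\omega)=\sigma_p^2|\phi^{(p)}(\omega)|^{-2}$, and $\phi^{(p)}_\ell(\omega)=\sum_{s=1}^{p-\ell}\phi_{p,\ell+s}e^{is\omega}$ for $0\le\ell<p$, $\phi^{(p)}_\ell(\omega)=0$ for $\ell\ge p$. Fourier series with square-summable coefficients are understood as elements of $L_2([0,2\pi))$, so pointwise statements in $\omega$ are for almost every $\omega$. *)

theory Defs
  imports "HOL-Analysis.Analysis"
begin

definition circle :: "real measure" where
  "circle = lebesgue_on {0..<2 * pi}"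

text \<open>Elements of \<open>L\<^sub>2([0,2\<pi>))\<close> are handled through representatives: \<open>L2_sums u F\<close> says that
  \<open>F\<close> represents the \<open>L\<^sub>2\<close>-sum of the series of functions \<open>u 0, u 1, \<dots>\<close>, which determines \<open>F\<close>
  almost everywhere. Membership of all terms in \<open>L\<^sub>2\<close> is demanded because the Bochner integral of
  a non-integrable function is 0.\<close>

definition L2_circle :: "(real \<Rightarrow> complex) set" where
  "L2_circle = {F. F \<in> borel_measurable circle \<and> integrable circle (\<lambda>\<omega>. (cmod (F \<omega>))\<^sup>2)}"

definition L2_sums :: "(nat \<Rightarrow> real \<Rightarrow> complex) \<Rightarrow> (real \<Rightarrow> complex) \<Rightarrow> bool" where
  "L2_sums u F \<longleftrightarrow> (\<forall>j. u j \<in> L2_circle) \<and> F \<in> L2_circle \<and>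
     (\<lambda>n. \<integral>\<omega>. (cmod (F \<omega> - (\<Sum>j<n. u j \<omega>)))\<^sup>2 \<partial>circle) \<longlonglongrightarrow> 0"

definition has_fourier_series :: "(real \<Rightarrow> complex) \<Rightarrow> (nat \<Rightarrow> complex) \<Rightarrow> bool" where
  "has_fourier_series F a \<longleftrightarrow> L2_sums (\<lambda>j \<omega>. a j * cis (real j * \<omega>)) F"

definition l2_plus :: "(nat \<Rightarrow> complex) set" where
  "l2_plus = {v. summable (\<lambda>j. (cmod (v j))\<^sup>2)}"

definition positive_definite_seq :: "(int \<Rightarrow> real) \<Rightarrow> bool" where
  "positive_definite_seq c \<longleftrightarrow>
     (\<forall>n (x :: nat \<Rightarrow> real). (\<exists>i<n. x i \<noteq> 0) \<longrightarrow>
        (\<Sum>i<n. \<Sum>j<n. x i * c (int i - int j) * x j) > 0)"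

text \<open>For symmetric \<open>c\<close> the sum is real, so taking the real part loses nothing.\<close>

definition spectral_density :: "(int \<Rightarrow> real) \<Rightarrow> real \<Rightarrow> real" where
  "spectral_density c \<omega> =
     Re (\<Sum>\<^sub>\<infinity>r::int. complex_of_real (c r) * cis (real_of_int r * \<omega>))"

text \<open>The sequences \<open>\<psi>\<close>, \<open>\<phi>\<close> are indexed from 1; their values at 0 are never used.
  \<open>psi\<close> and \<open>phi\<close> represent the boundary functions of \<open>\<Psi>\<close> and \<open>\<Phi>\<close> in \<open>L\<^sub>2\<close>.\<close>

definition spectral_factorization ::
  "(int \<Rightarrow> real) \<Rightarrow> real \<Rightarrow> (nat \<Rightarrow> real) \<Rightarrow> (nat \<Rightarrow> real) \<Rightarrow>
   (real \<Rightarrow> complex) \<Rightarrow> (real \<Rightarrow> complex) \<Rightarrow> bool" where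
  "spectral_factorization c \<sigma>2 \<psi> \<phi> psi phi \<longleftrightarrow>
     \<sigma>2 > 0 \<and>
     summable (\<lambda>j. (\<psi> (Suc j))\<^sup>2) \<and> summable (\<lambda>j. (\<phi> (Suc j))\<^sup>2) \<and>
     (\<forall>z::complex. cmod z < 1 \<longrightarrow>
        (1 + (\<Sum>j. complex_of_real (\<psi> (Suc j)) * z ^ Suc j)) *
        (1 - (\<Sum>j. complex_of_real (\<phi> (Suc j)) * z ^ Suc j)) = 1) \<and>
     has_fourier_series psi (\<lambda>j. if j = 0 then 1 else complex_of_real (\<psi> j)) \<and>
     has_fourier_series phi (\<lambda>j. if j = 0 then 1 else - complex_of_real (\<phi> j)) \<and>
     (AE \<omega> in circle.
        phi \<omega> = inverse (psi \<omega>) \<and>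
        spectral_density c \<omega> = \<sigma>2 * (cmod (psi \<omega>))\<^sup>2 \<and>
        spectral_density c \<omega> = \<sigma>2 / (cmod (phi \<omega>))\<^sup>2)"

definition ar_filter :: "nat \<Rightarrow> (nat \<Rightarrow> real) \<Rightarrow> real \<Rightarrow> complex" where
  "ar_filter p a \<omega> = 1 - (\<Sum>j=1..p. complex_of_real (a j) * cis (real j * \<omega>))"

definition ar_error :: "(int \<Rightarrow> real) \<Rightarrow> nat \<Rightarrow> (nat \<Rightarrow> real) \<Rightarrow> real" where
  "ar_error c p a =
     1 / (2 * pi) * (\<integral>\<omega>. (cmod (ar_filter p a \<omega>))\<^sup>2 * spectral_density c \<omega> \<partial>circle)"

text \<open>Vectors \<open>(a\<^sub>1, \<dots>, a\<^sub>p)\<close> are functions vanishing outside \<open>{1..p}\<close>.\<close>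

definition best_ar :: "(int \<Rightarrow> real) \<Rightarrow> nat \<Rightarrow> (nat \<Rightarrow> real) \<Rightarrow> bool" where
  "best_ar c p a \<longleftrightarrow> is_arg_min (ar_error c p) (\<lambda>b. \<forall>j. j \<notin> {1..p} \<longrightarrow> b j = 0) a"

text \<open>If \<open>a\<close> is the best AR(\<open>p\<close>) coefficient vector, then \<open>ar_error c p a\<close> is \<open>\<sigma>\<^sub>p\<^sup>2\<close> and
  \<open>ar_density c p a\<close> is \<open>f\<^sub>p\<close>.\<close>

definition ar_density :: "(int \<Rightarrow> real) \<Rightarrow> nat \<Rightarrow> (nat \<Rightarrow> real) \<Rightarrow> real \<Rightarrow> real" where
  "ar_density c p a \<omega> = ar_error c p a / (cmod (ar_filter p a \<omega>))\<^sup>2"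

text \<open>For \<open>l \<ge> p\<close> the truncated difference \<open>p - l\<close> makes the sum empty, as required.\<close>

definition ar_tail :: "nat \<Rightarrow> (nat \<Rightarrow> real) \<Rightarrow> nat \<Rightarrow> real \<Rightarrow> complex" where
  "ar_tail p a l \<omega> = (\<Sum>s=1..p - l. complex_of_real (a (l + s)) * cis (real s * \<omega>))"

end

theory Submission
  imports Defs "HOL-Real_Asymp.Real_Asymp"
begin

text \<open>The argument takes place in the convolution algebra of absolutely summable sequences on
  \<open>\<int>\<close>, with the weighted norms \<open>\<Sum>(1 + |r|)\<^sup>K |x\<^sub>r|\<close>. Wiener's lemma, proved through the
  spectral radius of \<open>1 - f / M\<close>, shows that the factor \<open>\<phi>\<close> has finite weighted norm: it solves
  \<open>(c * \<phi>)\<^sub>n = 0\<close> for \<open>n > 0\<close>, and an approximate inverse of \<open>f\<close> turns this into a contractive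
  fixed point equation. Baxter's inequality then gives \<open>\<Sum>\<^sub>j |\<phi>\<^sub>p\<^sub>,\<^sub>j - \<phi>\<^sub>j| = O(p\<^sup>-\<^sup>K)\<close> and
  \<open>\<sigma>\<^sub>p\<^sup>2 - \<sigma>\<^sup>2 = O(p\<^sup>-\<^sup>K)\<close>. Writing \<open>1 / f = |\<phi>|\<^sup>2 / \<sigma>\<^sup>2\<close>, we have
  \<open>H = \<phi> (\<phi>\<^sup>* G + \<Sum>\<^sub>l g\<^sub>l \<phi>\<^sub>l\<^sup>*) / \<sigma>\<^sup>2\<close>, and similarly for \<open>H\<^sub>p\<close>; the difference is estimated using
  \<open>\<Sum>\<^sub>l |\<phi>\<^sub>l - \<phi>\<^sup>(\<^sup>p\<^sup>)\<^sub>l| \<le> \<Sum>\<^sub>j j |\<phi>\<^sub>j - \<phi>\<^sub>p\<^sub>,\<^sub>j| = O(p\<^sup>1\<^sup>-\<^sup>K)\<close>.\<close>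

section \<open>The convolution algebra of absolutely summable sequences\<close>

text \<open>The factorization is given only in the L2 sense. Its coefficients are a priori just
  bounded, so convolution is first studied for one summable and one bounded factor. The infimum of f
  enters Wiener's lemma through |1 - f / M| <= 1 - m / M < 1. The obstacle there is that the
  weighted norm is larger than the sup norm; powers help because a trigonometric polynomial of
  degree d has a k-th power with only 2 d k + 1 coefficients, so the price is polynomial in k
  against a geometric gain. The condition K > 1 acts twice: p^(-K) <= 1 / p makes the tail of phi
  small enough for Baxter's inequality beyond an explicit p0, and it makes the first moment of the
  coefficients finite, which bounds the sums over l by sup |g_s|. The power of p lost in the first
  error term is the weight j <= p. The series over l converge only in L2, so estimates are made for
  partial sums and passed to the limit, in L2 or pointwise along a common subsequence. Finally, the
  constant has to be chosen before the factorization; uniqueness of the factorization inside the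
  algebra makes this possible.\<close>

no_notation Infinite_Set_Sum.abs_summable_on (infix "abs'_summable'_on" 50)

definition conv :: "(int \<Rightarrow> complex) \<Rightarrow> (int \<Rightarrow> complex) \<Rightarrow> int \<Rightarrow> complex" where
  "conv a b n = (\<Sum>\<^sub>\<infinity>k. a k * b (n - k))"

lemma bij_minus_int: "bij_betw (\<lambda>n::int. n - k) UNIV UNIV"
  by (rule bij_betwI[where g = "\<lambda>n. n + k"]) auto

lemma bij_minus_left_int: "bij_betw (\<lambda>k::int. n - k) UNIV UNIV"
  by (rule bij_betwI[where g = "\<lambda>k. n - k"]) auto

text \<open>Shearing (k, n) to (k, n - k) turns the double series into a product of two single ones.
  This is the Fubini hypothesis for \<open>infsum_conv_pairs\<close> and for associativity.\<close>

lemma abs_summable_conv_pairs: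
  fixes a b :: "int \<Rightarrow> 'a :: {real_normed_div_algebra, banach}"
  assumes a: "a abs_summable_on UNIV" and b: "b abs_summable_on UNIV"
  shows "(\<lambda>(k, n). a k * b (n - k)) abs_summable_on UNIV \<times> UNIV"
proof -
  have 1: "(\<lambda>n. norm (b (n - k))) summable_on UNIV" for k
    using summable_on_reindex_bij_betw[OF bij_minus_int, of "\<lambda>n. norm (b n)"] b by simp
  have 2: "(\<Sum>\<^sub>\<infinity>n. norm (b (n - k))) = (\<Sum>\<^sub>\<infinity>n. norm (b n))" for k
    by (rule infsum_reindex_bij_betw[OF bij_minus_int])
  show ?thesis
    unfolding Infinite_Sum.abs_summable_on_Sigma_iff using a 1
    by (auto simp: norm_mult summable_on_cmult_right infsum_cmult_right' 2 infsum_nonneg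
          intro!: summable_on_cmult_left)
qed

lemma infsum_conv_pairs:
  fixes a b :: "int \<Rightarrow> 'a :: {real_normed_field, banach}"
  assumes a: "a abs_summable_on UNIV" and b: "b abs_summable_on UNIV"
  shows "((\<lambda>n. \<Sum>\<^sub>\<infinity>k. a k * b (n - k)) has_sum (\<Sum>\<^sub>\<infinity>k. a k) * (\<Sum>\<^sub>\<infinity>n. b n)) UNIV"
proof -
  have s: "(\<lambda>(k, n). a k * b (n - k)) summable_on UNIV \<times> UNIV"
    using abs_summable_conv_pairs[OF a b] by (rule abs_summable_summable)
  have s': "(\<lambda>(n, k). a k * b (n - k)) summable_on UNIV \<times> UNIV"
    using s by (subst summable_on_swap) (simp add: case_prod_unfold)
  have "(\<lambda>n. \<Sum>\<^sub>\<infinity>k. a k * b (n - k)) summable_on UNIV"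
    using summable_on_Sigma_banach[OF s'] by simp
  moreover have "(\<Sum>\<^sub>\<infinity>n. \<Sum>\<^sub>\<infinity>k. a k * b (n - k)) = (\<Sum>\<^sub>\<infinity>k. \<Sum>\<^sub>\<infinity>n. a k * b (n - k))"
    by (rule infsum_swap_banach) (fact s')
  moreover have "(\<Sum>\<^sub>\<infinity>n. a k * b (n - k)) = a k * (\<Sum>\<^sub>\<infinity>n. b n)" for k
    using infsum_reindex_bij_betw[OF bij_minus_int, of b k] by (simp add: infsum_cmult_right')
  ultimately show ?thesis
    by (simp add: has_sum_iff infsum_cmult_left')
qed

text \<open>The second factor is only bounded because convolution must apply to the coefficients of
  an L2 function before their summability is known.\<close>

lemma summable_conv_bounded:
  assumes a: "a abs_summable_on UNIV" and x: "\<And>n. norm (x n) \<le> B"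
  shows "(\<lambda>k. a k * x (n - k)) abs_summable_on (UNIV :: int set)"
    and "norm (conv a x n) \<le> (\<Sum>\<^sub>\<infinity>k. norm (a k)) * B"
proof -
  have s: "(\<lambda>k. norm (a k) * B) summable_on UNIV"
    by (rule summable_on_cmult_left[OF a])
  have le: "norm (a k * x (n - k)) \<le> norm (a k) * B" for k
    by (simp add: norm_mult mult_left_mono x)
  show 1: "(\<lambda>k. a k * x (n - k)) abs_summable_on (UNIV :: int set)"
    by (rule Infinite_Sum.abs_summable_on_comparison_test'[OF s le])
  have "norm (conv a x n) \<le> (\<Sum>\<^sub>\<infinity>k. norm (a k) * B)"
    unfolding conv_def
    by (rule norm_infsum_le[OF has_sum_infsum[OF abs_summable_summable[OF 1]] has_sum_infsum[OF s] le])
  then show "norm (conv a x n) \<le> (\<Sum>\<^sub>\<infinity>k. norm (a k)) * B"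
    by (simp add: infsum_cmult_left')
qed

lemma conv_commute: "conv a b = conv b a"
proof
  fix n
  show "conv a b n = conv b a n"
    unfolding conv_def
    using infsum_reindex_bij_betw[OF bij_minus_left_int[of n], of "\<lambda>k. a k * b (n - k)"]
    by (simp add: mult.commute)
qed

text \<open>A bounded factor keeps the double series of \<open>a\<close> and \<open>b\<close>
  summable, so the order of summation may change. Bounded \<open>x\<close> serves to apply an
  approximate inverse to the equation for the coefficients of phi; summable \<open>x\<close> gives
  the ring law.\<close>

lemma conv_assoc_bounded:
  assumes a: "a abs_summable_on UNIV" and b: "b abs_summable_on UNIV" and x: "\<And>n. norm (x n) \<le> B"
  shows "conv a (conv b x) = conv (conv a b) x"
proof
  fix n
  have B: "0 \<le> B" using x[of 0] norm_ge_zero order_trans by blast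
  have s: "(\<lambda>(k, i). (a k * b (i - k)) * x (n - i)) summable_on UNIV \<times> UNIV"
  proof (rule abs_summable_summable, rule Infinite_Sum.abs_summable_on_comparison_test')
    show "(\<lambda>p. norm (case p of (k, i) \<Rightarrow> a k * b (i - k)) * B) summable_on UNIV \<times> UNIV"
      by (rule summable_on_cmult_left[OF abs_summable_conv_pairs[OF a b]])
  qed (auto simp: norm_mult intro!: mult_left_mono x)
  have "conv a (conv b x) n = (\<Sum>\<^sub>\<infinity>k. a k * (\<Sum>\<^sub>\<infinity>i. b (i - k) * x (n - i)))"
    unfolding conv_def
    using infsum_reindex_bij_betw[OF bij_minus_int, of "\<lambda>j. b j * x (n - k - j)" k for k]
    by (simp add: algebra_simps)
  also have "\<dots> = (\<Sum>\<^sub>\<infinity>k. \<Sum>\<^sub>\<infinity>i. a k * b (i - k) * x (n - i))"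
    by (simp add: infsum_cmult_right' mult.assoc)
  also have "\<dots> = (\<Sum>\<^sub>\<infinity>i. \<Sum>\<^sub>\<infinity>k. a k * b (i - k) * x (n - i))"
    by (rule infsum_swap_banach[OF s])
  also have "\<dots> = conv (conv a b) x n"
    by (simp add: conv_def infsum_cmult_left')
  finally show "conv a (conv b x) n = conv (conv a b) x n" .
qed

lemma abs_summable_bounded:
  assumes "(a :: int \<Rightarrow> complex) abs_summable_on UNIV"
  shows "norm (a n) \<le> (\<Sum>\<^sub>\<infinity>k. norm (a k))"
  using finite_sum_le_infsum[OF assms, of "{n}"] by auto

lemma abs_summable_conv:
  assumes a: "a abs_summable_on UNIV" and b: "b abs_summable_on UNIV"
  shows "conv a b abs_summable_on UNIV"
proof -
  have na: "(\<lambda>n. norm (a n)) abs_summable_on UNIV" and nb: "(\<lambda>n. norm (b n)) abs_summable_on UNIV"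
    using a b by auto
  note s = summable_on_swap[THEN iffD1, OF abs_summable_conv_pairs[OF a b]]
  have "norm (conv a b n) \<le> (\<Sum>\<^sub>\<infinity>k. norm (a k) * norm (b (n - k)))" for n
  proof -
    have "(\<lambda>k. a k * b (n - k)) abs_summable_on UNIV"
      by (rule summable_conv_bounded(1)[OF a abs_summable_bounded[OF b]])
    then show ?thesis
      unfolding conv_def using norm_infsum_bound[of "\<lambda>k. a k * b (n - k)" UNIV] by (simp add: norm_mult)
  qed
  then show ?thesis
    using infsum_conv_pairs[OF na nb]
    by (intro Infinite_Sum.abs_summable_on_comparison_test'[of "\<lambda>n. \<Sum>\<^sub>\<infinity>k. norm (a k) * norm (b (n - k))"])
       (auto simp: has_sum_iff)
qed

lemma abs_summable_add:
  fixes a b :: "'b \<Rightarrow> 'a :: {real_normed_vector, banach}"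
  assumes "a abs_summable_on A" "b abs_summable_on A"
  shows "(\<lambda>n. a n + b n) abs_summable_on A"
  by (rule Infinite_Sum.abs_summable_on_comparison_test'[OF summable_on_add[OF assms]])
     (simp add: norm_triangle_ineq)

section \<open>The commutative ring of absolutely summable sequences\<close>

typedef l1 = "{a :: int \<Rightarrow> complex. a abs_summable_on UNIV}"
  morphisms cf Abs_l1
  by (rule exI[of _ "\<lambda>_. 0"]) simp

setup_lifting type_definition_l1

lemma cf_summable: "cf x abs_summable_on UNIV"
  using cf[of x] by simp

lemma l1_eqI: "(\<And>n. cf x n = cf y n) \<Longrightarrow> x = y"
  by (simp add: cf_inject[symmetric] fun_eq_iff)

definition delta :: "int \<Rightarrow> int \<Rightarrow> complex" where
  "delta m n = (if n = m then 1 else 0)"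

lemma abs_summable_finite_support:
  fixes a :: "'b \<Rightarrow> 'a :: {real_normed_vector, banach}"
  assumes "finite S" "\<And>n. n \<notin> S \<Longrightarrow> a n = 0"
  shows "a abs_summable_on UNIV"
  using assms by (intro finite_nonzero_values_imp_summable_on finite_subset[OF _ assms(1)]) auto

instantiation l1 :: comm_ring_1
begin

no_notation Infinite_Set_Sum.abs_summable_on (infix "abs'_summable'_on" 50)

lift_definition zero_l1 :: l1 is "\<lambda>_. 0" by simp
lift_definition one_l1 :: l1 is "delta 0"
  by (rule abs_summable_finite_support[of "{0}"]) (auto simp: delta_def)
lift_definition plus_l1 :: "l1 \<Rightarrow> l1 \<Rightarrow> l1" is "\<lambda>a b n. a n + b n"
  by (rule abs_summable_add)
lift_definition uminus_l1 :: "l1 \<Rightarrow> l1" is "\<lambda>a n. - a n" by simp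
lift_definition minus_l1 :: "l1 \<Rightarrow> l1 \<Rightarrow> l1" is "\<lambda>a b n. a n - b n"
  subgoal for a b using abs_summable_add[of a UNIV "\<lambda>n. - b n"] by simp
  done
lift_definition times_l1 :: "l1 \<Rightarrow> l1 \<Rightarrow> l1" is conv
  by (rule abs_summable_conv)

lemma conv_delta: "conv (delta m) a n = a (n - m)"
proof -
  have "conv (delta m) a n = (\<Sum>\<^sub>\<infinity>k\<in>{m}. delta m k * a (n - k))"
    unfolding conv_def by (rule infsum_cong_neutral) (auto simp: delta_def)
  then show ?thesis by (simp add: delta_def)
qed

instance
proof
  fix a b c :: l1
  show "a * b * c = a * (b * c)"
    by transfer (metis conv_assoc_bounded abs_summable_bounded)
  show "a * b = b * a"
    by transfer (rule conv_commute)
  show "1 * a = a"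
    by transfer (auto simp: conv_delta)
  show "(a + b) * c = a * c + b * c"
  proof (transfer, rule ext)
    fix a b c :: "int \<Rightarrow> complex" and n
    assume s: "a abs_summable_on UNIV" "b abs_summable_on UNIV" "c abs_summable_on UNIV"
    show "conv (\<lambda>n. a n + b n) c n = conv a c n + conv b c n"
      unfolding conv_def
      using infsum_add[OF abs_summable_summable[OF summable_conv_bounded(1)[OF s(1) abs_summable_bounded[OF s(3)], where n = n]]
          abs_summable_summable[OF summable_conv_bounded(1)[OF s(2) abs_summable_bounded[OF s(3)], where n = n]]]
      by (simp add: distrib_right)
  qed
  show "0 \<noteq> (1::l1)"
    by transfer (auto simp: delta_def fun_eq_iff)
qed (transfer; auto)+

end

lemma cf_simps [simp]:
  "cf 0 n = 0" "cf 1 n = (if n = 0 then 1 else 0)" "cf (x + y) n = cf x n + cf y n"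
  "cf (x - y) n = cf x n - cf y n" "cf (- x) n = - cf x n"
  by (transfer; simp add: delta_def)+

lemma cf_times: "cf (x * y) n = conv (cf x) (cf y) n"
  by transfer simp

lemma cf_sum: "cf (sum f A) n = (\<Sum>i\<in>A. cf (f i) n)"
  by (induction A rule: infinite_finite_induct) auto

lift_definition scale :: "complex \<Rightarrow> l1 \<Rightarrow> l1" is "\<lambda>c a n. c * a n"
  by (auto simp: norm_mult intro: summable_on_cmult_right)

lift_definition proj :: "int set \<Rightarrow> l1 \<Rightarrow> l1" is "\<lambda>S a n. if n \<in> S then a n else 0"
  subgoal for S a
    by (rule Infinite_Sum.abs_summable_on_comparison_test[of a]) auto
  done

text \<open>On the circle this is complex conjugation (\<open>ev_star\<close>); in the algebra it
  exchanges sequences supported on nonnegative and on nonpositive indices.\<close>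

lift_definition star :: "l1 \<Rightarrow> l1" is "\<lambda>a n. cnj (a (- n))"
  subgoal for a
    using summable_on_reindex_bij_betw[OF bij_minus_left_int[of 0], of "\<lambda>n. norm (a n)"] by simp
  done

lift_definition harmonic :: "int \<Rightarrow> l1" is delta
  subgoal for m
    by (rule abs_summable_finite_support[of "{m}"]) (auto simp: delta_def)
  done

lemma cf_scale [simp]: "cf (scale c x) n = c * cf x n"
  and cf_proj [simp]: "cf (proj S x) n = (if n \<in> S then cf x n else 0)"
  and cf_star [simp]: "cf (star x) n = cnj (cf x (- n))"
  and cf_harmonic [simp]: "cf (harmonic m) n = (if n = m then 1 else 0)"
  by (transfer; simp add: delta_def)+

lemma scale_mult_left: "scale c x * y = scale c (x * y)"
  by (rule l1_eqI) (simp add: cf_times conv_def mult.assoc infsum_cmult_right')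

lemma scale_mult_right: "x * scale c y = scale c (x * y)"
  by (metis scale_mult_left mult.commute)

lemma star_mult: "star (x * y) = star x * star y"
proof (rule l1_eqI)
  fix n
  show "cf (star (x * y)) n = cf (star x * star y) n"
    using infsum_reindex_bij_betw[OF bij_minus_left_int[of 0], of "\<lambda>k. cnj (cf x k) * cnj (cf y (- n - k))"]
    by (simp add: cf_times conv_def flip: infsum_cnj)
qed

lemma star_star [simp]: "star (star x) = x"
  and star_one [simp]: "star 1 = 1"
  and star_scale: "star (scale c x) = scale (cnj c) (star x)"
  by (rule l1_eqI; simp)+

lemma cf_harmonic_times: "cf (harmonic m * x) n = cf x (n - m)"
  by (simp add: cf_times harmonic.rep_eq conv_delta)

lemma cf_times_eq_0:
  assumes "\<And>k. cf x k = 0 \<or> cf y (n - k) = 0"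
  shows "cf (x * y) n = 0"
  unfolding cf_times conv_def using assms by (intro infsum_0) auto

lemma cf_times_single:
  assumes "\<And>k. k \<noteq> m \<Longrightarrow> cf x k = 0 \<or> cf y (n - k) = 0"
  shows "cf (x * y) n = cf x m * cf y (n - m)"
proof -
  have "(\<Sum>\<^sub>\<infinity>k. cf x k * cf y (n - k)) = (\<Sum>\<^sub>\<infinity>k\<in>{m}. cf x k * cf y (n - k))"
    using assms by (intro infsum_cong_neutral) auto
  then show ?thesis by (simp add: cf_times conv_def)
qed

section \<open>Weighted norms and their submultiplicativity\<close>

definition weight :: "real \<Rightarrow> int \<Rightarrow> real" where
  "weight K n = (1 + \<bar>real_of_int n\<bar>) powr K"

definition wsum :: "real \<Rightarrow> l1 \<Rightarrow> bool" where
  "wsum K x \<longleftrightarrow> (\<lambda>n. weight K n * norm (cf x n)) summable_on UNIV"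

text \<open>An \<open>infsum\<close> without summability is 0, so a bound on \<open>wnorm\<close>
  carries information only together with \<open>wsum\<close>; at exponent 0 the latter is
  automatic.\<close>

definition wnorm :: "real \<Rightarrow> l1 \<Rightarrow> real" where
  "wnorm K x = (\<Sum>\<^sub>\<infinity>n. weight K n * norm (cf x n))"

lemma weight_nonneg [simp]: "weight K n \<ge> 0"
  by (simp add: weight_def)

lemma weight_ge_1: "K \<ge> 0 \<Longrightarrow> weight K n \<ge> 1"
  by (auto simp: weight_def intro: ge_one_powr_ge_zero)

lemma weight_0 [simp]: "weight 0 n = 1"
  by (auto simp: weight_def)

text \<open>Here 1 + |n| is preferable to |n|: 1 + |m + n| <= (1 + |m|) (1 + |n|), and the weight is
  at least 1 also at index 0, so that weighted norms dominate the unweighted one.\<close>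

lemma weight_submult:
  assumes "K \<ge> 0"
  shows "weight K (m + n) \<le> weight K m * weight K n"
proof -
  have "1 + \<bar>real_of_int (m + n)\<bar> \<le> (1 + \<bar>real_of_int m\<bar>) * (1 + \<bar>real_of_int n\<bar>)"
    by (simp add: algebra_simps) (smt (verit) mult_nonneg_nonneg abs_ge_zero)
  then have "weight K (m + n) \<le> ((1 + \<bar>real_of_int m\<bar>) * (1 + \<bar>real_of_int n\<bar>)) powr K"
    unfolding weight_def by (intro powr_mono2) (use assms in auto)
  then show ?thesis by (simp add: weight_def powr_mult)
qed

lemma wsum_0 [simp]: "wsum 0 x"
  using cf_summable[of x] by (simp add: wsum_def)

lemma wsumI_finite:
  assumes "finite S" "\<And>n. n \<notin> S \<Longrightarrow> cf x n = 0"
  shows "wsum K x" "wnorm K x = (\<Sum>n\<in>S. weight K n * norm (cf x n))"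
proof -
  have "((\<lambda>n. weight K n * norm (cf x n)) has_sum (\<Sum>n\<in>S. weight K n * norm (cf x n))) UNIV"
    using assms by (intro has_sum_finite_neutralI[of S]) auto
  then show "wsum K x" "wnorm K x = (\<Sum>n\<in>S. weight K n * norm (cf x n))"
    by (auto simp: wsum_def wnorm_def has_sum_iff)
qed

lemma wnorm_nonneg [simp]: "wnorm K x \<ge> 0"
  unfolding wnorm_def by (rule infsum_nonneg) simp

lemma cf_le_wnorm: "wsum K x \<Longrightarrow> weight K n * norm (cf x n) \<le> wnorm K x"
  unfolding wnorm_def wsum_def
  using finite_sum_le_infsum[of "\<lambda>n. weight K n * norm (cf x n)" UNIV "{n}"] by auto

lemma wsum_mono:
  assumes "wsum K y" "\<And>n. norm (cf x n) \<le> norm (cf y n)"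
  shows "wsum K x" "wnorm K x \<le> wnorm K y"
proof -
  show *: "wsum K x"
    unfolding wsum_def
    by (rule summable_on_comparison_test[OF assms(1)[unfolded wsum_def]]) (auto intro: mult_left_mono assms)
  show "wnorm K x \<le> wnorm K y"
    unfolding wnorm_def using * assms by (intro infsum_mono) (auto simp: wsum_def intro: mult_left_mono)
qed

text \<open>The weight at n is at most the product of the weights at k and n - k, so the weighted
  convolution is dominated by the plain convolution of the weighted sequences.\<close>

lemma wsum_mult:
  assumes K: "K \<ge> 0" and x: "wsum K x" and y: "wsum K y"
  shows "wsum K (x * y)" "wnorm K (x * y) \<le> wnorm K x * wnorm K y"
proof -
  define a where "a n = weight K n * norm (cf x n)" for n
  define b where "b n = weight K n * norm (cf y n)" for n
  have sa: "a abs_summable_on UNIV" and sb: "b abs_summable_on UNIV"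
    using x y by (auto simp: a_def b_def wsum_def)
  have hs: "((\<lambda>n. \<Sum>\<^sub>\<infinity>k. a k * b (n - k)) has_sum wnorm K x * wnorm K y) UNIV"
    using infsum_conv_pairs[OF sa sb] by (simp add: a_def b_def wnorm_def)
  have sk: "(\<lambda>k. a k * b (n - k)) summable_on UNIV" for n
  proof (rule summable_on_comparison_test)
    show "(\<lambda>k. a k * wnorm K y) summable_on UNIV"
      using sa by (intro summable_on_cmult_left) (simp add: a_def)
    show "a k * b (n - k) \<le> a k * wnorm K y" for k
      using cf_le_wnorm[OF y] by (intro mult_left_mono) (auto simp: a_def b_def)
  qed (simp add: a_def b_def)
  have le: "weight K n * norm (cf (x * y) n) \<le> (\<Sum>\<^sub>\<infinity>k. a k * b (n - k))" for n
  proof -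
    have s: "(\<lambda>k. weight K n * norm (cf x k * cf y (n - k))) summable_on UNIV"
      by (intro summable_on_cmult_right
          summable_conv_bounded(1)[OF cf_summable abs_summable_bounded[OF cf_summable]])
    have "weight K n * norm (cf (x * y) n) \<le> weight K n * (\<Sum>\<^sub>\<infinity>k. norm (cf x k * cf y (n - k)))"
      unfolding cf_times conv_def
      by (intro mult_left_mono norm_infsum_bound
          summable_conv_bounded(1)[OF cf_summable abs_summable_bounded[OF cf_summable]]) simp
    also have "\<dots> = (\<Sum>\<^sub>\<infinity>k. weight K n * norm (cf x k * cf y (n - k)))"
      by (simp add: infsum_cmult_right')
    also have "\<dots> \<le> (\<Sum>\<^sub>\<infinity>k. a k * b (n - k))"
    proof (rule infsum_mono[OF s sk])
      fix k
      show "weight K n * norm (cf x k * cf y (n - k)) \<le> a k * b (n - k)"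
        using mult_right_mono[OF weight_submult[OF K, of k "n - k"], of "norm (cf x k * cf y (n - k))"]
        by (simp add: a_def b_def norm_mult algebra_simps)
    qed
    finally show ?thesis .
  qed
  show 1: "wsum K (x * y)"
    unfolding wsum_def
    by (rule summable_on_comparison_test[OF has_sum_imp_summable[OF hs] le]) simp
  show "wnorm K (x * y) \<le> wnorm K x * wnorm K y"
    unfolding wnorm_def[of K "x * y"] infsumI[OF hs, symmetric]
    by (rule infsum_mono[OF 1[unfolded wsum_def] has_sum_imp_summable[OF hs] le])
qed

lemma wsum_add:
  assumes x: "wsum K x" and y: "wsum K y"
  shows "wsum K (x + y)" "wnorm K (x + y) \<le> wnorm K x + wnorm K y"
proof -
  have le: "weight K n * norm (cf (x + y) n) \<le> weight K n * norm (cf x n) + weight K n * norm (cf y n)" for n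
    using mult_left_mono[OF norm_triangle_ineq[of "cf x n" "cf y n"], of "weight K n"]
    by (simp add: algebra_simps)
  note s = summable_on_add[OF x[unfolded wsum_def] y[unfolded wsum_def]]
  show 1: "wsum K (x + y)"
    unfolding wsum_def by (rule summable_on_comparison_test[OF s le]) simp
  have "wnorm K (x + y) \<le> (\<Sum>\<^sub>\<infinity>n. weight K n * norm (cf x n) + weight K n * norm (cf y n))"
    unfolding wnorm_def by (rule infsum_mono[OF 1[unfolded wsum_def] s le])
  then show "wnorm K (x + y) \<le> wnorm K x + wnorm K y"
    unfolding wnorm_def using infsum_add[OF x[unfolded wsum_def] y[unfolded wsum_def]] by simp
qed

lemma wsum_uminus: "wsum K (- x) \<longleftrightarrow> wsum K x" "wnorm K (- x) = wnorm K x"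
  by (simp_all add: wsum_def wnorm_def)

lemma wsum_diff:
  assumes x: "wsum K x" and y: "wsum K y"
  shows "wsum K (x - y)" "wnorm K (x - y) \<le> wnorm K x + wnorm K y"
  using wsum_add[of K x "- y"] assms by (simp_all add: wsum_uminus)

lemma wsum_scale:
  shows "wsum K x \<Longrightarrow> wsum K (scale c x)" "wnorm K (scale c x) = norm c * wnorm K x"
proof -
  have eq: "weight K n * norm (cf (scale c x) n) = norm c * (weight K n * norm (cf x n))" for n
    by (simp add: norm_mult)
  show "wsum K x \<Longrightarrow> wsum K (scale c x)"
    unfolding wsum_def eq by (rule summable_on_cmult_right)
  show "wnorm K (scale c x) = norm c * wnorm K x"
    unfolding wnorm_def eq by (rule infsum_cmult_right')
qed

lemma wsum_one [simp]: "wsum K 1" "wnorm K 1 = 1"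
  using wsumI_finite[of "{0}" 1 K] by (auto simp: weight_def)

lemma wsum_zero [simp]: "wsum K 0" "wnorm K 0 = 0"
  using wsumI_finite[of "{}" 0 K] by auto

lemma wsum_power:
  assumes "K \<ge> 0" "wsum K x"
  shows "wsum K (x ^ n)" "wnorm K (x ^ n) \<le> wnorm K x ^ n"
proof (induction n)
  case (Suc n)
  { case 1 show ?case using wsum_mult(1)[OF assms(1,2) Suc(1)] by simp }
  { case 2 show ?case
      using order_trans[OF wsum_mult(2)[OF assms(1,2) Suc(1)] mult_left_mono[OF Suc(2)]] by simp }
qed auto

lemma wsum_sum:
  assumes "\<And>i. i \<in> A \<Longrightarrow> wsum K (f i)"
  shows "wsum K (sum f A)" "wnorm K (sum f A) \<le> (\<Sum>i\<in>A. wnorm K (f i))"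
proof -
  have "wsum K (sum f A) \<and> wnorm K (sum f A) \<le> (\<Sum>i\<in>A. wnorm K (f i))"
    using assms
    by (induction A rule: infinite_finite_induct)
       (auto intro: wsum_add(1) intro!: order_trans[OF wsum_add(2)])
  then show "wsum K (sum f A)" "wnorm K (sum f A) \<le> (\<Sum>i\<in>A. wnorm K (f i))" by auto
qed

lemma wsum_proj: "wsum K x \<Longrightarrow> wsum K (proj S x)"
  and wnorm_proj: "wsum K x \<Longrightarrow> wnorm K (proj S x) \<le> wnorm K x"
  using wsum_mono[of K x "proj S x"] by auto

lemma wnorm_star [simp]: "wnorm K (star x) = wnorm K x"
  using infsum_reindex_bij_betw[OF bij_minus_left_int[of 0], of "\<lambda>n. weight K n * norm (cf x n)"]
  by (simp add: wnorm_def weight_def)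

text \<open>Density of trigonometric polynomials in the weighted norm, which allows truncation in
  both halves of Wiener's lemma.\<close>

lemma wnorm_proj_tendsto:
  assumes "wsum K x"
  shows "(\<lambda>d::nat. wnorm K (x - proj {- int d..int d} x)) \<longlonglongrightarrow> 0"
proof (rule LIMSEQ_I)
  fix e :: real assume e: "e > 0"
  let ?f = "\<lambda>n. weight K n * norm (cf x n)"
  have s: "?f summable_on UNIV" using assms by (simp add: wsum_def)
  obtain F where F: "finite F" "dist (sum ?f F) (infsum ?f UNIV) \<le> e / 2"
    using infsum_finite_approximation[OF s, of "e/2"] e by auto
  have "norm (wnorm K (x - proj {- int d..int d} x) - 0) < e" if d: "d \<ge> nat (Max (insert 0 (abs ` F)))" for d
  proof -
    have FD: "F \<subseteq> {- int d..int d}"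
    proof
      fix k assume "k \<in> F"
      then have "\<bar>k\<bar> \<le> Max (insert 0 (abs ` F))" using F by (intro Max_ge) auto
      then show "k \<in> {- int d..int d}" using d by auto
    qed
    let ?D = "{- int d..int d}"
    have "wnorm K (x - proj ?D x) = (\<Sum>\<^sub>\<infinity>n\<in>- ?D. ?f n)"
      unfolding wnorm_def by (rule infsum_cong_neutral) auto
    also have "\<dots> = infsum ?f UNIV - sum ?f ?D"
      using infsum_Un_disjoint[of ?f ?D "- ?D"] s summable_on_subset[OF s]
      by (simp add: Compl_partition2[symmetric] Compl_partition)
    also have "\<dots> \<le> infsum ?f UNIV - sum ?f F"
      using FD F by (intro diff_left_mono sum_mono2) auto
    also have "\<dots> < e" using F(2) e by (auto simp: dist_real_def abs_if split: if_splits)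
    finally show ?thesis by simp
  qed
  then show "\<exists>no. \<forall>n\<ge>no. norm (wnorm K (x - proj {- int n..int n} x) - 0) < e" by blast
qed

section \<open>Fourier series of summable sequences\<close>

definition ev :: "l1 \<Rightarrow> real \<Rightarrow> complex" where
  "ev x \<omega> = (\<Sum>\<^sub>\<infinity>n. cf x n * cis (real_of_int n * \<omega>))"

lemma ev_has_sum: "((\<lambda>n. cf x n * cis (real_of_int n * \<omega>)) has_sum ev x \<omega>) UNIV"
  unfolding ev_def
  by (rule has_sum_infsum, rule abs_summable_summable) (use cf_summable[of x] in \<open>simp add: norm_mult\<close>)

lemma ev_mult: "ev (x * y) \<omega> = ev x \<omega> * ev y \<omega>"
proof -
  define a where "a n = cf x n * cis (real_of_int n * \<omega>)" for n
  define b where "b n = cf y n * cis (real_of_int n * \<omega>)" for n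
  have s: "a abs_summable_on UNIV" "b abs_summable_on UNIV"
    using cf_summable[of x] cf_summable[of y] by (auto simp: a_def b_def norm_mult)
  have "a k * b (n - k) = cf x k * cf y (n - k) * cis (real_of_int n * \<omega>)" for n k
  proof -
    have "cis (real_of_int k * \<omega>) * cis (real_of_int (n - k) * \<omega>) = cis (real_of_int n * \<omega>)"
      by (simp add: cis_mult algebra_simps)
    then show ?thesis by (simp add: a_def b_def mult_ac)
  qed
  then have eq: "(\<Sum>\<^sub>\<infinity>k. a k * b (n - k)) = cf (x * y) n * cis (real_of_int n * \<omega>)" for n
    by (simp add: cf_times conv_def infsum_cmult_left')
  have "infsum a UNIV = ev x \<omega>" "infsum b UNIV = ev y \<omega>"
    by (simp_all add: ev_def a_def[abs_def] b_def[abs_def])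
  then show ?thesis
    using infsumI[OF infsum_conv_pairs[OF s]] unfolding eq by (simp only: ev_def[of "x * y"])
qed

lemma ev_simps [simp]:
  "ev 0 \<omega> = 0" "ev 1 \<omega> = 1" "ev (x + y) \<omega> = ev x \<omega> + ev y \<omega>" "ev (- x) \<omega> = - ev x \<omega>"
  "ev (x - y) \<omega> = ev x \<omega> - ev y \<omega>" "ev (scale c x) \<omega> = c * ev x \<omega>"
proof -
  have "(\<Sum>\<^sub>\<infinity>n. cf 1 n * cis (real_of_int n * \<omega>)) = (\<Sum>\<^sub>\<infinity>n\<in>{0::int}. 1)"
    by (rule infsum_cong_neutral) auto
  then show "ev 1 \<omega> = 1" by (simp add: ev_def)
  show add: "ev (x + y) \<omega> = ev x \<omega> + ev y \<omega>" for x y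
    using has_sum_add[OF ev_has_sum[of x \<omega>] ev_has_sum[of y \<omega>]]
    unfolding ev_def[of "x + y"] by (intro infsumI) (simp add: distrib_right)
  show um: "ev (- x) \<omega> = - ev x \<omega>" for x
    by (simp add: ev_def infsum_uminus)
  show "ev (x - y) \<omega> = ev x \<omega> - ev y \<omega>"
    using add[of x "- y"] um[of y] by simp
  show "ev (scale c x) \<omega> = c * ev x \<omega>"
    by (simp add: ev_def mult.assoc infsum_cmult_right')
qed (simp add: ev_def)

lemma ev_power: "ev (x ^ n) \<omega> = ev x \<omega> ^ n"
  by (induction n) (auto simp: ev_mult)

lemma norm_ev_le: "norm (ev x \<omega>) \<le> wnorm 0 x"
  unfolding wnorm_def
  by (rule norm_infsum_le[OF ev_has_sum has_sum_infsum])
     (use cf_summable[of x] in \<open>auto simp: norm_mult\<close>)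

lemma ev_star: "ev (star x) \<omega> = cnj (ev x \<omega>)"
proof -
  have "cnj (ev x \<omega>) = (\<Sum>\<^sub>\<infinity>n. cnj (cf x n) * cis (- (real_of_int n * \<omega>)))"
    by (simp add: ev_def cis_cnj flip: infsum_cnj)
  also have "\<dots> = (\<Sum>\<^sub>\<infinity>n. cnj (cf x (- n)) * cis (real_of_int n * \<omega>))"
    using infsum_reindex_bij_betw[OF bij_minus_left_int[of 0], of "\<lambda>n. cnj (cf x n) * cis (- (real_of_int n * \<omega>))"]
    by simp
  finally show ?thesis by (simp add: ev_def)
qed

lemma ev_finite:
  assumes "finite S" "\<And>n. n \<notin> S \<Longrightarrow> cf x n = 0"
  shows "ev x \<omega> = (\<Sum>n\<in>S. cf x n * cis (real_of_int n * \<omega>))"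
proof -
  have "ev x \<omega> = (\<Sum>\<^sub>\<infinity>n\<in>S. cf x n * cis (real_of_int n * \<omega>))"
    unfolding ev_def by (rule infsum_cong_neutral) (use assms in auto)
  then show ?thesis using assms by simp
qed

lemma ev_harmonic [simp]: "ev (harmonic m) \<omega> = cis (real_of_int m * \<omega>)"
  by (subst ev_finite[of "{m}"]) auto

lemma ev_proj_tendsto: "(\<lambda>d::nat. ev (proj {- int d..int d} x) \<omega>) \<longlonglongrightarrow> ev x \<omega>"
proof -
  have "(\<lambda>d::nat. ev (x - proj {- int d..int d} x) \<omega>) \<longlonglongrightarrow> 0"
  proof (rule Lim_null_comparison)
    show "\<forall>\<^sub>F d in sequentially. norm (ev (x - proj {- int d..int d} x) \<omega>) \<le> wnorm 0 (x - proj {- int d..int d} x)"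
      by (intro always_eventually allI norm_ev_le)
  qed (intro wnorm_proj_tendsto wsum_0)
  from tendsto_minus[OF this] have "(\<lambda>d::nat. ev (proj {- int d..int d} x) \<omega> - ev x \<omega>) \<longlonglongrightarrow> 0"
    by simp
  then show ?thesis by (rule LIM_zero_cancel)
qed

section \<open>Integration over the circle\<close>

lemma space_circle: "space circle = {0..<2 * pi}"
  by (simp add: circle_def)

lemma circle_lmeasurable: "{0..<2 * pi} \<in> lmeasurable"
  by (rule bounded_set_imp_lmeasurable) auto

interpretation circle: finite_measure circle
  unfolding circle_def by (rule finite_measure_lebesgue_on[OF circle_lmeasurable])

lemma measure_circle: "measure circle (space circle) = 2 * pi"
  by (simp add: circle_def measure_restrict_space)

lemma borel_measurable_circle: "f \<in> borel_measurable borel \<Longrightarrow> f \<in> borel_measurable circle"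
  unfolding circle_def
  by (intro measurable_restrict_space1 measurable_completion) simp

lemma cis_measurable_circle [measurable]: "(\<lambda>\<omega>. cis (a * \<omega>)) \<in> borel_measurable circle"
  by (intro borel_measurable_circle borel_measurable_continuous_onI continuous_intros)

lemma integral_cis_circle: "(\<integral>\<omega>. cis (real_of_int k * \<omega>) \<partial>circle) = (if k = 0 then 2 * pi else 0)"
proof (cases "k = 0")
  case True
  then show ?thesis using measure_circle by (simp add: complex_eq_iff)
next
  case False
  let ?F = "\<lambda>\<omega>. cis (real_of_int k * \<omega>) / (\<i> * real_of_int k)"
  have d: "(?F has_vector_derivative cis (real_of_int k * \<omega>)) (at \<omega> within S)" for \<omega> S
  proof -
    have "((\<lambda>z. exp (\<i> * real_of_int k * z) / (\<i> * real_of_int k)) has_field_derivative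
        exp (\<i> * real_of_int k * complex_of_real \<omega>)) (at (complex_of_real \<omega>))"
      using False by (auto intro!: derivative_eq_intros)
    from has_vector_derivative_real_field[OF this] show ?thesis
      by (simp add: cis_conv_exp mult.assoc)
  qed
  have "((\<lambda>\<omega>. cis (real_of_int k * \<omega>)) has_integral (?F (2 * pi) - ?F 0)) {0..2 * pi}"
    by (rule fundamental_theorem_of_calculus[OF _ d]) simp
  moreover have "cis (real_of_int k * (2 * pi)) = 1"
    using cis_multiple_2pi[of "real_of_int k"] by (simp add: mult_ac)
  ultimately have "((\<lambda>\<omega>. cis (real_of_int k * \<omega>)) has_integral 0) {0..2 * pi}"
    by simp
  then have "((\<lambda>\<omega>. cis (real_of_int k * \<omega>)) has_integral 0) {0..<2 * pi}"
    by (subst has_integral_spike_set_eq[of _ "{0..2 * pi}"])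
       (auto intro: negligible_subset[of "{2 * pi}"])
  moreover have "integrable circle (\<lambda>\<omega>. cis (real_of_int k * \<omega>))"
    by (rule circle.integrable_const_bound[of _ 1]) auto
  ultimately show ?thesis
    using lebesgue_integral_eq_integral[of "{0..<2*pi}" "\<lambda>\<omega>. cis (real_of_int k * \<omega>)"] False
    by (simp add: circle_def integral_unique)
qed

lemma ev_measurable_circle [measurable]: "ev x \<in> borel_measurable circle"
proof (rule borel_measurable_LIMSEQ_metric)
  fix d :: nat
  show "ev (proj {- int d..int d} x) \<in> borel_measurable circle"
  proof -
    have "ev (proj {- int d..int d} x) = (\<lambda>\<omega>. \<Sum>n\<in>{- int d..int d}. cf (proj {- int d..int d} x) n * cis (real_of_int n * \<omega>))"
      by (rule ext, rule ev_finite) auto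
    then show ?thesis by simp
  qed
qed (rule ev_proj_tendsto)

lemma integrable_ev [simp]: "integrable circle (ev x)"
  by (rule circle.integrable_const_bound[of _ "wnorm 0 x"]) (auto intro: norm_ev_le)

lemma integral_ev: "(\<integral>\<omega>. ev x \<omega> \<partial>circle) = 2 * pi * cf x 0"
proof -
  have fin: "(\<integral>\<omega>. ev (proj {- int d..int d} x) \<omega> \<partial>circle) = 2 * pi * cf x 0" for d :: nat
  proof -
    have i: "integrable circle (\<lambda>\<omega>. cf x n * cis (real_of_int n * \<omega>))" for n
      by (rule circle.integrable_const_bound[of _ "norm (cf x n)"]) (auto simp: norm_mult)
    have "(\<integral>\<omega>. ev (proj {- int d..int d} x) \<omega> \<partial>circle)
        = (\<Sum>n\<in>{- int d..int d}. \<integral>\<omega>. cf x n * cis (real_of_int n * \<omega>) \<partial>circle)"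
      by (subst ev_finite[of "{- int d..int d}"]) (auto simp: i)
    also have "\<dots> = (\<Sum>n\<in>{- int d..int d}. if n = 0 then 2 * pi * cf x n else 0)"
      by (intro sum.cong) (auto simp: integral_cis_circle)
    finally show ?thesis by simp
  qed
  have "(\<lambda>d::nat. \<integral>\<omega>. ev (proj {- int d..int d} x) \<omega> \<partial>circle) \<longlonglongrightarrow> (\<integral>\<omega>. ev x \<omega> \<partial>circle)"
  proof (rule integral_dominated_convergence)
    show "AE \<omega> in circle. norm (ev (proj {- int d..int d} x) \<omega>) \<le> wnorm 0 x" for d
      using order_trans[OF norm_ev_le wnorm_proj[of 0 x]] by auto
  qed (auto intro: ev_proj_tendsto)
  then show ?thesis
    unfolding fin by (simp add: LIMSEQ_const_iff)
qed

lemma cf_eq_integral: "2 * pi * cf x n = (\<integral>\<omega>. ev x \<omega> * cis (- real_of_int n * \<omega>) \<partial>circle)"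
  using integral_ev[of "harmonic (- n) * x"] by (simp add: cf_harmonic_times ev_mult mult.commute[of "cis _"])

text \<open>A coefficient is a mean of \<open>ev x\<close> against a unimodular function. Sup bounds
  behave multiplicatively under powers, and this turns them into coefficient bounds.\<close>

lemma norm_cf_le:
  assumes "\<And>\<omega>. norm (ev x \<omega>) \<le> B"
  shows "norm (cf x n) \<le> B"
proof -
  have "2 * pi * norm (cf x n) = norm (\<integral>\<omega>. ev x \<omega> * cis (- real_of_int n * \<omega>) \<partial>circle)"
    unfolding cf_eq_integral[symmetric] by (simp add: norm_mult)
  also have "\<dots> \<le> (\<integral>\<omega>. norm (ev x \<omega> * cis (- real_of_int n * \<omega>)) \<partial>circle)"
    by (rule integral_norm_bound)
  also have "\<dots> \<le> (\<integral>\<omega>. B \<partial>circle)"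
    by (intro integral_mono) (auto simp: norm_mult assms)
  also have "\<dots> = 2 * pi * B" by (simp add: measure_circle)
  finally show ?thesis by simp
qed

section \<open>Wiener's lemma\<close>

lemma poly_times_power_tendsto_0:
  fixes d :: nat and K q :: real
  assumes "0 < q" "q < 1" "d > 0"
  shows "(\<lambda>n::nat. (2 * real d * real n + 1) * ((1 + real d * real n) powr K * q ^ n)) \<longlonglongrightarrow> 0"
proof -
  define D where "D = real d"
  have "D > 0" using assms by (simp add: D_def)
  then show ?thesis using assms(1,2) unfolding D_def[symmetric] by real_asymp
qed

lemma wnorm_0_le:
  assumes "K \<ge> 0" "wsum K x"
  shows "wnorm 0 x \<le> wnorm K x"
  unfolding wnorm_def
  by (rule infsum_mono[OF wsum_0[unfolded wsum_def] assms(2)[unfolded wsum_def]])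
     (use mult_right_mono[OF weight_ge_1[OF assms(1)]] in force)

lemma of_nat_times: "of_nat m * x = scale (of_nat m) (x :: l1)"
  by (induction m) (auto intro!: l1_eqI simp: algebra_simps)

lemma cf_power_eq_0:
  assumes "\<And>n. \<bar>n\<bar> > int d \<Longrightarrow> cf v n = 0" "\<bar>n\<bar> > int (d * k)"
  shows "cf (v ^ k) n = 0"
  using assms(2)
proof (induction k arbitrary: n)
  case (Suc k)
  have "cf (v * v ^ k) n = 0"
  proof (rule cf_times_eq_0)
    fix j
    show "cf v j = 0 \<or> cf (v ^ k) (n - j) = 0"
    proof (cases "\<bar>j\<bar> > int d")
      case False
      then have "\<bar>n - j\<bar> > int (d * k)" using Suc.prems by (simp add: algebra_simps)
      then show ?thesis using Suc.IH by blast
    qed (use assms(1) in blast)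
  qed
  then show ?case by simp
qed auto

text \<open>The k-th power has degree at most d k, hence at most 2 d k + 1 nonzero coefficients;
  each is at most \<rho>^k by the sup bound and carries a weight of at most (1 + d k)^K.\<close>

lemma wnorm_trig_power_le:
  assumes K: "K \<ge> 0" and v: "\<And>n. \<bar>n\<bar> > int d \<Longrightarrow> cf v n = 0"
    and ev: "\<And>\<omega>. norm (ev v \<omega>) \<le> \<rho>"
  shows "wnorm K (v ^ k) \<le> (2 * real d * real k + 1) * ((1 + real d * real k) powr K * \<rho> ^ k)"
proof -
  let ?S = "{- int (d * k)..int (d * k)}"
  have "wnorm K (v ^ k) = (\<Sum>n\<in>?S. weight K n * norm (cf (v ^ k) n))"
    by (rule wsumI_finite) (auto intro: cf_power_eq_0[OF v])
  also have "\<dots> \<le> (\<Sum>n\<in>?S. (1 + real d * real k) powr K * \<rho> ^ k)"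
  proof (intro sum_mono mult_mono)
    fix n assume n: "n \<in> ?S"
    then have "\<bar>n\<bar> \<le> int (d * k)" by auto
    then have "\<bar>real_of_int n\<bar> \<le> real (d * k)"
      by (metis of_int_abs of_int_le_iff of_int_of_nat_eq)
    then show "weight K n \<le> (1 + real d * real k) powr K"
      unfolding weight_def using K by (intro powr_mono2) auto
    show "norm (cf (v ^ k) n) \<le> \<rho> ^ k"
      by (intro norm_cf_le) (auto simp: ev_power norm_power intro!: power_mono ev)
  qed auto
  also have "\<dots> = (2 * real d * real k + 1) * ((1 + real d * real k) powr K * \<rho> ^ k)"
    by simp
  finally show ?thesis .
qed

text \<open>Split u = v + r with v a trigonometric polynomial and r small in the weighted norm, and
  expand the power binomially. Powers of v cost only a polynomial factor over the sup norm, powers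
  of r are geometric.\<close>

lemma wnorm_power_tendsto_0:
  assumes K: "K \<ge> 0" and u: "wsum K u" and ev: "\<And>\<omega>. norm (ev u \<omega>) \<le> \<rho>" and \<rho>: "\<rho> < 1"
  shows "(\<lambda>n. wnorm K (u ^ n)) \<longlonglongrightarrow> 0"
proof -
  have \<rho>0: "0 \<le> \<rho>" using ev[of 0] norm_ge_zero order_trans by blast
  \<comment> \<open>One e is spent on the sup norm of v, another on the norm of r; \<rho> + 2 e = (1
    + \<rho>) / 2 is still below 1.\<close>
  define e where "e = (1 - \<rho>) / 4"
  have e: "e > 0" "\<rho> + 2 * e < 1" using \<rho> by (auto simp: e_def field_simps)
  have "\<forall>\<^sub>F d in sequentially. wnorm K (u - proj {- int d..int d} u) < e"
    using wnorm_proj_tendsto[OF u] e(1) by (rule order_tendstoD)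
  then obtain d :: nat where d: "d > 0" "wnorm K (u - proj {- int d..int d} u) < e"
    using eventually_happens'[OF sequentially_bot eventually_conj[OF _ eventually_gt_at_top[of "0 :: nat"]]] by blast
  define v where "v = proj {- int d..int d} u"
  define r where "r = u - v"
  have wv: "wsum K v" and wr: "wsum K r" "wnorm K r \<le> e"
    using u d by (auto simp: v_def r_def intro: wsum_proj wsum_diff)
  have evv: "norm (ev v \<omega>) \<le> \<rho> + e" for \<omega>
  proof -
    have "norm (ev r \<omega>) \<le> e"
      using order_trans[OF norm_ev_le order_trans[OF wnorm_0_le[OF K wr(1)] wr(2)]] .
    moreover have eq: "ev v \<omega> = ev u \<omega> - ev r \<omega>" by (simp add: r_def)
    ultimately show ?thesis
      unfolding eq using norm_triangle_ineq4[of "ev u \<omega>" "ev r \<omega>"] ev[of \<omega>] by linarith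
  qed
  \<comment> \<open>The polynomial factor is nondecreasing in k, so its value at n can be pulled out
    of the binomial sum.\<close>
  define P where "P k = (2 * real d * real k + 1) * (1 + real d * real k) powr K" for k :: nat
  have vk: "wnorm K (v ^ k) \<le> P k * (\<rho> + e) ^ k" for k
  proof -
    have "cf v n = 0" if "\<bar>n\<bar> > int d" for n using that by (auto simp: v_def)
    then show ?thesis using wnorm_trig_power_le[OF K _ evv, of d k] by (simp add: P_def mult.assoc)
  qed
  have Pm: "P k \<le> P n" "0 \<le> P k" if "k \<le> n" for k n
    using that K unfolding P_def by (auto intro!: mult_mono powr_mono2 add_mono)
  have bound: "wnorm K (u ^ n) \<le> P n * (\<rho> + 2 * e) ^ n" for n
  proof -
    let ?t = "\<lambda>k. of_nat (n choose k) * v ^ k * r ^ (n - k)"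
    have t: "?t k = scale (of_nat (n choose k)) (v ^ k * r ^ (n - k))" for k
      by (simp add: of_nat_times scale_mult_left)
    have wt: "wsum K (?t k)" for k
      unfolding t by (intro wsum_scale wsum_mult wsum_power K wv wr)
    have "wnorm K (?t k) \<le> of_nat (n choose k) * (P n * (\<rho> + e) ^ k * e ^ (n - k))" if "k \<le> n" for k
    proof -
      have "wnorm K (?t k) = of_nat (n choose k) * wnorm K (v ^ k * r ^ (n - k))"
        unfolding t wsum_scale by simp
      also have "\<dots> \<le> of_nat (n choose k) * (wnorm K (v ^ k) * wnorm K (r ^ (n - k)))"
        by (intro mult_left_mono wsum_mult wsum_power K wv wr) auto
      also have "\<dots> \<le> of_nat (n choose k) * (P n * (\<rho> + e) ^ k * e ^ (n - k))"
      proof (intro mult_left_mono mult_mono)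
        show "wnorm K (v ^ k) \<le> P n * (\<rho> + e) ^ k"
          using order_trans[OF vk mult_right_mono[OF Pm(1)[OF that], of "(\<rho> + e) ^ k"]] \<rho>0 e by simp
        show "wnorm K (r ^ (n - k)) \<le> e ^ (n - k)"
          using order_trans[OF wsum_power(2)[OF K wr(1)] power_mono[OF wr(2)]] by simp
      qed (use \<rho>0 e Pm(2)[of n n] in auto)
      finally show ?thesis .
    qed
    then have "(\<Sum>k\<le>n. wnorm K (?t k)) \<le> (\<Sum>k\<le>n. of_nat (n choose k) * (P n * (\<rho> + e) ^ k * e ^ (n - k)))"
      by (intro sum_mono) auto
    also have "\<dots> = P n * ((\<rho> + e) + e) ^ n"
      unfolding binomial_ring[of "\<rho> + e" e n] sum_distrib_left by (simp add: mult_ac)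
    finally have "(\<Sum>k\<le>n. wnorm K (?t k)) \<le> P n * (\<rho> + 2 * e) ^ n" by (simp add: algebra_simps)
    moreover have "u ^ n = (\<Sum>k\<le>n. ?t k)"
      using binomial_ring[of v r n] by (simp add: r_def)
    ultimately show ?thesis
      using wsum_sum(2)[of "{..n}" K ?t, OF wt] by simp
  qed
  show ?thesis
  proof (rule Lim_null_comparison)
    show "\<forall>\<^sub>F n in sequentially. norm (wnorm K (u ^ n)) \<le> P n * (\<rho> + 2 * e) ^ n"
      using bound by simp
    show "(\<lambda>n. P n * (\<rho> + 2 * e) ^ n) \<longlonglongrightarrow> 0"
      using poly_times_power_tendsto_0[of "\<rho> + 2 * e" d K] e \<rho>0 d by (simp add: P_def mult.assoc)
  qed
qed

text \<open>A finite Neumann sum suffices: with u = 1 - C / M, the sum of u^k / M over k < n, times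
  C, is 1 - u^n. Half of the error budget 1 goes to u^n, half to cutting the sum down to a
  trigonometric polynomial, whose finite support is what a one-sided equation tolerates.\<close>

lemma approximate_inverse:
  assumes K: "K \<ge> 0" and C: "wsum K C" and ev: "\<And>\<omega>. ev C \<omega> = complex_of_real (f \<omega>)"
    and f: "\<And>\<omega>. m \<le> f \<omega>" "\<And>\<omega>. f \<omega> \<le> M" and m: "0 < m"
  obtains q d where "\<And>n. \<bar>n\<bar> > int d \<Longrightarrow> cf q n = 0" "wsum K q" "wnorm K (1 - q * C) < 1"
proof -
  have M: "m \<le> M" "M > 0" using f(1)[of 0] f(2)[of 0] m by auto
  define u where "u = 1 - scale (1 / M) C"
  have wu: "wsum K u" by (simp add: u_def wsum_diff wsum_scale C)
  have evu: "norm (ev u \<omega>) \<le> 1 - m / M" for \<omega>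
  proof -
    have "ev u \<omega> = complex_of_real (1 - f \<omega> / M)" by (simp add: u_def ev)
    then have "norm (ev u \<omega>) = \<bar>1 - f \<omega> / M\<bar>" by (simp only: norm_of_real)
    moreover have "f \<omega> / M \<le> 1" "m / M \<le> f \<omega> / M" using f M by (auto simp: divide_right_mono)
    ultimately show ?thesis by linarith
  qed
  have "(\<lambda>n. wnorm K (u ^ n)) \<longlonglongrightarrow> 0"
    by (rule wnorm_power_tendsto_0[OF K wu evu]) (use m M in auto)
  from order_tendstoD(2)[OF this, of "1 / 2"] obtain n where n: "wnorm K (u ^ n) < 1 / 2"
    using eventually_happens'[OF sequentially_bot] by force
  define q0 where "q0 = scale (1 / M) (\<Sum>k<n. u ^ k)"
  have wq0: "wsum K q0" unfolding q0_def by (intro wsum_scale wsum_sum wsum_power K wu)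
  have "scale (1 / M) C = 1 - u" by (simp add: u_def)
  have q0C: "q0 * C = 1 - u ^ n"
  proof -
    have "q0 * C = (\<Sum>k<n. u ^ k) * scale (1 / M) C"
      by (simp only: q0_def scale_mult_left scale_mult_right)
    then show ?thesis
      using \<open>scale (1 / M) C = 1 - u\<close> by (simp add: one_diff_power_eq mult.commute)
  qed
  have "(\<lambda>d::nat. wnorm K (q0 - proj {- int d..int d} q0) * wnorm K C) \<longlonglongrightarrow> 0 * wnorm K C"
    by (intro tendsto_intros wnorm_proj_tendsto wq0)
  from order_tendstoD(2)[OF this, of "1 / 2"]
  obtain d :: nat where d: "wnorm K (q0 - proj {- int d..int d} q0) * wnorm K C < 1 / 2"
    using eventually_happens'[OF sequentially_bot] by force
  define q where "q = proj {- int d..int d} q0"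
  have wq: "wsum K q" by (simp add: q_def wsum_proj wq0)
  have "1 - q * C = u ^ n + (q0 - q) * C"
    using q0C by (simp add: algebra_simps)
  also have "wnorm K \<dots> \<le> wnorm K (u ^ n) + wnorm K ((q0 - q) * C)"
    by (intro wsum_add wsum_power wsum_mult wsum_diff K wu C wq wq0)
  also have "wnorm K ((q0 - q) * C) \<le> wnorm K (q0 - q) * wnorm K C"
    by (intro wsum_mult wsum_diff K C wq wq0)
  also have "wnorm K (u ^ n) + wnorm K (q0 - q) * wnorm K C < 1"
    using n d by (simp add: q_def)
  finally have "wnorm K (1 - q * C) < 1" by simp
  then show ?thesis
    by (intro that[of d q] wq) (auto simp: q_def)
qed

lemma conv_diff_right:
  assumes x: "\<And>n. norm (x n) \<le> B" and y: "\<And>n. norm (y n) \<le> B'"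
  shows "conv (cf a) (\<lambda>n. x n - y n) n = conv (cf a) x n - conv (cf a) y n"
  unfolding conv_def
  using infsum_add[OF abs_summable_summable[OF summable_conv_bounded(1)[OF cf_summable[of a] x, where n = n]]
      summable_on_uminus[THEN iffD2, OF abs_summable_summable[OF summable_conv_bounded(1)[OF cf_summable[of a] y, where n = n]]]]
  by (simp add: infsum_uminus algebra_simps)

lemma conv_diff_left:
  assumes x: "\<And>n. norm (x n) \<le> B"
  shows "conv (cf (a - b)) x n = conv (cf a) x n - conv (cf b) x n"
  unfolding conv_def
  using infsum_add[OF abs_summable_summable[OF summable_conv_bounded(1)[OF cf_summable[of a] x, where n = n]]
      summable_on_uminus[THEN iffD2, OF abs_summable_summable[OF summable_conv_bounded(1)[OF cf_summable[of b] x, where n = n]]]]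
  by (simp add: infsum_uminus algebra_simps)

text \<open>Since \<open>x\<close> is only known to be bounded, the contraction cannot be applied to
  it in the weighted norm. Instead the iterates \<open>X N\<close> have uniformly bounded weighted
  norms and converge to \<open>x\<close> pointwise; a Fatou argument over finite sets transfers the
  bound.\<close>

lemma weighted_summable_fixpoint:
  fixes d :: nat
  assumes K: "K \<ge> 0" and e: "wsum K e" "wnorm K e < 1" and x: "\<And>n. norm (x n) \<le> B"
    and x0: "\<And>n. n < 0 \<Longrightarrow> x n = 0" and fp: "\<And>n. n > int d \<Longrightarrow> x n = conv (cf e) x n"
  shows "(\<lambda>n. weight K n * norm (x n)) summable_on UNIV"
proof -
  define \<theta> where "\<theta> = wnorm K e"
  have \<theta>: "0 \<le> \<theta>" "\<theta> < 1" using e by (auto simp: \<theta>_def)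
  have B: "0 \<le> B" using x[of 0] norm_ge_zero order_trans by blast
  \<comment> \<open>On 0..d no equation is available, so these values of \<open>x\<close> enter as a
    fixed inhomogeneous term.\<close>
  define y where "y = (\<Sum>n\<in>{0..int d}. scale (x n) (harmonic n))"
  have cfy: "cf y n = (if n \<in> {0..int d} then x n else 0)" for n
    by (simp add: y_def cf_sum if_distrib cong: if_cong)
  have wy: "wsum K y" by (rule wsumI_finite[of "{0..int d}"]) (auto simp: cfy)
  define X where "X = rec_nat y (\<lambda>_ z. y + proj {int d<..} (e * z))"
  have X: "X 0 = y" "X (Suc N) = y + proj {int d<..} (e * X N)" for N
    by (simp_all add: X_def)
  have wX: "wsum K (X N)" for N
    by (induction N) (auto simp: X intro!: wy wsum_add wsum_proj wsum_mult K e)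
  \<comment> \<open>The bound solves t = \<open>wnorm K y\<close> + \<theta> t, so it is preserved
    by the iteration.\<close>
  have bX: "wnorm K (X N) \<le> wnorm K y / (1 - \<theta>)" for N
  proof (induction N)
    case 0
    have "wnorm K y * (1 - \<theta>) \<le> wnorm K y * 1" using \<theta> by (intro mult_left_mono) auto
    then show ?case using \<theta> by (simp add: X field_simps)
  next
    case (Suc N)
    have "wnorm K (X (Suc N)) \<le> wnorm K y + wnorm K (proj {int d<..} (e * X N))"
      unfolding X by (intro wsum_add wy wsum_proj wsum_mult K e wX)
    also have "wnorm K (proj {int d<..} (e * X N)) \<le> wnorm K (e * X N)"
      by (intro wnorm_proj wsum_mult K e wX)
    also have "\<dots> \<le> \<theta> * wnorm K (X N)" unfolding \<theta>_def by (intro wsum_mult K e wX)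
    also have "\<dots> \<le> \<theta> * (wnorm K y / (1 - \<theta>))" by (intro mult_left_mono Suc \<theta>)
    also have "wnorm K y + \<theta> * (wnorm K y / (1 - \<theta>)) = wnorm K y / (1 - \<theta>)"
      using \<theta> by (simp add: field_simps)
    finally show ?case by simp
  qed
  \<comment> \<open>Convergence is measured in the sup norm, the one in which \<open>x\<close> is
    known to be finite; \<open>e\<close> contracts there as well, because its unweighted norm is at
    most \<theta>.\<close>
  have diff: "norm (x n - cf (X N) n) \<le> \<theta> ^ N * B" for n N
  proof (induction N arbitrary: n)
    case 0
    show ?case using x[of n] B by (simp add: X cfy)
  next
    case (Suc N)
    show ?case
    proof (cases "n > int d")
      case True
      have "x n - cf (X (Suc N)) n = conv (cf e) x n - conv (cf e) (cf (X N)) n"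
        using True fp by (simp add: X cfy cf_times)
      also have "\<dots> = conv (cf e) (\<lambda>n. x n - cf (X N) n) n"
        by (rule conv_diff_right[OF x abs_summable_bounded[OF cf_summable], symmetric])
      also have "norm \<dots> \<le> wnorm 0 e * (\<theta> ^ N * B)"
        using summable_conv_bounded(2)[OF cf_summable Suc] by (simp add: wnorm_def)
      also have "\<dots> \<le> \<theta> * (\<theta> ^ N * B)"
        unfolding \<theta>_def by (intro mult_right_mono wnorm_0_le K e) (use B in auto)
      finally show ?thesis by simp
    next
      case False
      then have "x n - cf (X (Suc N)) n = 0" using x0[of n] by (simp add: X cfy)
      then show ?thesis using B \<theta> by simp
    qed
  qed
  have lim: "(\<lambda>N. cf (X N) n) \<longlonglongrightarrow> x n" for n
  proof (rule LIM_zero_cancel, rule Lim_null_comparison)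
    show "\<forall>\<^sub>F N in sequentially. norm (cf (X N) n - x n) \<le> \<theta> ^ N * B"
      using diff by (simp add: norm_minus_commute)
    have "(\<lambda>N. \<theta> ^ N * B) \<longlonglongrightarrow> 0 * B"
      using \<theta> by (intro tendsto_intros LIMSEQ_realpow_zero) auto
    then show "(\<lambda>N. \<theta> ^ N * B) \<longlonglongrightarrow> 0" by simp
  qed
  have "(\<Sum>n\<in>F. weight K n * norm (x n)) \<le> wnorm K y / (1 - \<theta>)" if F: "finite F" for F
  proof (rule LIMSEQ_le_const2)
    show "(\<lambda>N. \<Sum>n\<in>F. weight K n * norm (cf (X N) n)) \<longlonglongrightarrow> (\<Sum>n\<in>F. weight K n * norm (x n))"
      by (intro tendsto_intros lim)
    have "(\<Sum>n\<in>F. weight K n * norm (cf (X N) n)) \<le> wnorm K (X N)" for N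
      unfolding wnorm_def using wX[unfolded wsum_def] F
      by (intro finite_sum_le_infsum) auto
    then show "\<exists>N. \<forall>n\<ge>N. (\<Sum>k\<in>F. weight K k * norm (cf (X n) k)) \<le> wnorm K y / (1 - \<theta>)"
      by (intro exI allI impI order_trans[OF _ bX])
  qed
  then show ?thesis
    by (intro nonneg_bdd_above_summable_on bdd_aboveI2[where M = "wnorm K y / (1 - \<theta>)"]) auto
qed

text \<open>Wiener's lemma in one-sided form: with an approximate inverse \<open>q\<close> of \<open>C\<close>, a trigonometric
  polynomial of degree \<open>d\<close>, the coefficients of \<open>q * C * x\<close> beyond \<open>d\<close> vanish, so there
  \<open>x = (1 - q * C) * x\<close>, a contraction in the weighted norm.\<close>

lemma weighted_summable_Toeplitz_kernel:
  assumes K: "K \<ge> 0" and C: "wsum K C" and ev: "\<And>\<omega>. ev C \<omega> = complex_of_real (f \<omega>)"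
    and f: "\<And>\<omega>. m \<le> f \<omega>" "\<And>\<omega>. f \<omega> \<le> M" and m: "0 < m"
    and x: "\<And>n. norm (x n) \<le> B" and x0: "\<And>n. n < 0 \<Longrightarrow> x n = 0"
    and eq: "\<And>n. n > 0 \<Longrightarrow> conv (cf C) x n = 0"
  shows "(\<lambda>n. weight K n * norm (x n)) summable_on UNIV"
proof -
  obtain q d where q: "\<And>n. \<bar>n\<bar> > int d \<Longrightarrow> cf q n = 0" "wsum K q" "wnorm K (1 - q * C) < 1"
    using approximate_inverse[OF K C ev f m] by metis
  show ?thesis
  proof (rule weighted_summable_fixpoint[OF K _ q(3) x x0])
    show "wsum K (1 - q * C)" by (intro wsum_diff wsum_mult wsum_one K C q)
    fix n assume n: "n > int d"
    have "conv (cf (q * C)) x n = conv (cf q) (conv (cf C) x) n"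
      by (simp add: times_l1.rep_eq conv_assoc_bounded[OF cf_summable cf_summable x])
    also have "\<dots> = 0"
      unfolding conv_def[of "cf q"]
    proof (rule infsum_0)
      fix k
      show "cf q k * conv (cf C) x (n - k) = 0"
        using q(1)[of k] eq[of "n - k"] n by (cases "\<bar>k\<bar> > int d") auto
    qed
    finally have "conv (cf (1 - q * C)) x n = conv (cf 1) x n"
      by (simp add: conv_diff_left[OF x])
    then show "x n = conv (cf (1 - q * C)) x n"
      by (simp add: one_l1.rep_eq conv_delta)
  qed
qed

section \<open>Baxter's inequality\<close>

abbreviation norm1 :: "l1 \<Rightarrow> real" where
  "norm1 \<equiv> wnorm 0"

lemma norm1_simps:
  "norm1 (x + y) \<le> norm1 x + norm1 y" "norm1 (x - y) \<le> norm1 x + norm1 y"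
  "norm1 (x * y) \<le> norm1 x * norm1 y" "norm1 (proj S x) \<le> norm1 x" "norm1 (- x) = norm1 x"
  "norm (cf x n) \<le> norm1 x"
  using cf_le_wnorm[of 0 x n]
  by (simp_all add: wsum_add wsum_diff wsum_mult wnorm_proj wsum_uminus)

text \<open>If the support of \<open>y\<close> prevents indices outside \<open>S'\<close> from being
  moved into \<open>S\<close>, only the part of \<open>x\<close> on \<open>S'\<close> contributes.
  In Baxter's inequality this lets only the tail of \<Phi> enter.\<close>

lemma norm1_proj_mult_le:
  assumes "\<And>k n. n \<in> S \<Longrightarrow> k \<notin> S' \<Longrightarrow> cf y (n - k) = 0"
  shows "norm1 (proj S (x * y)) \<le> norm1 (proj S' x) * norm1 y"
proof -
  have "proj S (x * y) = proj S (proj S' x * y)"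
  proof (rule l1_eqI)
    fix n
    have "cf ((x - proj S' x) * y) n = 0" if "n \<in> S"
      by (rule cf_times_eq_0) (use assms that in auto)
    then show "cf (proj S (x * y)) n = cf (proj S (proj S' x * y)) n"
      by (simp add: algebra_simps)
  qed
  then show ?thesis using norm1_simps(3,4) order_trans by metis
qed

text \<open>Given \<open>inverse\<close>, the last identity amounts to C = s \<Psi> star \<Psi>.
  Multiplied by \<Phi> it has the form that Fourier coefficients deliver, with a sequence supported
  on nonpositive indices on the right.\<close>

locale l1_factorization =
  fixes C \<Phi> \<Psi> :: l1 and s :: real
  assumes C_star: "star C = C" and s_pos: "s > 0"
    and \<Phi>_causal: "\<And>n. n < 0 \<Longrightarrow> cf \<Phi> n = 0" and \<Psi>_causal: "\<And>n. n < 0 \<Longrightarrow> cf \<Psi> n = 0"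
    and \<Phi>_0: "cf \<Phi> 0 = 1" and inverse: "\<Phi> * \<Psi> = 1" and C_\<Phi>: "C * \<Phi> = scale s (star \<Psi>)"
begin

lemma \<Psi>_0: "cf \<Psi> 0 = 1"
proof -
  have "cf (\<Phi> * \<Psi>) 0 = cf \<Phi> 0 * cf \<Psi> (0 - 0)"
    by (rule cf_times_single) (metis \<Phi>_causal \<Psi>_causal diff_0 linorder_cases neg_less_0_iff_less)
  then show ?thesis by (simp add: inverse \<Phi>_0)
qed

lemma star_inverse: "star \<Phi> * star \<Psi> = 1"
  using inverse by (metis star_mult star_one)

lemma C_star_\<Phi>: "C * star \<Phi> = scale s \<Psi>"
  using arg_cong[OF C_\<Phi>, of star] by (simp add: star_mult star_scale C_star)

end

text \<open>The product \<Phi>2 \<Psi>1 is supported on n >= 0 and is a multiple of a sequence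
  supported on n <= 0, so only index 0 survives, with value 1. This makes a constant obtained from
  one factorization valid for all.\<close>

lemma l1_factorization_unique:
  assumes 1: "l1_factorization C \<Phi>1 \<Psi>1 s1" and 2: "l1_factorization C \<Phi>2 \<Psi>2 s2"
  shows "\<Phi>1 = \<Phi>2" "\<Psi>1 = \<Psi>2" "s1 = s2"
proof -
  interpret F1: l1_factorization C \<Phi>1 \<Psi>1 s1 by fact
  interpret F2: l1_factorization C \<Phi>2 \<Psi>2 s2 by fact
  have "scale s1 (star \<Psi>1 * \<Phi>2) = scale s2 (star \<Psi>2 * \<Phi>1)"
    using F1.C_\<Phi> F2.C_\<Phi> by (metis mult.assoc mult.commute scale_mult_left)
  \<comment> \<open>The multiplier cancels star \<Psi>1 on the left and \<Phi>1 on the right,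
    leaving a one-sided sequence on each side.\<close>
  then have "scale s1 (star \<Psi>1 * \<Phi>2) * (star \<Phi>1 * \<Psi>1) = scale s2 (star \<Psi>2 * \<Phi>1) * (star \<Phi>1 * \<Psi>1)"
    by simp
  moreover have "scale s1 (star \<Psi>1 * \<Phi>2) * (star \<Phi>1 * \<Psi>1) = scale s1 ((star \<Phi>1 * star \<Psi>1) * (\<Phi>2 * \<Psi>1))"
    by (simp add: scale_mult_left scale_mult_right mult_ac)
  moreover have "scale s2 (star \<Psi>2 * \<Phi>1) * (star \<Phi>1 * \<Psi>1) = scale s2 ((\<Phi>1 * \<Psi>1) * (star \<Psi>2 * star \<Phi>1))"
    by (simp add: scale_mult_left scale_mult_right mult_ac)
  ultimately have eq: "scale s1 (\<Phi>2 * \<Psi>1) = scale s2 (star \<Psi>2 * star \<Phi>1)"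
    by (simp add: F1.inverse F1.star_inverse)
  have one: "\<Phi>2 * \<Psi>1 = 1"
  proof (rule l1_eqI)
    fix n :: int
    consider "n < 0" | "n > 0" | "n = 0" by linarith
    then show "cf (\<Phi>2 * \<Psi>1) n = cf 1 n"
    proof cases
      case 1
      have "cf (\<Phi>2 * \<Psi>1) n = 0"
        by (rule cf_times_eq_0) (use 1 F2.\<Phi>_causal F1.\<Psi>_causal in \<open>smt (verit)\<close>)
      then show ?thesis using 1 by simp
    next
      case 2
      have "cf (star \<Psi>2 * star \<Phi>1) n = 0"
        by (rule cf_times_eq_0) (use 2 F1.\<Phi>_causal F2.\<Psi>_causal in \<open>simp; smt (verit)\<close>)
      then have "cf (scale s1 (\<Phi>2 * \<Psi>1)) n = 0" unfolding eq by simp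
      then show ?thesis using 2 F1.s_pos by simp
    next
      case 3
      have "cf (\<Phi>2 * \<Psi>1) 0 = cf \<Phi>2 0 * cf \<Psi>1 (0 - 0)"
        by (rule cf_times_single) (metis F2.\<Phi>_causal F1.\<Psi>_causal diff_0 linorder_cases neg_less_0_iff_less)
      then show ?thesis using 3 by (simp add: F2.\<Phi>_0 F1.\<Psi>_0)
    qed
  qed
  show "\<Phi>1 = \<Phi>2"
    using one F1.inverse by (metis mult.assoc mult.commute mult_1)
  then show "\<Psi>1 = \<Psi>2"
    using one F2.inverse by (metis mult.assoc mult.commute mult_1)
  then have "scale s1 (star \<Psi>1) = scale s2 (star \<Psi>1)"
    using F1.C_\<Phi> F2.C_\<Phi> \<open>\<Phi>1 = \<Phi>2\<close> by simp
  then have "cf (scale s1 (star \<Psi>1)) 0 = cf (scale s2 (star \<Psi>1)) 0" by simp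
  then show "s1 = s2" by (simp add: F1.\<Psi>_0)
qed

context l1_factorization
begin

text \<open>Baxter's inequality. Write \<open>C * A = sp + U + V\<close> with \<open>U\<close> supported beyond \<open>p\<close> and \<open>V\<close> on the
  negative integers. Comparing supports in \<open>\<Phi> * (C * A)\<close> and \<open>star \<Phi> * (C * A)\<close> expresses \<open>U\<close>
  through \<open>V\<close> and \<open>V\<close> through \<open>U\<close>, each time with only the tail of \<open>\<Phi>\<close> beyond \<open>p\<close> involved.\<close>

lemma baxter:
  fixes p :: nat and sp :: real
  assumes A: "\<And>n. n \<notin> {0..int p} \<Longrightarrow> cf A n = 0" "cf A 0 = 1"
    and D: "cf (C * A) 0 = sp" "\<And>n. 1 \<le> n \<Longrightarrow> n \<le> int p \<Longrightarrow> cf (C * A) n = 0" and sp: "sp \<ge> 0"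
    and T: "T = norm1 (proj {int p<..} \<Phi>)" and small: "norm1 \<Psi> * T \<le> 1 / 2"
  defines "R \<equiv> 3 * norm1 \<Psi> * (1 + norm1 \<Psi> * norm1 \<Phi>) * sp * T"
  shows "norm1 (A - \<Phi>) \<le> 2 / s * norm1 \<Phi> * norm1 \<Phi> * R" "\<bar>sp - s\<bar> \<le> norm1 \<Phi> * R"
proof -
  define U where "U = proj {int p<..} (C * A)"
  define V where "V = proj {..<0} (C * A)"
  define e where "e = scale sp 1"
  have CA: "C * A = e + U + V"
    by (rule l1_eqI) (use D in \<open>auto simp: U_def V_def e_def\<close>)
  have norm_e: "norm1 e = sp" using sp by (simp add: e_def wsum_scale)
  have T0: "T \<ge> 0" by (simp add: T)
  have U_supp: "cf U n = 0" if "n \<le> int p" for n using that by (simp add: U_def)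
  have V_supp: "cf V n = 0" if "n \<ge> 0" for n using that by (simp add: V_def)
  have eqU: "\<Phi> * (C * A) = scale s (star \<Psi> * A)"
    using C_\<Phi> by (metis mult.assoc mult.commute scale_mult_left)
  have eqV: "star \<Phi> * (C * A) = scale s (\<Psi> * A)"
    using C_star_\<Phi> by (metis mult.assoc mult.commute scale_mult_left)
  \<comment> \<open>Above p the right side of \<open>eqU\<close> vanishes, as star \<Psi> only
    lowers indices and A stops at p. Up to p the product \<Phi> * U vanishes, as \<Phi> only raises
    them. Hence \<Phi> * U is determined by e + V.\<close>
  have "\<Phi> * U = - proj {int p<..} (\<Phi> * (e + V))"
  proof (rule l1_eqI)
    fix n
    show "cf (\<Phi> * U) n = cf (- proj {int p<..} (\<Phi> * (e + V))) n"
    proof (cases "n > int p")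
      case True
      have "cf (star \<Psi> * A) n = 0"
        by (rule cf_times_eq_0) (use True \<Psi>_causal A(1) in \<open>simp; smt (verit)\<close>)
      then have "cf (\<Phi> * (C * A)) n = 0" unfolding eqU by simp
      then have "cf (\<Phi> * e) n + cf (\<Phi> * U) n + cf (\<Phi> * V) n = 0" by (simp add: CA distrib_left)
      then show ?thesis using True by (simp add: distrib_left) algebra
    next
      case False
      have "cf (\<Phi> * U) n = 0"
        by (rule cf_times_eq_0) (use False \<Phi>_causal U_supp in \<open>smt (verit)\<close>)
      then show ?thesis using False by simp
    qed
  qed
  then have "\<Psi> * (\<Phi> * U) = - (\<Psi> * proj {int p<..} (\<Phi> * (e + V)))" by simp
  moreover have "\<Psi> * (\<Phi> * U) = U" using inverse by (metis mult.assoc mult.commute mult_1)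
  ultimately have U_eq: "U = - (\<Psi> * proj {int p<..} (\<Phi> * (e + V)))" by simp
  \<comment> \<open>The mirror image: \<Psi> * A has no negative indices, and star \<Phi> * V has no
    others.\<close>
  have "star \<Phi> * V = - proj {..<0} (star \<Phi> * (e + U))"
  proof (rule l1_eqI)
    fix n
    show "cf (star \<Phi> * V) n = cf (- proj {..<0} (star \<Phi> * (e + U))) n"
    proof (cases "n < 0")
      case True
      have "cf (\<Psi> * A) n = 0"
        by (rule cf_times_eq_0) (use True \<Psi>_causal A(1) in \<open>simp; smt (verit)\<close>)
      then have "cf (star \<Phi> * (C * A)) n = 0" unfolding eqV by simp
      then have "cf (star \<Phi> * e) n + cf (star \<Phi> * U) n + cf (star \<Phi> * V) n = 0"
        by (simp add: CA distrib_left)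
      then show ?thesis using True by (simp add: distrib_left) algebra
    next
      case False
      have "cf (star \<Phi> * V) n = 0"
        by (rule cf_times_eq_0) (use False \<Phi>_causal V_supp in \<open>simp; smt (verit)\<close>)
      then show ?thesis using False by simp
    qed
  qed
  then have "star \<Psi> * (star \<Phi> * V) = - (star \<Psi> * proj {..<0} (star \<Phi> * (e + U)))" by simp
  moreover have "star \<Psi> * (star \<Phi> * V) = V" using star_inverse by (metis mult.assoc mult.commute mult_1)
  ultimately have V_eq: "V = - (star \<Psi> * proj {..<0} (star \<Phi> * (e + U)))" by simp
  have nU: "norm1 U \<le> norm1 \<Psi> * (T * (sp + norm1 V))"
  proof -
    have "norm1 U \<le> norm1 \<Psi> * norm1 (proj {int p<..} (\<Phi> * (e + V)))"
      by (subst U_eq) (simp add: norm1_simps)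
    also have "norm1 (proj {int p<..} (\<Phi> * (e + V))) \<le> T * norm1 (e + V)"
      unfolding T by (rule norm1_proj_mult_le) (use V_supp in \<open>auto simp: e_def\<close>)
    also have "norm1 (e + V) \<le> sp + norm1 V" using norm1_simps(1)[of e V] norm_e by simp
    finally show ?thesis using T0 by (simp add: mult_left_mono)
  qed
  \<comment> \<open>To carry U, which lives above p, to a negative index, star \<Phi> must shift
    down by more than p.\<close>
  have tail: "norm1 (proj {..<- int p} (star \<Phi>)) = T"
  proof -
    have "proj {..<- int p} (star \<Phi>) = star (proj {int p<..} \<Phi>)"
      by (rule l1_eqI) auto
    then show ?thesis by (simp add: T)
  qed
  have nV: "norm1 V \<le> norm1 \<Psi> * (norm1 \<Phi> * sp + T * norm1 U)"
  proof -
    have "norm1 V \<le> norm1 \<Psi> * norm1 (proj {..<0} (star \<Phi> * (e + U)))"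
      by (subst V_eq) (use norm1_simps(3)[of "star \<Psi>"] in \<open>simp add: norm1_simps(5)\<close>)
    also have "proj {..<0} (star \<Phi> * (e + U)) = proj {..<0} (star \<Phi> * e) + proj {..<0} (star \<Phi> * U)"
      by (rule l1_eqI) (simp add: algebra_simps)
    also have "norm1 \<dots> \<le> norm1 (proj {..<0} (star \<Phi> * e)) + norm1 (proj {..<0} (star \<Phi> * U))"
      by (rule norm1_simps)
    also have "norm1 (proj {..<0} (star \<Phi> * e)) \<le> norm1 \<Phi> * sp"
      using order_trans[OF norm1_simps(4) norm1_simps(3)[of "star \<Phi>" e]] norm_e by simp
    also have "norm1 (proj {..<0} (star \<Phi> * U)) \<le> T * norm1 U"
      unfolding tail[symmetric] by (rule norm1_proj_mult_le) (use U_supp in auto)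
    finally show ?thesis by (simp add: mult_left_mono)
  qed
  let ?M = "norm1 \<Psi> * norm1 \<Phi> * sp"
  \<comment> \<open>The hypothesis \<open>small\<close> halves each occurrence of the other unknown,
    so the two bounds can be solved for the norms of U and V; the factor 3 in \<open>R\<close> comes
    from sp + |V| <= 3 (sp + \<open>?M\<close>).\<close>
  have "norm1 \<Psi> * T * norm1 U \<le> 1 / 2 * norm1 U" by (rule mult_right_mono[OF small]) simp
  then have nV': "norm1 V \<le> ?M + norm1 U / 2" using nV by (simp add: algebra_simps)
  have "norm1 \<Psi> * T * (sp + norm1 V) \<le> 1 / 2 * (sp + norm1 V)"
    by (rule mult_right_mono[OF small]) (use sp in simp)
  then have nU': "norm1 U \<le> (sp + norm1 V) / 2" 
    using nU by (simp only: mult.assoc[of "norm1 \<Psi>"])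
  have "0 \<le> ?M" using sp by simp
  with nU' nV' have "norm1 V \<le> 2 * (sp + ?M)" using sp by argo
  with \<open>0 \<le> ?M\<close> have "sp + norm1 V \<le> 3 * (sp + ?M)" by argo
  then have "norm1 \<Psi> * (T * (sp + norm1 V)) \<le> norm1 \<Psi> * (T * (3 * (sp + ?M)))"
    by (intro mult_left_mono T0) auto
  with nU have nUR: "norm1 U \<le> R" by (simp add: R_def algebra_simps)
  \<comment> \<open>If W vanished, s A would equal sp \<Phi>. The identity s A = \<Phi> * (e + W)
    bounds A - \<Phi>, and its coefficient at 0 reads s = sp + W_0, so W controls both
    errors.\<close>
  define W where "W = proj {0..} (star \<Phi> * U)"
  have nW: "norm1 W \<le> norm1 \<Phi> * R"
  proof -
    have "norm1 W \<le> norm1 \<Phi> * norm1 U"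
      unfolding W_def using order_trans[OF norm1_simps(4) norm1_simps(3)[of "star \<Phi>" U]] by simp
    also have "\<dots> \<le> norm1 \<Phi> * R" by (intro mult_left_mono nUR) simp
    finally show ?thesis .
  qed
  have "scale s (\<Psi> * A) = e + W"
  proof (rule l1_eqI)
    fix n :: int
    show "cf (scale s (\<Psi> * A)) n = cf (e + W) n"
    proof (cases "n < 0")
      case True
      have "cf (\<Psi> * A) n = 0"
        by (rule cf_times_eq_0) (use True \<Psi>_causal A(1) in \<open>simp; smt (verit)\<close>)
      then show ?thesis using True by (simp add: W_def e_def)
    next
      case False
      have "cf (star \<Phi> * V) n = 0"
        by (rule cf_times_eq_0) (use False \<Phi>_causal V_supp in \<open>simp; smt (verit)\<close>)
      moreover have "cf (star \<Phi> * e) n = cf e n"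
        using False \<Phi>_causal \<Phi>_0 by (cases "n = 0") (simp_all add: e_def scale_mult_right)
      ultimately show ?thesis
        unfolding eqV[symmetric] CA using False by (simp add: W_def algebra_simps)
    qed
  qed
  then have "\<Phi> * scale s (\<Psi> * A) = \<Phi> * (e + W)" by simp
  moreover have "\<Phi> * scale s (\<Psi> * A) = scale s A"
    using inverse by (metis mult.assoc mult_1 scale_mult_right)
  ultimately have sA: "scale s A = \<Phi> * (e + W)" by simp
  have "cf (\<Phi> * (e + W)) 0 = cf \<Phi> 0 * cf (e + W) (0 - 0)"
  proof (rule cf_times_single)
    fix k :: int assume "k \<noteq> 0"
    then show "cf \<Phi> k = 0 \<or> cf (e + W) (0 - k) = 0"
      using \<Phi>_causal[of k] by (cases "k < 0") (auto simp: e_def W_def)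
  qed
  then have s_eq: "complex_of_real s = sp + cf W 0"
    unfolding sA[symmetric] by (simp add: A \<Phi>_0 e_def)
  then have "cf W 0 = complex_of_real (s - sp)" by simp
  then have "\<bar>sp - s\<bar> = norm (cf W 0)" by (simp only: norm_of_real abs_minus_commute)
  also have "\<dots> \<le> norm1 W" by (rule norm1_simps)
  finally have ssp: "\<bar>sp - s\<bar> \<le> norm1 W" .
  then show "\<bar>sp - s\<bar> \<le> norm1 \<Phi> * R" using nW by linarith
  have "scale s (A - \<Phi>) = \<Phi> * (scale (complex_of_real (sp - s)) 1 + W)"
  proof -
    have "scale s (A - \<Phi>) = scale s A - scale s \<Phi>" by (rule l1_eqI) (simp add: algebra_simps)
    also have "\<dots> = \<Phi> * (e + W) - \<Phi> * scale s 1" by (simp add: sA scale_mult_right)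
    also have "\<dots> = \<Phi> * (e + W - scale s 1)" by (simp add: algebra_simps)
    also have "e + W - scale s 1 = scale (complex_of_real (sp - s)) 1 + W"
      by (rule l1_eqI) (simp add: e_def algebra_simps)
    finally show ?thesis .
  qed
  then have "s * norm1 (A - \<Phi>) = norm1 (\<Phi> * (scale (complex_of_real (sp - s)) 1 + W))"
    using s_pos wsum_scale(2)[of 0 s "A - \<Phi>"] by simp
  also have "\<dots> \<le> norm1 \<Phi> * norm1 (scale (complex_of_real (sp - s)) 1 + W)"
    by (rule norm1_simps)
  also have "\<dots> \<le> norm1 \<Phi> * (\<bar>sp - s\<bar> + norm1 W)"
    using norm1_simps(1)[of "scale (complex_of_real (sp - s)) 1" W]
    by (intro mult_left_mono) (simp_all add: wsum_scale flip: of_real_diff)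
  also have "\<dots> \<le> norm1 \<Phi> * (2 * (norm1 \<Phi> * R))"
    using ssp nW by (intro mult_left_mono) auto
  finally show "norm1 (A - \<Phi>) \<le> 2 / s * norm1 \<Phi> * norm1 \<Phi> * R"
    using s_pos by (simp add: field_simps)
qed

end

section \<open>Square-integrable functions on the circle\<close>

lemma L2_circleI_bounded:
  assumes "F \<in> borel_measurable circle" "\<And>\<omega>. norm (F \<omega>) \<le> B"
  shows "F \<in> L2_circle"
  unfolding L2_circle_def
proof safe
  show "integrable circle (\<lambda>\<omega>. (cmod (F \<omega>))\<^sup>2)"
    by (rule circle.integrable_const_bound[of _ "B\<^sup>2"]) (use assms in \<open>auto intro!: AE_I2 power_mono\<close>)
qed fact

lemma L2_circle_bounded_mult:
  assumes F: "F \<in> L2_circle" and B: "B \<in> borel_measurable circle" "AE \<omega> in circle. norm (B \<omega>) \<le> b"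
  shows "(\<lambda>\<omega>. B \<omega> * F \<omega>) \<in> L2_circle"
proof -
  have [measurable]: "F \<in> borel_measurable circle" "B \<in> borel_measurable circle"
    and i: "integrable circle (\<lambda>\<omega>. b\<^sup>2 * (cmod (F \<omega>))\<^sup>2)"
    using F B by (auto simp: L2_circle_def)
  have "integrable circle (\<lambda>\<omega>. (cmod (B \<omega> * F \<omega>))\<^sup>2)"
  proof (rule Bochner_Integration.integrable_bound[OF i])
    show "AE \<omega> in circle. norm ((cmod (B \<omega> * F \<omega>))\<^sup>2) \<le> norm (b\<^sup>2 * (cmod (F \<omega>))\<^sup>2)"
      using B(2)
    proof eventually_elim
      case (elim \<omega>)
      then have "(cmod (B \<omega>))\<^sup>2 \<le> b\<^sup>2" by (rule power_mono) simp
      then show ?case by (simp add: norm_mult power_mult_distrib mult_right_mono)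
    qed
  qed measurable
  then show ?thesis by (simp add: L2_circle_def)
qed

lemma norm_add_square_le: "(norm (x + y :: 'a :: real_normed_vector))\<^sup>2 \<le> 2 * (norm x)\<^sup>2 + 2 * (norm y)\<^sup>2"
proof -
  have "(norm (x + y))\<^sup>2 \<le> (norm x + norm y)\<^sup>2" by (intro power_mono norm_triangle_ineq) simp
  also have "\<dots> \<le> 2 * (norm x)\<^sup>2 + 2 * (norm y)\<^sup>2"
    using zero_le_power2[of "norm x - norm y"] by (simp add: power2_eq_square algebra_simps)
  finally show ?thesis .
qed

lemma L2_circle_add:
  assumes F: "F \<in> L2_circle" and G: "G \<in> L2_circle"
  shows "(\<lambda>\<omega>. F \<omega> + G \<omega>) \<in> L2_circle"
    and "(\<integral>\<omega>. (cmod (F \<omega> + G \<omega>))\<^sup>2 \<partial>circle)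
      \<le> 2 * (\<integral>\<omega>. (cmod (F \<omega>))\<^sup>2 \<partial>circle) + 2 * (\<integral>\<omega>. (cmod (G \<omega>))\<^sup>2 \<partial>circle)"
proof -
  have [measurable]: "F \<in> borel_measurable circle" "G \<in> borel_measurable circle"
    and i: "integrable circle (\<lambda>\<omega>. 2 * (cmod (F \<omega>))\<^sup>2 + 2 * (cmod (G \<omega>))\<^sup>2)"
    using F G by (auto simp: L2_circle_def)
  have j: "integrable circle (\<lambda>\<omega>. (cmod (F \<omega> + G \<omega>))\<^sup>2)"
    by (rule Bochner_Integration.integrable_bound[OF i]) (auto intro!: norm_add_square_le)
  then show "(\<lambda>\<omega>. F \<omega> + G \<omega>) \<in> L2_circle" by (simp add: L2_circle_def)
  have "(\<integral>\<omega>. (cmod (F \<omega> + G \<omega>))\<^sup>2 \<partial>circle) \<le> (\<integral>\<omega>. 2 * (cmod (F \<omega>))\<^sup>2 + 2 * (cmod (G \<omega>))\<^sup>2 \<partial>circle)"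
    by (rule integral_mono[OF j i norm_add_square_le])
  also have "\<dots> = 2 * (\<integral>\<omega>. (cmod (F \<omega>))\<^sup>2 \<partial>circle) + 2 * (\<integral>\<omega>. (cmod (G \<omega>))\<^sup>2 \<partial>circle)"
    using F G by (simp add: L2_circle_def)
  finally show "(\<integral>\<omega>. (cmod (F \<omega> + G \<omega>))\<^sup>2 \<partial>circle)
      \<le> 2 * (\<integral>\<omega>. (cmod (F \<omega>))\<^sup>2 \<partial>circle) + 2 * (\<integral>\<omega>. (cmod (G \<omega>))\<^sup>2 \<partial>circle)" .
qed

lemma L2_circle_uminus: "F \<in> L2_circle \<Longrightarrow> (\<lambda>\<omega>. - F \<omega>) \<in> L2_circle"
  by (simp add: L2_circle_def)

lemma L2_circle_diff: "F \<in> L2_circle \<Longrightarrow> G \<in> L2_circle \<Longrightarrow> (\<lambda>\<omega>. F \<omega> - G \<omega>) \<in> L2_circle"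
  using L2_circle_add(1)[of F "\<lambda>\<omega>. - G \<omega>"] L2_circle_uminus[of G] by simp

lemma L2_circle_cnj: "F \<in> L2_circle \<Longrightarrow> (\<lambda>\<omega>. cnj (F \<omega>)) \<in> L2_circle"
  by (auto simp: L2_circle_def intro!: borel_measurable_continuous_on[of cnj] continuous_intros)

lemma L2_circle_zero: "(\<lambda>\<omega>. 0) \<in> L2_circle"
  by (simp add: L2_circle_def)

lemma L2_circle_sum: "(\<And>j. j \<in> J \<Longrightarrow> u j \<in> L2_circle) \<Longrightarrow> (\<lambda>\<omega>. \<Sum>j\<in>J. u j \<omega>) \<in> L2_circle"
  by (induction J rule: infinite_finite_induct) (auto intro: L2_circle_add L2_circle_zero)

lemma L2_circle_ev: "ev x \<in> L2_circle"
  by (rule L2_circleI_bounded[OF ev_measurable_circle norm_ev_le])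

lemma L2_circle_cis: "(\<lambda>\<omega>. cis (a * \<omega>)) \<in> L2_circle"
  by (rule L2_circleI_bounded[of _ 1]) auto

text \<open>The arithmetic-geometric mean inequality with a free parameter plays the part of
  Cauchy-Schwarz; t is chosen to absorb a term or to make one small.\<close>

lemma L2_circle_mult:
  assumes F: "F \<in> L2_circle" and G: "G \<in> L2_circle" and t: "t > 0"
  shows "integrable circle (\<lambda>\<omega>. F \<omega> * G \<omega>)"
    and "norm (\<integral>\<omega>. F \<omega> * G \<omega> \<partial>circle)
      \<le> (t * (\<integral>\<omega>. (cmod (F \<omega>))\<^sup>2 \<partial>circle) + (\<integral>\<omega>. (cmod (G \<omega>))\<^sup>2 \<partial>circle) / t) / 2"
proof -
  have [measurable]: "F \<in> borel_measurable circle" "G \<in> borel_measurable circle"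
    and i: "integrable circle (\<lambda>\<omega>. (t * (cmod (F \<omega>))\<^sup>2 + (cmod (G \<omega>))\<^sup>2 / t) / 2)"
    using F G by (auto simp: L2_circle_def)
  have le: "norm (F \<omega> * G \<omega>) \<le> (t * (cmod (F \<omega>))\<^sup>2 + (cmod (G \<omega>))\<^sup>2 / t) / 2" for \<omega>
  proof -
    have "0 \<le> (t * cmod (F \<omega>) - cmod (G \<omega>))\<^sup>2 / t" using t by simp
    also have "\<dots> = t * (cmod (F \<omega>))\<^sup>2 + (cmod (G \<omega>))\<^sup>2 / t - 2 * (cmod (F \<omega>) * cmod (G \<omega>))"
      using t by (simp add: power2_eq_square field_simps)
    finally show ?thesis by (simp add: norm_mult)
  qed
  show j: "integrable circle (\<lambda>\<omega>. F \<omega> * G \<omega>)"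
  proof (rule Bochner_Integration.integrable_bound[OF i])
    show "AE \<omega> in circle. norm (F \<omega> * G \<omega>) \<le> norm ((t * (cmod (F \<omega>))\<^sup>2 + (cmod (G \<omega>))\<^sup>2 / t) / 2)"
      using le by (intro AE_I2) (metis abs_ge_self order_trans real_norm_def)
  qed measurable
  have "norm (\<integral>\<omega>. F \<omega> * G \<omega> \<partial>circle) \<le> (\<integral>\<omega>. norm (F \<omega> * G \<omega>) \<partial>circle)"
    by (rule integral_norm_bound)
  also have "\<dots> \<le> (\<integral>\<omega>. (t * (cmod (F \<omega>))\<^sup>2 + (cmod (G \<omega>))\<^sup>2 / t) / 2 \<partial>circle)"
    by (rule integral_mono[OF integrable_norm[OF j] i le])
  also have "\<dots> = (t * (\<integral>\<omega>. (cmod (F \<omega>))\<^sup>2 \<partial>circle) + (\<integral>\<omega>. (cmod (G \<omega>))\<^sup>2 \<partial>circle) / t) / 2"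
    using F G by (simp add: L2_circle_def)
  finally show "norm (\<integral>\<omega>. F \<omega> * G \<omega> \<partial>circle)
      \<le> (t * (\<integral>\<omega>. (cmod (F \<omega>))\<^sup>2 \<partial>circle) + (\<integral>\<omega>. (cmod (G \<omega>))\<^sup>2 \<partial>circle) / t) / 2" .
qed

lemma integral_mult_tendsto_0:
  assumes F: "\<And>n. F n \<in> L2_circle" and G: "G \<in> L2_circle"
    and lim: "(\<lambda>n. \<integral>\<omega>. (cmod (F n \<omega>))\<^sup>2 \<partial>circle) \<longlonglongrightarrow> 0"
  shows "(\<lambda>n. \<integral>\<omega>. F n \<omega> * G \<omega> \<partial>circle) \<longlonglongrightarrow> 0"
proof (rule LIMSEQ_I)
  fix e :: real assume e: "e > 0"
  define b where "b = (\<integral>\<omega>. (cmod (G \<omega>))\<^sup>2 \<partial>circle)"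
  have b: "b \<ge> 0" unfolding b_def by simp
  \<comment> \<open>This keeps the fixed term b / t below e; the summand 1 keeps t positive when b =
    0.\<close>
  define t where "t = (b + 1) / e"
  have t: "t > 0" using e b by (simp add: t_def)
  have bt: "b / t < e" using e b by (simp add: t_def field_simps)
  have "\<forall>\<^sub>F n in sequentially. (\<integral>\<omega>. (cmod (F n \<omega>))\<^sup>2 \<partial>circle) < e / t"
    using lim e t by (intro order_tendstoD(2)) auto
  then have "\<forall>\<^sub>F n in sequentially. norm (\<integral>\<omega>. F n \<omega> * G \<omega> \<partial>circle) < e"
  proof eventually_elim
    case (elim n)
    have "t * (\<integral>\<omega>. (cmod (F n \<omega>))\<^sup>2 \<partial>circle) < e" using elim t by (simp add: field_simps)
    then have "(t * (\<integral>\<omega>. (cmod (F n \<omega>))\<^sup>2 \<partial>circle) + b / t) / 2 < e" using bt by simp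
    then show ?case by (rule le_less_trans[OF L2_circle_mult(2)[OF F[of n] G t, folded b_def]])
  qed
  then show "\<exists>no. \<forall>n\<ge>no. norm ((\<integral>\<omega>. F n \<omega> * G \<omega> \<partial>circle) - 0) < e"
    by (simp add: eventually_sequentially)
qed

lemma L2_limit_unique:
  assumes F: "F \<in> L2_circle" and F': "F' \<in> L2_circle" and S: "\<And>n. S n \<in> L2_circle"
    and lim: "(\<lambda>n. \<integral>\<omega>. (cmod (F \<omega> - S n \<omega>))\<^sup>2 \<partial>circle) \<longlonglongrightarrow> 0"
    and lim': "(\<lambda>n. \<integral>\<omega>. (cmod (F' \<omega> - S n \<omega>))\<^sup>2 \<partial>circle) \<longlonglongrightarrow> 0"
  shows "AE \<omega> in circle. F \<omega> = F' \<omega>"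
proof -
  have "(\<integral>\<omega>. (cmod (F \<omega> - F' \<omega>))\<^sup>2 \<partial>circle) \<le> 0"
  proof (rule LIMSEQ_le_const)
    show "(\<lambda>n. 2 * (\<integral>\<omega>. (cmod (F \<omega> - S n \<omega>))\<^sup>2 \<partial>circle) + 2 * (\<integral>\<omega>. (cmod (F' \<omega> - S n \<omega>))\<^sup>2 \<partial>circle)) \<longlonglongrightarrow> 0"
      using tendsto_add[OF tendsto_mult[OF tendsto_const[of 2] lim] tendsto_mult[OF tendsto_const[of 2] lim']] by simp
    show "\<exists>N. \<forall>n\<ge>N. (\<integral>\<omega>. (cmod (F \<omega> - F' \<omega>))\<^sup>2 \<partial>circle)
        \<le> 2 * (\<integral>\<omega>. (cmod (F \<omega> - S n \<omega>))\<^sup>2 \<partial>circle) + 2 * (\<integral>\<omega>. (cmod (F' \<omega> - S n \<omega>))\<^sup>2 \<partial>circle)"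
    proof (intro exI allI impI)
      fix n
      show "(\<integral>\<omega>. (cmod (F \<omega> - F' \<omega>))\<^sup>2 \<partial>circle)
        \<le> 2 * (\<integral>\<omega>. (cmod (F \<omega> - S n \<omega>))\<^sup>2 \<partial>circle) + 2 * (\<integral>\<omega>. (cmod (F' \<omega> - S n \<omega>))\<^sup>2 \<partial>circle)"
        using L2_circle_add(2)[OF L2_circle_diff[OF F S[of n]] L2_circle_diff[OF S[of n] F']]
        by (simp add: norm_minus_commute)
    qed
  qed
  moreover have i: "integrable circle (\<lambda>\<omega>. (cmod (F \<omega> - F' \<omega>))\<^sup>2)"
    using L2_circle_diff[OF F F'] by (simp add: L2_circle_def)
  ultimately have "(\<integral>\<omega>. (cmod (F \<omega> - F' \<omega>))\<^sup>2 \<partial>circle) = 0"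
    by (intro antisym) auto
  then have "AE \<omega> in circle. (cmod (F \<omega> - F' \<omega>))\<^sup>2 = 0"
    using integral_nonneg_eq_0_iff_AE[OF i] by simp
  then show ?thesis by simp
qed

lemma L2_sumsD:
  assumes "L2_sums u F"
  shows "u j \<in> L2_circle" "F \<in> L2_circle" "(\<lambda>\<omega>. \<Sum>j<n. u j \<omega>) \<in> L2_circle"
    "(\<lambda>n. \<integral>\<omega>. (cmod (F \<omega> - (\<Sum>j<n. u j \<omega>)))\<^sup>2 \<partial>circle) \<longlonglongrightarrow> 0"
  using assms by (auto simp: L2_sums_def intro: L2_circle_sum)

text \<open>Testing an L2 sum against a fixed L2 function is the way in which coefficient identities
  are extracted from the L2 hypotheses.\<close>

lemma L2_sums_pairing:
  assumes F: "L2_sums u F" and B: "B \<in> L2_circle"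
  shows "(\<lambda>j. \<integral>\<omega>. u j \<omega> * B \<omega> \<partial>circle) sums (\<integral>\<omega>. F \<omega> * B \<omega> \<partial>circle)"
proof -
  note F' = L2_sumsD[OF F]
  have i: "integrable circle (\<lambda>\<omega>. u j \<omega> * B \<omega>)" for j
    by (rule L2_circle_mult(1)[OF F'(1) B zero_less_one])
  have eq: "(\<integral>\<omega>. (F \<omega> - (\<Sum>j<n. u j \<omega>)) * B \<omega> \<partial>circle)
      = (\<integral>\<omega>. F \<omega> * B \<omega> \<partial>circle) - (\<Sum>j<n. \<integral>\<omega>. u j \<omega> * B \<omega> \<partial>circle)" for n
  proof -
    have "(\<lambda>\<omega>. (F \<omega> - (\<Sum>j<n. u j \<omega>)) * B \<omega>) = (\<lambda>\<omega>. F \<omega> * B \<omega> - (\<Sum>j<n. u j \<omega> * B \<omega>))"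
      by (simp add: left_diff_distrib sum_distrib_right)
    then show ?thesis
      using Bochner_Integration.integral_diff[OF L2_circle_mult(1)[OF F'(2) B zero_less_one]
          Bochner_Integration.integrable_sum[of "{..<n}", OF i]]
      by (simp add: Bochner_Integration.integral_sum[OF i])
  qed
  have "(\<lambda>n. \<integral>\<omega>. (F \<omega> - (\<Sum>j<n. u j \<omega>)) * B \<omega> \<partial>circle) \<longlonglongrightarrow> 0"
    by (rule integral_mult_tendsto_0[OF L2_circle_diff[OF F'(2,3)] B F'(4)])
  from tendsto_diff[OF tendsto_const[of "\<integral>\<omega>. F \<omega> * B \<omega> \<partial>circle"] this] show ?thesis
    by (simp add: sums_def eq)
qed

lemma has_fourier_series_pairing:
  assumes "has_fourier_series F a" "B \<in> L2_circle"
  shows "(\<lambda>j. a j * (\<integral>\<omega>. cis (real j * \<omega>) * B \<omega> \<partial>circle)) sums (\<integral>\<omega>. F \<omega> * B \<omega> \<partial>circle)"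
  using L2_sums_pairing[OF assms[unfolded has_fourier_series_def]] by (simp add: mult.assoc)

lemma has_fourier_series_coeff:
  fixes a :: "nat \<Rightarrow> complex"
  assumes "has_fourier_series F a"
  shows "(\<integral>\<omega>. F \<omega> * cis (- real_of_int m * \<omega>) \<partial>circle) = 2 * pi * (if m \<ge> 0 then a (nat m) else 0)"
proof -
  have "(\<integral>\<omega>. cis (real j * \<omega>) * cis (- real_of_int m * \<omega>) \<partial>circle) = (if int j = m then 2 * pi else 0)" for j
    using integral_cis_circle[of "int j - m"] by (simp add: cis_mult left_diff_distrib)
  then have "(\<lambda>j. a j * (if int j = m then 2 * pi else 0)) sums (\<integral>\<omega>. F \<omega> * cis (- real_of_int m * \<omega>) \<partial>circle)"
    using has_fourier_series_pairing[OF assms L2_circle_cis, of "- real_of_int m"] by simp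
  moreover have "(\<lambda>j. a j * (if int j = m then 2 * pi else 0)) sums (2 * pi * (if m \<ge> 0 then a (nat m) else 0))"
  proof (cases "m \<ge> 0")
    case True
    then have "(\<lambda>j. a j * (if int j = m then 2 * pi else 0)) = (\<lambda>j. if j = nat m then 2 * pi * a j else 0)"
      by (auto simp: fun_eq_iff)
    then show ?thesis using True sums_single[of "nat m" "\<lambda>j. 2 * pi * a j"] by simp
  next
    case False
    then have "(\<lambda>j. a j * (if int j = m then 2 * pi else 0)) = (\<lambda>j. 0)" by (auto simp: fun_eq_iff)
    then show ?thesis using False by simp
  qed
  ultimately show ?thesis by (rule sums_unique2)
qed

lemma has_fourier_series_ev:
  assumes causal: "\<And>n. n < 0 \<Longrightarrow> cf x n = 0"
  shows "has_fourier_series (ev x) (\<lambda>j. cf x (int j))"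
  unfolding has_fourier_series_def L2_sums_def
proof (intro conjI allI)
  show "(\<lambda>\<omega>. cf x (int j) * cis (real j * \<omega>)) \<in> L2_circle" for j
    by (rule L2_circle_bounded_mult[OF L2_circle_cis, of "\<lambda>_. cf x (int j)"]) auto
  show "ev x \<in> L2_circle" by (rule L2_circle_ev)
  have partial: "(\<Sum>j<n. cf x (int j) * cis (real j * \<omega>)) = ev (proj {0..<int n} x) \<omega>" for n \<omega>
  proof -
    have "ev (proj {0..<int n} x) \<omega> = (\<Sum>k\<in>{0..<int n}. cf (proj {0..<int n} x) k * cis (real_of_int k * \<omega>))"
      by (rule ev_finite) auto
    also have "\<dots> = (\<Sum>j<n. cf x (int j) * cis (real j * \<omega>))"
      by (rule sum.reindex_bij_witness[of _ int nat]) auto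
    finally show ?thesis by simp
  qed
  define b where "b n = norm1 (x - proj {0..<int n} x)" for n
  \<comment> \<open>For a sequence without negative indices the symmetric window -n..n keeps the
    first n + 1 coefficients, hence the shift by one.\<close>
  have b_Suc: "b (Suc n) = norm1 (x - proj {- int n..int n} x)" for n
    unfolding b_def by (rule arg_cong[of _ _ norm1], rule l1_eqI) (auto simp: causal)
  have "(\<lambda>n. b (Suc n)) \<longlonglongrightarrow> 0" unfolding b_Suc by (rule wnorm_proj_tendsto) simp
  then have b: "b \<longlonglongrightarrow> 0" by (rule LIMSEQ_imp_Suc)
  show "(\<lambda>n. \<integral>\<omega>. (cmod (ev x \<omega> - (\<Sum>j<n. cf x (int j) * cis (real j * \<omega>))))\<^sup>2 \<partial>circle) \<longlonglongrightarrow> 0"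
  proof (rule Lim_null_comparison)
    have "norm (\<integral>\<omega>. (cmod (ev (x - proj {0..<int n} x) \<omega>))\<^sup>2 \<partial>circle) \<le> 2 * pi * (b n)\<^sup>2" for n
    proof -
      have "(\<integral>\<omega>. (cmod (ev (x - proj {0..<int n} x) \<omega>))\<^sup>2 \<partial>circle) \<le> (\<integral>\<omega>. (b n)\<^sup>2 \<partial>circle)"
        using L2_circle_ev[of "x - proj {0..<int n} x"] unfolding L2_circle_def b_def
        by (intro integral_mono) (auto intro!: power_mono norm_ev_le simp del: ev_simps)
      then show ?thesis by (simp add: measure_circle)
    qed
    then show "\<forall>\<^sub>F n in sequentially. norm (\<integral>\<omega>. (cmod (ev x \<omega> - (\<Sum>j<n. cf x (int j) * cis (real j * \<omega>))))\<^sup>2 \<partial>circle)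
        \<le> 2 * pi * (b n)\<^sup>2"
      by (simp add: partial)
    show "(\<lambda>n. 2 * pi * (b n)\<^sup>2) \<longlonglongrightarrow> 0"
      using tendsto_mult[OF tendsto_const[of "2 * pi"] tendsto_power[OF b, of 2]] by simp
  qed
qed

lemma has_fourier_series_diff:
  assumes F: "has_fourier_series F a" and G: "has_fourier_series G b"
  shows "has_fourier_series (\<lambda>\<omega>. F \<omega> - G \<omega>) (\<lambda>j. a j - b j)"
proof -
  note F' = L2_sumsD[OF F[unfolded has_fourier_series_def]]
  note G' = L2_sumsD[OF G[unfolded has_fourier_series_def]]
  let ?SF = "\<lambda>n \<omega>. \<Sum>j<n. a j * cis (real j * \<omega>)" and ?SG = "\<lambda>n \<omega>. \<Sum>j<n. b j * cis (real j * \<omega>)"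
  have eq: "F \<omega> - G \<omega> - (\<Sum>j<n. (a j - b j) * cis (real j * \<omega>)) = (F \<omega> - ?SF n \<omega>) + (?SG n \<omega> - G \<omega>)" for n \<omega>
    by (simp add: left_diff_distrib sum_subtractf)
  show ?thesis
    unfolding has_fourier_series_def L2_sums_def eq
  proof (intro conjI allI)
    show "(\<lambda>\<omega>. (a j - b j) * cis (real j * \<omega>)) \<in> L2_circle" for j
      using L2_circle_diff[OF F'(1) G'(1)] by (simp add: left_diff_distrib)
    show "(\<lambda>\<omega>. F \<omega> - G \<omega>) \<in> L2_circle" by (rule L2_circle_diff[OF F'(2) G'(2)])
    show "(\<lambda>n. \<integral>\<omega>. (cmod ((F \<omega> - ?SF n \<omega>) + (?SG n \<omega> - G \<omega>)))\<^sup>2 \<partial>circle) \<longlonglongrightarrow> 0"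
    proof (rule Lim_null_comparison)
      show "\<forall>\<^sub>F n in sequentially. norm (\<integral>\<omega>. (cmod ((F \<omega> - ?SF n \<omega>) + (?SG n \<omega> - G \<omega>)))\<^sup>2 \<partial>circle)
          \<le> 2 * (\<integral>\<omega>. (cmod (F \<omega> - ?SF n \<omega>))\<^sup>2 \<partial>circle) + 2 * (\<integral>\<omega>. (cmod (G \<omega> - ?SG n \<omega>))\<^sup>2 \<partial>circle)"
        using L2_circle_add(2)[OF L2_circle_diff[OF F'(2,3)] L2_circle_diff[OF G'(3,2)]]
        by (intro always_eventually allI) (simp add: norm_minus_commute)
      show "(\<lambda>n. 2 * (\<integral>\<omega>. (cmod (F \<omega> - ?SF n \<omega>))\<^sup>2 \<partial>circle) + 2 * (\<integral>\<omega>. (cmod (G \<omega> - ?SG n \<omega>))\<^sup>2 \<partial>circle)) \<longlonglongrightarrow> 0"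
        using tendsto_add[OF tendsto_mult[OF tendsto_const[of 2] F'(4)] tendsto_mult[OF tendsto_const[of 2] G'(4)]] by simp
    qed
  qed
qed

lemma has_fourier_series_unique:
  assumes F: "has_fourier_series F a" and G: "has_fourier_series G a"
  shows "AE \<omega> in circle. F \<omega> = G \<omega>"
proof -
  note F' = L2_sumsD[OF F[unfolded has_fourier_series_def]]
  note G' = L2_sumsD[OF G[unfolded has_fourier_series_def]]
  show ?thesis by (rule L2_limit_unique[OF F'(2) G'(2) F'(3) F'(4) G'(4)])
qed

section \<open>The spectral factorization\<close>

lemma borel_measurable_cnj [measurable (raw)]:
  "f \<in> borel_measurable N \<Longrightarrow> (\<lambda>x. cnj (f x)) \<in> borel_measurable N"
  by (rule borel_measurable_continuous_on[of cnj]) (auto intro: continuous_intros)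

text \<open>Pairings produce ordered series over the naturals, convolution an unordered sum over the
  integers; vanishing of \<open>x\<close> at negative indices matches the two.\<close>

lemma conv_causal_sums:
  assumes x: "\<And>n. norm (x n) \<le> B" and x0: "\<And>n. n < 0 \<Longrightarrow> x n = 0"
  shows "(\<lambda>j. x (int j) * cf a (m - int j)) sums conv (cf a) x m"
proof -
  have "((\<lambda>k. cf a k * x (m - k)) has_sum conv (cf a) x m) UNIV"
    unfolding conv_def
    by (rule has_sum_infsum, rule abs_summable_summable, rule summable_conv_bounded(1)[OF cf_summable x])
  then have "((\<lambda>k. x k * cf a (m - k)) has_sum conv (cf a) x m) UNIV"
    using has_sum_reindex_bij_betw[OF bij_minus_left_int[of m], of "\<lambda>k. cf a k * x (m - k)"]
    by (simp add: mult.commute)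
  then have "((\<lambda>k. x k * cf a (m - k)) has_sum conv (cf a) x m) {0..}"
    by (rule has_sum_cong_neutral[THEN iffD1, rotated -1]) (auto simp: x0)
  moreover have "bij_betw int UNIV {0..}"
    by (rule bij_betwI[of _ _ _ nat]) auto
  ultimately have "((\<lambda>j. x (int j) * cf a (m - int j)) has_sum conv (cf a) x m) UNIV"
    using has_sum_reindex_bij_betw[of int UNIV "{0..}" "\<lambda>k. x k * cf a (m - k)"] by simp
  then show ?thesis by (rule has_sum_imp_sums)
qed

lemma integral_cis_ev:
  "(\<integral>\<omega>. cis (real j * \<omega>) * (ev x \<omega> * cis (- real_of_int m * \<omega>)) \<partial>circle) = 2 * pi * cf x (m - int j)"
proof -
  have eq: "cis (real j * \<omega>) * (ev x \<omega> * cis (- real_of_int m * \<omega>)) = ev x \<omega> * cis (- real_of_int (m - int j) * \<omega>)" for \<omega>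
  proof -
    have "cis (real j * \<omega>) * cis (- real_of_int m * \<omega>) = cis (- real_of_int (m - int j) * \<omega>)"
      by (simp add: cis_mult algebra_simps)
    then show ?thesis by (metis mult.assoc mult.commute)
  qed
  show ?thesis unfolding eq cf_eq_integral ..
qed

definition causal :: "(nat \<Rightarrow> complex) \<Rightarrow> int \<Rightarrow> complex" where
  "causal a n = (if n < 0 then 0 else a (nat n))"

lemma causal_simps [simp]: "n < 0 \<Longrightarrow> causal a n = 0" "causal a (int j) = a j" "causal a 0 = a 0"
  by (auto simp: causal_def)

lemma has_fourier_series_causal_coeff:
  assumes "has_fourier_series F a"
  shows "(\<integral>\<omega>. F \<omega> * cis (- real_of_int m * \<omega>) \<partial>circle) = 2 * pi * causal a m"
  using has_fourier_series_coeff[OF assms, of m] by (simp add: causal_def)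

text \<open>Each coefficient is a pairing with a harmonic. Boundedness is all that the fixed point
  argument asks of the coefficients of phi, and it makes sup |g_s| finite.\<close>

lemma has_fourier_series_bounded:
  assumes "has_fourier_series F a"
  shows "\<exists>B. \<forall>j. norm (a j) \<le> B"
proof -
  have F: "F \<in> L2_circle" using assms by (simp add: has_fourier_series_def L2_sums_def)
  have "norm (a j) \<le> ((\<integral>\<omega>. (cmod (F \<omega>))\<^sup>2 \<partial>circle) + 2 * pi) / 2" for j
  proof -
    have "norm (a j) \<le> 2 * pi * norm (a j)"
      using pi_ge_two mult_right_mono[of 1 "2 * pi" "norm (a j)"] by simp
    also have "\<dots> = norm (\<integral>\<omega>. F \<omega> * cis (- real_of_int (int j) * \<omega>) \<partial>circle)"
      unfolding has_fourier_series_causal_coeff[OF assms] by (simp add: norm_mult)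
    also have "\<dots> \<le> ((\<integral>\<omega>. (cmod (F \<omega>))\<^sup>2 \<partial>circle) + 2 * pi) / 2"
      using L2_circle_mult(2)[OF F L2_circle_cis zero_less_one, of "- real_of_int (int j)"]
      by (simp add: measure_circle)
    finally show ?thesis .
  qed
  then show ?thesis by blast
qed

text \<open>The minus sign undoes the one in \<Phi> = 1 - sum \<phi>_j z^j, so this represents the
  function \<phi>_l of the theorem when x is \<Phi>.\<close>

definition tail :: "nat \<Rightarrow> l1 \<Rightarrow> l1" where
  "tail l x = - proj {1..} (harmonic (- int l) * x)"

lemma cf_tail: "cf (tail l x) n = (if n \<ge> 1 then - cf x (n + int l) else 0)"
  by (simp add: tail_def cf_harmonic_times)

locale spectral_bounds =
  fixes c :: "int \<Rightarrow> real" and K m M :: real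
  assumes c_sym: "c (- r) = c r" and K: "K > 1"
    and c_summable: "(\<lambda>r::int. \<bar>real_of_int r\<bar> powr K * \<bar>c r\<bar>) summable_on UNIV"
    and m_pos: "m > 0" and f_ge: "m \<le> spectral_density c \<omega>" and f_le: "spectral_density c \<omega> \<le> M"
begin

definition C :: l1 where
  "C = Abs_l1 (\<lambda>r. complex_of_real (c r))"

lemma weighted_c_summable: "(\<lambda>r. weight K r * \<bar>c r\<bar>) summable_on UNIV"
proof (rule summable_on_comparison_test)
  have "(\<lambda>r::int. if r = 0 then \<bar>c 0\<bar> else 0) summable_on UNIV"
    by (rule finite_nonzero_values_imp_summable_on) (auto intro: finite_subset[of _ "{0}"])
  \<comment> \<open>Off 0, 1 + |r| <= 2 |r| gives the factor \<open>2 powr K\<close>; at 0 the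
    hypothesis contains no information, since \<open>0 powr K\<close> is 0, and c 0 is added by
    hand.\<close>
  then show "(\<lambda>r. 2 powr K * (\<bar>real_of_int r\<bar> powr K * \<bar>c r\<bar>) + (if r = 0 then \<bar>c 0\<bar> else 0)) summable_on UNIV"
    by (intro summable_on_add summable_on_cmult_right c_summable)
  fix r :: int
  show "weight K r * \<bar>c r\<bar> \<le> 2 powr K * (\<bar>real_of_int r\<bar> powr K * \<bar>c r\<bar>) + (if r = 0 then \<bar>c 0\<bar> else 0)"
  proof (cases "r = 0")
    case False
    then have "1 \<le> \<bar>real_of_int r\<bar>" by linarith
    then have "weight K r \<le> (2 * \<bar>real_of_int r\<bar>) powr K"
      unfolding weight_def using K by (intro powr_mono2) auto
    then show ?thesis using False by (simp add: powr_mult mult_right_mono flip: mult.assoc)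
  qed (simp add: weight_def)
qed simp

lemma cf_C [simp]: "cf C r = c r"
proof -
  have "(\<lambda>r. \<bar>c r\<bar>) summable_on UNIV"
  proof (rule summable_on_comparison_test[OF weighted_c_summable])
    show "\<bar>c r\<bar> \<le> weight K r * \<bar>c r\<bar>" for r
      using mult_right_mono[OF weight_ge_1[of K r], of "\<bar>c r\<bar>"] K by simp
  qed simp
  then show ?thesis by (simp add: C_def Abs_l1_inverse)
qed

lemma wsum_C: "wsum K C"
  using weighted_c_summable by (simp add: wsum_def)

lemma star_C: "star C = C"
  by (rule l1_eqI) (simp add: c_sym)

lemma ev_C: "ev C \<omega> = spectral_density c \<omega>"
proof -
  have "cnj (ev C \<omega>) = ev C \<omega>" by (metis ev_star star_C)
  then have "ev C \<omega> = Re (ev C \<omega>)" by (simp add: complex_eq_iff)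
  also have "Re (ev C \<omega>) = spectral_density c \<omega>" by (simp add: ev_def spectral_density_def)
  finally show ?thesis .
qed

lemma f_pos: "spectral_density c \<omega> > 0"
  using f_ge[of \<omega>] m_pos by linarith

lemma f_measurable [measurable]: "spectral_density c \<in> borel_measurable circle"
proof -
  have "spectral_density c = (\<lambda>\<omega>. Re (ev C \<omega>))" by (simp add: ev_C fun_eq_iff)
  then show ?thesis by simp
qed

text \<open>This upgrades the L2 data to the algebra. The coefficients of phi satisfy homogeneous
  Toeplitz equations and are therefore weighted summable; the identities between phi, psi and f then
  become identities in \<open>l1\<close>.\<close>

lemma spectral_factorization_l1:
  assumes "spectral_factorization c \<sigma>2 \<psi> \<phi> psi phi"
  shows "\<exists>\<Phi> \<Psi>. l1_factorization C \<Phi> \<Psi> \<sigma>2 \<and> wsum K \<Phi> \<and> (AE \<omega> in circle. phi \<omega> = ev \<Phi> \<omega>) \<and>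
    (\<forall>j>0. cf \<Phi> (int j) = - complex_of_real (\<phi> j))"
proof -
  define a b where "a = (\<lambda>j::nat. if j = 0 then 1 else - complex_of_real (\<phi> j))"
    and "b = (\<lambda>j::nat. if j = 0 then 1 else complex_of_real (\<psi> j))"
  define x y where "x = causal a" and "y = causal b"
  have s: "\<sigma>2 > 0" and psi: "has_fourier_series psi b" and phi: "has_fourier_series phi a"
    and ae: "AE \<omega> in circle. phi \<omega> = inverse (psi \<omega>) \<and>
        spectral_density c \<omega> = \<sigma>2 * (cmod (psi \<omega>))\<^sup>2 \<and> spectral_density c \<omega> = \<sigma>2 / (cmod (phi \<omega>))\<^sup>2"
    using assms by (auto simp: spectral_factorization_def a_def b_def)
  have L2: "psi \<in> L2_circle" "phi \<in> L2_circle"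
    using psi phi by (auto simp: has_fourier_series_def L2_sums_def)
  then have [measurable]: "psi \<in> borel_measurable circle" "phi \<in> borel_measurable circle"
    by (auto simp: L2_circle_def)
  obtain Bx By where Bx: "\<And>j. norm (a j) \<le> Bx" and By: "\<And>j. norm (b j) \<le> By"
    using has_fourier_series_bounded[OF phi] has_fourier_series_bounded[OF psi] by blast
  have Bx0: "0 \<le> Bx" using Bx[of 0] norm_ge_zero order_trans by blast
  have xb: "norm (x n) \<le> Bx" for n using Bx[of "nat n"] Bx0 by (simp add: x_def causal_def)
  have x_neg: "n < 0 \<Longrightarrow> x n = 0" for n by (simp add: x_def)
  \<comment> \<open>These are the Fourier coefficients of phi f = \<sigma>2 cnj psi, which follows
    from phi = 1 / psi and f = \<sigma>2 |psi|^2. The right side has no positive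
    frequencies.\<close>
  have conv_C: "conv (cf C) x k = \<sigma>2 * cnj (y (- k))" for k
  proof -
    have B: "(\<lambda>\<omega>. ev C \<omega> * cis (- real_of_int k * \<omega>)) \<in> L2_circle"
      by (rule L2_circle_bounded_mult[OF L2_circle_cis, of "ev C" "norm1 C"]) (auto intro: norm_ev_le)
    have "(\<lambda>j. a j * (2 * pi * cf C (k - int j))) sums (\<integral>\<omega>. phi \<omega> * (ev C \<omega> * cis (- real_of_int k * \<omega>)) \<partial>circle)"
      using has_fourier_series_pairing[OF phi B] by (simp only: integral_cis_ev)
    moreover have "(\<lambda>j. a j * (2 * pi * cf C (k - int j))) sums (2 * pi * conv (cf C) x k)"
      using sums_mult[OF conv_causal_sums[where x = x and a = C and m = k, OF xb x_neg], where c = "2 * complex_of_real pi"] by (simp add: x_def mult_ac)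
    moreover have "(\<integral>\<omega>. phi \<omega> * (ev C \<omega> * cis (- real_of_int k * \<omega>)) \<partial>circle)
        = (\<integral>\<omega>. \<sigma>2 * cnj (psi \<omega> * cis (- real_of_int (- k) * \<omega>)) \<partial>circle)"
    proof (rule integral_cong_AE)
      show "AE \<omega> in circle. phi \<omega> * (ev C \<omega> * cis (- real_of_int k * \<omega>))
          = \<sigma>2 * cnj (psi \<omega> * cis (- real_of_int (- k) * \<omega>))"
        using ae
      proof eventually_elim
        case (elim \<omega>)
        then have 1: "ev C \<omega> = complex_of_real \<sigma>2 * (psi \<omega> * cnj (psi \<omega>))"
          by (simp add: ev_C flip: complex_norm_square)
        have "psi \<omega> \<noteq> 0" using elim f_pos[of \<omega>] by auto
        then have "phi \<omega> * ev C \<omega> = \<sigma>2 * cnj (psi \<omega>)" using elim 1 by simp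
        then show ?case by (simp add: cis_cnj flip: mult.assoc)
      qed
    qed measurable
    moreover have "\<dots> = 2 * pi * (\<sigma>2 * cnj (y (- k)))"
    proof -
      have "\<dots> = \<sigma>2 * cnj (\<integral>\<omega>. psi \<omega> * cis (- real_of_int (- k) * \<omega>) \<partial>circle)"
        by (simp del: complex_cnj_mult)
      then show ?thesis by (simp only: has_fourier_series_causal_coeff[OF psi]) (simp add: y_def)
    qed
    ultimately have "2 * pi * conv (cf C) x k = 2 * pi * (\<sigma>2 * cnj (y (- k)))"
      using sums_unique2 by metis
    then show ?thesis by simp
  qed
  have wx: "(\<lambda>n. weight K n * norm (x n)) summable_on UNIV"
  proof (rule weighted_summable_Toeplitz_kernel[OF _ wsum_C ev_C f_ge f_le m_pos xb x_neg])
    show "conv (cf C) x n = 0" if "n > 0" for n using that by (simp add: conv_C y_def)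
  qed (use K in auto)
  have "(\<lambda>n. norm (x n)) summable_on UNIV"
  proof (rule summable_on_comparison_test[OF wx])
    show "norm (x n) \<le> weight K n * norm (x n)" for n
      using mult_right_mono[OF weight_ge_1[of K n], of "norm (x n)"] K by simp
  qed simp
  moreover define \<Phi> where "\<Phi> = Abs_l1 x"
  ultimately have cf\<Phi>: "cf \<Phi> = x" by (simp add: Abs_l1_inverse)
  \<comment> \<open>Defined through C * \<Phi>, it is summable by construction, and
    \<open>conv_C\<close> identifies its coefficients with those of psi.\<close>
  define \<Psi> where "\<Psi> = scale (1 / \<sigma>2) (star (C * \<Phi>))"
  have cf\<Psi>: "cf \<Psi> n = y n" for n
    using s by (simp add: \<Psi>_def cf_times cf\<Phi> conv_C)
  have inv: "\<Phi> * \<Psi> = 1"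
  proof (rule l1_eqI)
    fix k
    have ev_psi: "(\<integral>\<omega>. cis (real j * \<omega>) * (psi \<omega> * cis (- real_of_int k * \<omega>)) \<partial>circle) = 2 * pi * y (k - int j)" for j
    proof -
      have "(\<integral>\<omega>. cis (real j * \<omega>) * (psi \<omega> * cis (- real_of_int k * \<omega>)) \<partial>circle)
          = (\<integral>\<omega>. psi \<omega> * cis (- real_of_int (k - int j) * \<omega>) \<partial>circle)"
      proof (rule Bochner_Integration.integral_cong[OF refl])
        fix \<omega>
        have "cis (real j * \<omega>) * cis (- real_of_int k * \<omega>) = cis (- real_of_int (k - int j) * \<omega>)"
          by (simp add: cis_mult algebra_simps)
        then show "cis (real j * \<omega>) * (psi \<omega> * cis (- real_of_int k * \<omega>)) = psi \<omega> * cis (- real_of_int (k - int j) * \<omega>)"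
          by (metis mult.assoc mult.commute)
      qed
      also have "\<dots> = 2 * pi * y (k - int j)"
        unfolding y_def by (rule has_fourier_series_causal_coeff[OF psi])
      finally show ?thesis .
    qed
    have B: "(\<lambda>\<omega>. psi \<omega> * cis (- real_of_int k * \<omega>)) \<in> L2_circle"
      using L2_circle_bounded_mult[OF L2(1) cis_measurable_circle, of "- real_of_int k" 1]
      by (simp add: mult.commute[of "cis _"])
    have "(\<lambda>j. a j * (2 * pi * y (k - int j))) sums (\<integral>\<omega>. phi \<omega> * (psi \<omega> * cis (- real_of_int k * \<omega>)) \<partial>circle)"
      using has_fourier_series_pairing[OF phi B] by (simp only: ev_psi)
    moreover have "(\<lambda>j. a j * (2 * pi * y (k - int j))) sums (2 * pi * conv (cf \<Psi>) x k)"
      using sums_mult[OF conv_causal_sums[where x = x and a = \<Psi> and m = k, OF xb x_neg], where c = "2 * complex_of_real pi"] by (simp add: x_def cf\<Psi> mult_ac)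
    \<comment> \<open>The product phi psi is 1 almost everywhere; psi is nonzero because f is
      positive, which matters as \<open>inverse 0\<close> is 0.\<close>
    moreover have "(\<integral>\<omega>. phi \<omega> * (psi \<omega> * cis (- real_of_int k * \<omega>)) \<partial>circle)
        = (\<integral>\<omega>. cis (real_of_int (- k) * \<omega>) \<partial>circle)"
    proof (rule integral_cong_AE)
      show "AE \<omega> in circle. phi \<omega> * (psi \<omega> * cis (- real_of_int k * \<omega>)) = cis (real_of_int (- k) * \<omega>)"
        using ae
      proof eventually_elim
        case (elim \<omega>)
        have "psi \<omega> \<noteq> 0" using elim f_pos[of \<omega>] by auto
        then show ?case using elim by (simp flip: mult.assoc)
      qed
    qed measurable
    ultimately have "2 * pi * conv (cf \<Psi>) x k = (if k = 0 then 2 * pi else 0)"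
      using sums_unique2[of "\<lambda>j. a j * (2 * pi * y (k - int j))"] integral_cis_circle[of "- k"] by auto
    then have "conv (cf \<Psi>) x k = (if k = 0 then 1 else 0)" by (auto split: if_splits)
    moreover have "cf (\<Phi> * \<Psi>) k = conv (cf \<Psi>) x k"
      by (subst mult.commute, subst cf_times) (simp add: cf\<Phi>)
    ultimately show "cf (\<Phi> * \<Psi>) k = cf 1 k" by simp
  qed
  have fac: "l1_factorization C \<Phi> \<Psi> \<sigma>2"
  proof
    show "C * \<Phi> = scale \<sigma>2 (star \<Psi>)" using s by (intro l1_eqI) (simp add: \<Psi>_def)
    show "cf \<Phi> n = 0" if "n < 0" for n using that by (simp add: cf\<Phi> x_neg)
    show "cf \<Phi> 0 = 1" by (simp add: cf\<Phi>) (simp add: x_def a_def)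
  qed (use s inv star_C in \<open>auto simp: cf\<Psi> y_def\<close>)
  show ?thesis
  proof (rule exI[of _ \<Phi>], rule exI[of _ \<Psi>], intro conjI allI impI fac)
    show "wsum K \<Phi>" using wx by (simp add: wsum_def cf\<Phi>)
    have "has_fourier_series (ev \<Phi>) a"
      using has_fourier_series_ev[of \<Phi>] by (simp add: cf\<Phi> x_def)
    then show "AE \<omega> in circle. phi \<omega> = ev \<Phi> \<omega>"
      by (rule has_fourier_series_unique[OF phi])
    show "cf \<Phi> (int j) = - complex_of_real (\<phi> j)" if "j > 0" for j
      using that by (simp add: cf\<Phi> x_def a_def)
  qed
qed

lemma phi_tail_ev:
  assumes "\<And>j. j > 0 \<Longrightarrow> cf \<Phi> (int j) = - complex_of_real (\<phi> j)"
    and "has_fourier_series F (\<lambda>s. if s = 0 then 0 else complex_of_real (\<phi> (l + s)))"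
  shows "AE \<omega> in circle. F \<omega> = ev (tail l \<Phi>) \<omega>"
proof (rule has_fourier_series_unique[OF assms(2)])
  have "cf (tail l \<Phi>) (int s) = (if s = 0 then 0 else complex_of_real (\<phi> (l + s)))" for s
    using assms(1)[of "l + s"] by (auto simp: cf_tail add.commute)
  then show "has_fourier_series (ev (tail l \<Phi>)) (\<lambda>s. if s = 0 then 0 else complex_of_real (\<phi> (l + s)))"
    using has_fourier_series_ev[of "tail l \<Phi>"] by (simp add: cf_tail)
qed

end

section \<open>Best fitting autoregressions\<close>

definition ar_poly :: "nat \<Rightarrow> (nat \<Rightarrow> real) \<Rightarrow> l1" where
  "ar_poly p a = 1 - (\<Sum>j=1..p. scale (a j) (harmonic (int j)))"

lemma cf_ar_poly:
  "cf (ar_poly p a) n = (if n = 0 then 1 else if 1 \<le> n \<and> n \<le> int p then - complex_of_real (a (nat n)) else 0)"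
proof -
  have "(\<Sum>j=1..p. complex_of_real (a j) * (if n = int j then 1 else 0))
      = (if 1 \<le> n \<and> n \<le> int p then complex_of_real (a (nat n)) else 0)"
  proof (cases "1 \<le> n \<and> n \<le> int p")
    case True
    then have "(\<Sum>j=1..p. complex_of_real (a j) * (if n = int j then 1 else 0))
        = (\<Sum>j=1..p. if nat n = j then complex_of_real (a j) else 0)"
      by (intro sum.cong) auto
    moreover have "1 \<le> nat n" "nat n \<le> p" using True by auto
    ultimately show ?thesis using True by simp
  qed (auto intro!: sum.neutral)
  then show ?thesis by (auto simp: ar_poly_def cf_sum)
qed

lemma ev_ar_poly: "ev (ar_poly p a) \<omega> = ar_filter p a \<omega>"
proof -
  have "ev (sum f J) \<omega> = (\<Sum>j\<in>J. ev (f j) \<omega>)" for f :: "nat \<Rightarrow> l1" and J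
    by (induction J rule: infinite_finite_induct) auto
  then show ?thesis by (simp add: ar_poly_def ar_filter_def)
qed

lemma ev_tail_ar_poly: "ev (tail l (ar_poly p a)) \<omega> = ar_tail p a l \<omega>"
proof -
  have "ev (tail l (ar_poly p a)) \<omega>
      = (\<Sum>n\<in>{1..int (p - l)}. cf (tail l (ar_poly p a)) n * cis (real_of_int n * \<omega>))"
    by (rule ev_finite) (auto simp: cf_tail cf_ar_poly)
  also have "\<dots> = (\<Sum>s=1..p - l. complex_of_real (a (l + s)) * cis (real s * \<omega>))"
    by (rule sum.reindex_bij_witness[of _ int nat])
       (auto simp: cf_tail cf_ar_poly nat_add_distrib add.commute)
  finally show ?thesis by (simp add: ar_tail_def)
qed

text \<open>Beyond p the quotient of the two weights, (1 + |n|)^(r - K), is at most p^(r - K). The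
  case r = 0 bounds the tail in Baxter's inequality, r = 1 produces p^(1 - K).\<close>

lemma wnorm_proj_tail_le:
  assumes "r \<le> K" "wsum K x" "p \<ge> 1" "0 \<le> K"
  shows "wsum r (proj {int p<..} x)" "wnorm r (proj {int p<..} x) \<le> real p powr (r - K) * wnorm K x"
proof -
  let ?f = "\<lambda>n. weight r n * norm (cf (proj {int p<..} x) n)"
  let ?g = "\<lambda>n. real p powr (r - K) * (weight K n * norm (cf x n))"
  have s: "?g summable_on UNIV"
    using assms(2) by (intro summable_on_cmult_right) (simp add: wsum_def)
  have le: "?f n \<le> ?g n" for n
  proof (cases "n > int p")
    case True
    have "weight r n = (1 + \<bar>real_of_int n\<bar>) powr (r - K) * weight K n"
      by (simp add: weight_def flip: powr_add)
    also have "\<dots> \<le> real p powr (r - K) * weight K n"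
      using True assms by (intro mult_right_mono powr_mono2') auto
    finally show ?thesis using True by (simp add: mult_right_mono flip: mult.assoc)
  qed auto
  show w: "wsum r (proj {int p<..} x)"
    unfolding wsum_def by (rule summable_on_comparison_test[OF s le]) simp
  have "wnorm r (proj {int p<..} x) \<le> (\<Sum>\<^sub>\<infinity>n. ?g n)"
    unfolding wnorm_def by (rule infsum_mono[OF w[unfolded wsum_def] s le])
  then show "wnorm r (proj {int p<..} x) \<le> real p powr (r - K) * wnorm K x"
    by (simp add: infsum_cmult_right' wnorm_def)
qed

context spectral_bounds
begin

lemma ev_ar_quadratic: "ev (star (ar_poly p a) * (C * ar_poly p a)) \<omega>
    = complex_of_real ((cmod (ar_filter p a \<omega>))\<^sup>2 * spectral_density c \<omega>)"
  unfolding of_real_mult complex_norm_square by (simp add: ev_mult ev_star ev_C ev_ar_poly mult_ac)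

text \<open>The mean of |A|^2 f is the coefficient at 0 of star A * C * A, which moves the
  minimization into the algebra.\<close>

lemma ar_error_eq: "complex_of_real (ar_error c p a) = cf (star (ar_poly p a) * (C * ar_poly p a)) 0"
proof -
  have "2 * pi * cf (star (ar_poly p a) * (C * ar_poly p a)) 0
      = complex_of_real (\<integral>\<omega>. (cmod (ar_filter p a \<omega>))\<^sup>2 * spectral_density c \<omega> \<partial>circle)"
    using integral_ev[of "star (ar_poly p a) * (C * ar_poly p a)"] unfolding ev_ar_quadratic integral_complex_of_real by simp
  then show ?thesis by (simp add: ar_error_def field_simps)
qed

lemma cf_C_ar_poly:
  "cf (C * ar_poly p a) n = complex_of_real (c n - (\<Sum>j=1..p. a j * c (n - int j)))"
  by (simp add: ar_poly_def right_diff_distrib sum_distrib_left scale_mult_right mult.commute[of C]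
      cf_sum cf_harmonic_times)

text \<open>From f >= m the integral of |A|^2 is at most 2 pi / m times the prediction error, and it
  bounds every coefficient of A.\<close>

lemma
  defines "B \<equiv> \<lambda>p a. (ar_error c p a / m + 1) / 2"
  shows norm_cf_ar_poly_le: "norm (cf (ar_poly p a) n) \<le> B p a"
    and ar_error_ge: "m \<le> ar_error c p a"
proof -
  define I where "I = (\<integral>\<omega>. (cmod (ev (ar_poly p a) \<omega>))\<^sup>2 \<partial>circle)"
  have "m * I = (\<integral>\<omega>. m * (cmod (ev (ar_poly p a) \<omega>))\<^sup>2 \<partial>circle)"
    by (simp add: I_def)
  also have "\<dots> \<le> (\<integral>\<omega>. (cmod (ar_filter p a \<omega>))\<^sup>2 * spectral_density c \<omega> \<partial>circle)"
  proof (rule integral_mono)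
    show "integrable circle (\<lambda>\<omega>. m * (cmod (ev (ar_poly p a) \<omega>))\<^sup>2)"
      using L2_circle_ev by (simp add: L2_circle_def)
    have "integrable circle (\<lambda>\<omega>. Re (ev (star (ar_poly p a) * (C * ar_poly p a)) \<omega>))"
      by simp
    then show "integrable circle (\<lambda>\<omega>. (cmod (ar_filter p a \<omega>))\<^sup>2 * spectral_density c \<omega>)"
      by (simp only: ev_ar_quadratic Re_complex_of_real)
    show "m * (cmod (ev (ar_poly p a) \<omega>))\<^sup>2 \<le> (cmod (ar_filter p a \<omega>))\<^sup>2 * spectral_density c \<omega>" for \<omega>
      using mult_left_mono[OF f_ge[of \<omega>], of "(cmod (ar_filter p a \<omega>))\<^sup>2"] by (simp add: ev_ar_poly mult.commute)
  qed
  also have "\<dots> = 2 * pi * ar_error c p a" by (simp add: ar_error_def)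
  finally have I: "m * I \<le> 2 * pi * ar_error c p a" .
  then have I': "I \<le> 2 * pi * (ar_error c p a / m)" using m_pos by (simp add: field_simps)
  have le: "2 * pi * norm (cf (ar_poly p a) n) \<le> (I + 2 * pi) / 2" for n
  proof -
    have "2 * pi * norm (cf (ar_poly p a) n) = norm (2 * pi * cf (ar_poly p a) n)" by (simp add: norm_mult)
    also have "\<dots> \<le> (I + 2 * pi) / 2"
      unfolding cf_eq_integral using L2_circle_mult(2)[OF L2_circle_ev L2_circle_cis zero_less_one, of "ar_poly p a" "- real_of_int n"]
      by (simp add: measure_circle I_def)
    finally show ?thesis .
  qed
  from le[of n] I' have "2 * pi * norm (cf (ar_poly p a) n) \<le> 2 * pi * B p a"
    by (simp add: B_def field_simps)
  then show "norm (cf (ar_poly p a) n) \<le> B p a" by simp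
  \<comment> \<open>The leading coefficient is 1, so the coefficient bound at index 0 reverses into
    a lower bound for I.\<close>
  from le[of 0] have "2 * pi \<le> I" by (simp add: cf_ar_poly)
  then have "m * (2 * pi) \<le> m * I" using m_pos by simp
  with I have "2 * pi * m \<le> 2 * pi * ar_error c p a" by (metis mult.commute order_trans)
  then show "m \<le> ar_error c p a" by simp
qed

lemma ar_error_zero: "ar_error c p (\<lambda>_. 0) = c 0"
proof -
  have "ar_poly p (\<lambda>_. 0) = 1" by (rule l1_eqI) (simp add: cf_ar_poly)
  then have "complex_of_real (ar_error c p (\<lambda>_. 0)) = c 0" by (simp add: ar_error_eq)
  then show ?thesis by (simp only: of_real_eq_iff)
qed

lemma c_0_pos: "c 0 > 0"
  using ar_error_ge[of 1 "\<lambda>_. 0"] m_pos unfolding ar_error_zero by linarith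

text \<open>Changing the r-th coefficient by t changes the error by t^2 c(0) - 2 t d, where d is the
  coefficient in question; minimality forces d = 0.\<close>

lemma best_ar_normal_equations:
  assumes best: "best_ar c p a" and r: "1 \<le> r" "r \<le> int p"
  shows "cf (C * ar_poly p a) r = 0"
proof -
  define A where "A = ar_poly p a"
  define d where "d = c r - (\<Sum>j=1..p. a j * c (r - int j))"
  have d: "cf (C * A) r = complex_of_real d" by (simp add: A_def d_def cf_C_ar_poly)
  have a0: "\<And>j. j \<notin> {1..p} \<Longrightarrow> a j = 0"
    and min: "\<And>b. (\<And>j. j \<notin> {1..p} \<Longrightarrow> b j = 0) \<Longrightarrow> ar_error c p a \<le> ar_error c p b"
    using best by (auto simp: best_ar_def is_arg_min_def not_less)
  have quad: "0 \<le> t\<^sup>2 * c 0 - 2 * t * d" for t :: real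
  proof -
    define b where "b = a(nat r := a (nat r) + t)"
    let ?h = "harmonic r"
    have "ar_error c p a \<le> ar_error c p b"
      using a0 r by (intro min) (auto simp: b_def)
    have Ab: "ar_poly p b = A - scale t ?h"
      by (rule l1_eqI) (use r in \<open>auto simp: A_def cf_ar_poly b_def\<close>)
    have sh: "star ?h = harmonic (- r)" by (rule l1_eqI) auto
    have hh: "harmonic (- r) * ?h = 1" by (rule l1_eqI) (auto simp: cf_harmonic_times)
    have "star (ar_poly p b) * (C * ar_poly p b)
        = star A * (C * A) - scale t (star A * (C * ?h)) - scale t (harmonic (- r) * (C * A))
          + scale (t * t) (harmonic (- r) * (C * ?h))"
    proof -
      have st: "star (A - scale t ?h) = star A - scale t (harmonic (- r))"
        by (rule l1_eqI) (auto simp flip: sh)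
      have "scale t (harmonic (- r)) * (C * scale t ?h) = scale (t * t) (harmonic (- r) * (C * ?h))"
        by (rule l1_eqI) (simp add: scale_mult_left scale_mult_right)
      then show ?thesis
        unfolding Ab st by (simp add: algebra_simps scale_mult_left scale_mult_right)
    qed
    moreover have "cf (harmonic (- r) * (C * A)) 0 = d" using d by (simp add: cf_harmonic_times)
    moreover have "cf (star A * (C * ?h)) 0 = d"
    proof -
      have "star A * (C * ?h) = star (harmonic (- r) * (C * A))"
        unfolding sh[symmetric] by (simp add: star_mult star_C mult_ac)
      then show ?thesis using d by (simp add: cf_harmonic_times)
    qed
    moreover have "cf (harmonic (- r) * (C * ?h)) 0 = c 0"
      using hh by (metis cf_C mult.left_commute mult.right_neutral)
    ultimately have "complex_of_real (ar_error c p b) = complex_of_real (ar_error c p a - t * d - t * d + t * t * c 0)"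
      unfolding ar_error_eq[of p b] by (simp add: A_def ar_error_eq[of p a])
    then have "ar_error c p b = ar_error c p a - t * d - t * d + t * t * c 0"
      by (simp only: of_real_eq_iff)
    with \<open>ar_error c p a \<le> ar_error c p b\<close> show ?thesis
      by (simp add: power2_eq_square mult_ac)
  qed
  \<comment> \<open>The vertex t = d / c(0) of the parabola.\<close>
  have "0 \<le> - (d * d / c 0)"
    using quad[of "d / c 0"] c_0_pos by (simp add: power2_eq_square field_simps)
  then have "d * d \<le> 0" using c_0_pos by (simp add: divide_le_0_iff zero_le_divide_iff)
  then have "d = 0" by (metis mult_eq_0_iff not_square_less_zero order_le_less)
  then show ?thesis using d by (simp add: A_def)
qed

text \<open>star A lives on -p..0 and C * A vanishes on 1..p, so only one product contributes to the
  coefficient at 0. The second bound compares with the predictor 0.\<close>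

lemma best_ar_error:
  assumes "best_ar c p a"
  shows "cf (C * ar_poly p a) 0 = ar_error c p a" "ar_error c p a \<le> c 0"
proof -
  have "cf (star (ar_poly p a) * (C * ar_poly p a)) 0 = cf (star (ar_poly p a)) 0 * cf (C * ar_poly p a) (0 - 0)"
  proof (rule cf_times_single)
    fix k :: int assume "k \<noteq> 0"
    then show "cf (star (ar_poly p a)) k = 0 \<or> cf (C * ar_poly p a) (0 - k) = 0"
      using best_ar_normal_equations[OF assms, of "- k"] by (auto simp: cf_ar_poly)
  qed
  then show "cf (C * ar_poly p a) 0 = ar_error c p a"
    unfolding ar_error_eq by (simp add: cf_ar_poly)
  have "\<not> ar_error c p (\<lambda>_. 0) < ar_error c p a"
    using assms by (auto simp: best_ar_def is_arg_min_def)
  then show "ar_error c p a \<le> c 0" by (simp add: ar_error_zero)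
qed

text \<open>Baxter's inequality needs a small tail and so works from some p0 on. Below p0 crude
  bounds suffice, inflated by p0^K; the constants add up both cases.\<close>

lemma best_ar_close:
  assumes fac: "l1_factorization C \<Phi> \<Psi> s" and w: "wsum K \<Phi>"
  obtains C1 C2 where "C1 \<ge> 0" "C2 \<ge> 0"
    "\<And>p a. p \<ge> 1 \<Longrightarrow> best_ar c p a \<Longrightarrow> norm1 (ar_poly p a - \<Phi>) \<le> C1 * real p powr (- K)"
    "\<And>p a. p \<ge> 1 \<Longrightarrow> best_ar c p a \<Longrightarrow> \<bar>ar_error c p a - s\<bar> \<le> C2 * real p powr (- K)"
proof -
  interpret l1_factorization C \<Phi> \<Psi> s by fact
  define F G W where "F = norm1 \<Phi>" and "G = norm1 \<Psi>" and "W = wnorm K \<Phi>"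
  have nonneg: "0 \<le> F" "0 \<le> G" "0 \<le> W" by (simp_all add: F_def G_def W_def)
  \<comment> \<open>As K > 1, the tail is at most p^(-K) W <= W / p, so p >= 2 G W gives the
    smallness 1/2.\<close>
  define p0 :: nat where "p0 = nat \<lceil>2 * G * W\<rceil> + 1"
  define \<rho> where "\<rho> = 3 * G * (1 + G * F) * c 0 * W"
  \<comment> \<open>This bounds every coefficient of \<open>ar_poly p a\<close>, because the minimal
    error is at most c(0).\<close>
  define b where "b = (c 0 / m + 1) / 2"
  define C1 where "C1 = 2 / s * F * F * \<rho> + ((real p0 + 1) * b + F) * real p0 powr K"
  define C2 where "C2 = F * \<rho> + (c 0 + s) * real p0 powr K"
  have \<rho>0: "\<rho> \<ge> 0" and b0: "b \<ge> 0" using nonneg c_0_pos m_pos by (auto simp: \<rho>_def b_def)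
  have parts: "0 \<le> 2 / s * F * F * \<rho>" "0 \<le> ((real p0 + 1) * b + F) * real p0 powr K"
    "0 \<le> F * \<rho>" "0 \<le> (c 0 + s) * real p0 powr K"
    using nonneg \<rho>0 b0 s_pos c_0_pos by auto
  have main: "norm1 (ar_poly p a - \<Phi>) \<le> C1 * real p powr (- K) \<and> \<bar>ar_error c p a - s\<bar> \<le> C2 * real p powr (- K)"
    if p: "p \<ge> 1" and best: "best_ar c p a" for p a
  proof -
    define X where "X = real p powr (- K)"
    have X: "X > 0" using p by (simp add: X_def)
    define E where "E = ar_error c p a"
    have E: "0 \<le> E" "E \<le> c 0" using ar_error_ge[of p a] m_pos best_ar_error(2)[OF best] by (auto simp: E_def)
    show ?thesis
    proof (cases "p \<ge> p0")
      case True
      define T where "T = norm1 (proj {int p<..} \<Phi>)"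
      have T: "T \<le> X * W" using wnorm_proj_tail_le(2)[of 0 K \<Phi> p] w K p by (simp add: T_def X_def W_def)
      have "2 * G * W \<le> real p" using True by (simp add: p0_def) linarith
      moreover have "X \<le> 1 / real p"
        using powr_mono[of "- K" "- 1" "real p"] p K by (simp add: X_def powr_minus_divide)
      ultimately have "G * (X * W) \<le> 1 / 2"
      proof -
        have "G * (X * W) \<le> G * (1 / real p * W)"
          using \<open>X \<le> 1 / real p\<close> nonneg by (intro mult_left_mono mult_right_mono) auto
        also have "\<dots> \<le> 1 / 2" using \<open>2 * G * W \<le> real p\<close> p by (simp add: field_simps)
        finally show ?thesis .
      qed
      then have small: "norm1 \<Psi> * T \<le> 1 / 2"
        using mult_left_mono[OF T nonneg(2)] by (simp add: G_def)
      define R where "R = 3 * norm1 \<Psi> * (1 + norm1 \<Psi> * norm1 \<Phi>) * E * T"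
      have supp: "cf (ar_poly p a) n = 0" if "n \<notin> {0..int p}" for n using that by (auto simp: cf_ar_poly)
      have "cf (ar_poly p a) 0 = 1" by (simp add: cf_ar_poly)
      note bax = baxter[OF supp this best_ar_error(1)[OF best, folded E_def] best_ar_normal_equations[OF best] E(1) T_def small,
          folded R_def]
      have "R = 3 * G * (1 + G * F) * (E * T)" by (simp add: R_def G_def F_def)
      also have "\<dots> \<le> 3 * G * (1 + G * F) * (c 0 * (X * W))"
        using T E nonneg by (intro mult_left_mono mult_mono) (auto simp: T_def)
      also have "\<dots> = \<rho> * X" by (simp add: \<rho>_def)
      finally have R: "R \<le> \<rho> * X" .
      have "norm1 (ar_poly p a - \<Phi>) \<le> 2 / s * F * F * R" using bax(1) by (simp add: F_def)
      also have "\<dots> \<le> 2 / s * F * F * (\<rho> * X)" using R nonneg s_pos by (intro mult_left_mono) auto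
      also have "\<dots> \<le> C1 * X"
        using mult_right_mono[OF parts(2), of X] X by (simp add: C1_def distrib_right)
      finally have 1: "norm1 (ar_poly p a - \<Phi>) \<le> C1 * X" .
      have "\<bar>E - s\<bar> \<le> F * R" using bax(2) by (simp add: F_def)
      also have "\<dots> \<le> F * (\<rho> * X)" using R nonneg by (intro mult_left_mono) auto
      also have "\<dots> \<le> C2 * X"
        using mult_right_mono[OF parts(4), of X] X by (simp add: C2_def distrib_right)
      finally show ?thesis using 1 by (simp add: E_def X_def)
    next
      case False
      have one: "1 \<le> real p0 powr K * X"
        using False p K powr_mono2[of K "real p" "real p0"] by (simp add: X_def powr_minus_divide)
      have "norm1 (ar_poly p a) = (\<Sum>n\<in>{0..int p}. weight 0 n * norm (cf (ar_poly p a) n))"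
        by (rule wsumI_finite) (auto simp: cf_ar_poly)
      also have "\<dots> \<le> (\<Sum>n\<in>{0..int p}. b)"
      proof (rule sum_mono)
        fix n
        have "norm (cf (ar_poly p a) n) \<le> (E / m + 1) / 2" unfolding E_def by (rule norm_cf_ar_poly_le)
        also have "\<dots> \<le> b" using E m_pos by (simp add: b_def divide_right_mono)
        finally show "weight 0 n * norm (cf (ar_poly p a) n) \<le> b" by simp
      qed
      also have "\<dots> \<le> (real p0 + 1) * b" using False b0 by (simp add: mult_right_mono)
      finally have "norm1 (ar_poly p a - \<Phi>) \<le> (real p0 + 1) * b + F"
        using norm1_simps(2)[of "ar_poly p a" \<Phi>] by (simp add: F_def)
      also have "\<dots> \<le> ((real p0 + 1) * b + F) * (real p0 powr K * X)"
        using mult_left_mono[OF one, of "(real p0 + 1) * b + F"] b0 nonneg by simp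
      also have "\<dots> \<le> C1 * X"
        using mult_right_mono[OF parts(1), of X] X by (simp add: C1_def distrib_right mult.assoc)
      finally have 1: "norm1 (ar_poly p a - \<Phi>) \<le> C1 * X" .
      have "\<bar>E - s\<bar> \<le> c 0 + s" using E s_pos by auto
      also have "\<dots> \<le> (c 0 + s) * (real p0 powr K * X)"
        using mult_left_mono[OF one, of "c 0 + s"] c_0_pos s_pos by simp
      also have "\<dots> \<le> C2 * X"
        using mult_right_mono[OF parts(3), of X] X by (simp add: C2_def distrib_right mult.assoc)
      finally show ?thesis using 1 by (simp add: E_def X_def)
    qed
  qed
  show ?thesis
    by (rule that[of C1 C2]) (use main parts in \<open>auto simp: C1_def C2_def\<close>)
qed

end

section \<open>The Toeplitz equation\<close>

context l1_factorization
begin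

text \<open>The Wiener-Hopf formula: the solution of the semi-infinite system whose right side is
  the l-th unit vector.\<close>

definition sol :: "nat \<Rightarrow> l1" where
  "sol l = scale (1 / s) (\<Phi> * proj {0..} (harmonic (int l) * star \<Phi>))"

text \<open>C * \<Phi> = s star \<Psi> turns the product into star \<Psi> times the nonnegative part
  of y. Without the cut star \<Psi> * y would be the harmonic itself, and the part cut off stays on
  negative indices under star \<Psi>.\<close>

lemma C_sol:
  assumes "n \<ge> 0"
  shows "cf (C * sol l) n = cf (harmonic (int l)) n"
proof -
  define y where "y = harmonic (int l) * star \<Phi>"
  have y: "proj {0..} y = y - proj {..<0} y" by (rule l1_eqI) auto
  have "C * sol l = star \<Psi> * proj {0..} y"
    using s_pos C_\<Phi> by (simp add: sol_def y_def scale_mult_right mult.assoc[symmetric] scale_mult_left l1_eqI)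
  also have "\<dots> = harmonic (int l) - star \<Psi> * proj {..<0} y"
  proof -
    have "star \<Psi> * y = harmonic (int l)"
      unfolding y_def using star_inverse by (metis mult.commute mult.left_commute mult.right_neutral)
    then show ?thesis by (simp add: y right_diff_distrib)
  qed
  finally have "C * sol l = harmonic (int l) - star \<Psi> * proj {..<0} y" .
  moreover have "cf (star \<Psi> * proj {..<0} y) n = 0"
    by (rule cf_times_eq_0) (use assms \<Psi>_causal in \<open>simp; smt (verit)\<close>)
  ultimately show ?thesis by simp
qed

lemma sol_causal: "n < 0 \<Longrightarrow> cf (sol l) n = 0"
proof -
  assume "n < 0"
  then have "cf (\<Phi> * proj {0..} (harmonic (int l) * star \<Phi>)) n = 0"
    by (intro cf_times_eq_0) (use \<Phi>_causal in \<open>simp; smt (verit)\<close>)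
  then show ?thesis by (simp add: sol_def)
qed

lemma ev_sol: "ev (sol l) \<omega> = ev \<Phi> \<omega> * (cis (real l * \<omega>) * cnj (ev \<Phi> \<omega>) + cnj (ev (tail l \<Phi>) \<omega>)) / s"
proof -
  \<comment> \<open>The coefficients at negative indices that the projection removes are exactly
    those of - star (tail l \<Phi>).\<close>
  have "proj {0..} (harmonic (int l) * star \<Phi>) = harmonic (int l) * star \<Phi> + star (tail l \<Phi>)"
    by (rule l1_eqI) (auto simp: cf_tail cf_harmonic_times)
  then show ?thesis by (simp add: sol_def ev_mult ev_star)
qed

end

lemma cf_mult_sum: "cf (x * (\<Sum>l\<in>J. scale (g l) (y l))) n = (\<Sum>l\<in>J. g l * cf (x * y l) n)"
  by (simp add: sum_distrib_left scale_mult_right cf_sum)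

lemma ev_sum: "ev (sum f J) \<omega> = (\<Sum>j\<in>J. ev (f j) \<omega>)"
  by (induction J rule: infinite_finite_induct) auto

context spectral_bounds
begin

text \<open>Positivity of \<open>T(f)\<close> controls the error of the partial sums: for \<open>D = H - H\<^sub>n\<close> and
  \<open>E = G - G\<^sub>n\<close>, the relation \<open>T(f) (h - h\<^sub>n) = g - g\<^sub>n\<close> gives \<open>\<integral> f |D|\<^sup>2 = \<integral> D cnj E\<close>.\<close>

lemma Toeplitz_solution:
  assumes fac: "l1_factorization C \<Phi> \<Psi> s"
    and phi: "AE \<omega> in circle. phi \<omega> = ev \<Phi> \<omega>" and phi_tail: "\<And>l. AE \<omega> in circle. phi_tail l \<omega> = ev (tail l \<Phi>) \<omega>"
    and f_phi: "AE \<omega> in circle. spectral_density c \<omega> = s / (cmod (phi \<omega>))\<^sup>2"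
    and sol: "\<And>l. (\<lambda>j. h j * complex_of_real (c (int l - int j))) sums g l"
    and G: "has_fourier_series G g" and H: "has_fourier_series H h"
    and N: "L2_sums (\<lambda>l \<omega>. g l * (cis (real l * \<omega>) + inverse (cnj (phi \<omega>)) * cnj (phi_tail l \<omega>))) N"
  shows "AE \<omega> in circle. H \<omega> = N \<omega> / complex_of_real (spectral_density c \<omega>)"
proof -
  interpret l1_factorization C \<Phi> \<Psi> s by fact
  define u where "u l \<omega> = g l * (cis (real l * \<omega>) + inverse (cnj (phi \<omega>)) * cnj (phi_tail l \<omega>))" for l \<omega>
  define Hn where "Hn n = (\<Sum>l<n. scale (g l) (sol l))" for n
  define Gn where "Gn n = (\<Sum>l<n. scale (g l) (harmonic (int l)))" for n :: nat
  note G' = L2_sumsD[OF G[unfolded has_fourier_series_def]]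
  note H' = L2_sumsD[OF H[unfolded has_fourier_series_def]]
  note N' = L2_sumsD[OF N[folded u_def]]
  have tails: "AE \<omega> in circle. \<forall>l. phi_tail l \<omega> = ev (tail l \<Phi>) \<omega>"
    using phi_tail by (simp add: AE_all_countable)
  \<comment> \<open>By 1 / f = |phi|^2 / s, a partial sum of the numerator divided by f is a finite
    combination of exact solutions.\<close>
  have Hn_eq: "AE \<omega> in circle. ev (Hn n) \<omega> = (\<Sum>l<n. u l \<omega>) / spectral_density c \<omega>" for n
    using phi f_phi tails
  proof eventually_elim
    case (elim \<omega>)
    have phi0: "ev \<Phi> \<omega> \<noteq> 0" using elim f_pos[of \<omega>] by auto
    have f_eq: "complex_of_real (spectral_density c \<omega>) = s / (ev \<Phi> \<omega> * cnj (ev \<Phi> \<omega>))"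
      using elim by (simp flip: complex_norm_square)
    then have "u l \<omega> / spectral_density c \<omega> = g l * ev (sol l) \<omega>" for l
      unfolding f_eq u_def ev_sol using elim(1,3) phi0 s_pos by (simp add: field_simps)
    then show ?case by (simp add: Hn_def ev_sum sum_divide_distrib)
  qed
  have cf_CHn: "cf (C * Hn n) (int j) = cf (Gn n) (int j)" for n j
    by (simp add: Hn_def Gn_def cf_mult_sum C_sol cf_sum)
  have ev_Gn: "ev (Gn n) \<omega> = (\<Sum>l<n. g l * cis (real l * \<omega>))" for n \<omega>
    by (simp add: Gn_def ev_sum)
  define I where "I F = (\<integral>\<omega>. (cmod (F \<omega>))\<^sup>2 \<partial>circle)" for F :: "real \<Rightarrow> complex"
  have conv1: "(\<lambda>n. I (\<lambda>\<omega>. H \<omega> - ev (Hn n) \<omega>)) \<longlonglongrightarrow> 0"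
  proof (rule Lim_null_comparison)
    have "(\<lambda>n. I (\<lambda>\<omega>. G \<omega> - ev (Gn n) \<omega>) / m\<^sup>2) \<longlonglongrightarrow> 0 / m\<^sup>2"
      using G'(4) m_pos unfolding ev_Gn I_def by (intro tendsto_divide tendsto_const) auto
    then show "(\<lambda>n. I (\<lambda>\<omega>. G \<omega> - ev (Gn n) \<omega>) / m\<^sup>2) \<longlonglongrightarrow> 0" by simp
    have "I (\<lambda>\<omega>. H \<omega> - ev (Hn n) \<omega>) \<le> I (\<lambda>\<omega>. G \<omega> - ev (Gn n) \<omega>) / m\<^sup>2" for n
    proof -
      define D E where "D \<omega> = H \<omega> - ev (Hn n) \<omega>" and "E \<omega> = G \<omega> - ev (Gn n) \<omega>" for \<omega>
      have "cf (Hn n) k = 0" if "k < 0" for k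
        using that by (simp add: Hn_def cf_sum sol_causal)
      then have D: "has_fourier_series D (\<lambda>j. h j - cf (Hn n) (int j))"
        unfolding D_def by (intro has_fourier_series_diff H has_fourier_series_ev)
      have L2D: "D \<in> L2_circle" and L2E: "E \<in> L2_circle"
        unfolding D_def E_def by (intro L2_circle_diff H' G' L2_circle_ev)+
      have fB: "(\<lambda>\<omega>. ev C \<omega> * F \<omega>) \<in> L2_circle" if "F \<in> L2_circle" for F
        by (rule L2_circle_bounded_mult[OF that, of "ev C" "norm1 C"]) (auto intro: norm_ev_le)
      \<comment> \<open>In conjugated form: f D and E have equal Fourier coefficients at j >= 0. For
        H this is the given system, for \<open>Hn\<close> it is \<open>C_sol\<close>.\<close>
      have coeff: "(\<integral>\<omega>. cis (real j * \<omega>) * (ev C \<omega> * cnj (D \<omega>)) \<partial>circle) = (\<integral>\<omega>. cis (real j * \<omega>) * cnj (E \<omega>) \<partial>circle)" for j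
      proof -
        let ?e = "\<lambda>\<omega>. cis (- real_of_int (int j) * \<omega>)"
        have B: "(\<lambda>\<omega>. ev C \<omega> * ?e \<omega>) \<in> L2_circle" by (rule fB[OF L2_circle_cis])
        have "(\<lambda>i. h i * (2 * pi * cf C (int j - int i))) sums (\<integral>\<omega>. H \<omega> * (ev C \<omega> * ?e \<omega>) \<partial>circle)"
          using has_fourier_series_pairing[OF H B] by (simp only: integral_cis_ev)
        moreover have "(\<lambda>i. h i * (2 * pi * cf C (int j - int i))) sums (2 * pi * g j)"
          using sums_mult[OF sol[of j], of "2 * complex_of_real pi"] by (simp add: mult_ac)
        ultimately have 1: "(\<integral>\<omega>. H \<omega> * (ev C \<omega> * ?e \<omega>) \<partial>circle) = 2 * pi * g j"
          by (rule sums_unique2)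
        have 2: "(\<integral>\<omega>. ev (Hn n) \<omega> * (ev C \<omega> * ?e \<omega>) \<partial>circle) = 2 * pi * cf (Gn n) (int j)"
          using cf_eq_integral[of "C * Hn n" "int j"] unfolding cf_CHn ev_mult by (simp add: mult_ac)
        have 3: "(\<integral>\<omega>. G \<omega> * ?e \<omega> \<partial>circle) = 2 * pi * g j"
          using has_fourier_series_causal_coeff[OF G, of "int j"] by simp
        have 4: "(\<integral>\<omega>. ev (Gn n) \<omega> * ?e \<omega> \<partial>circle) = 2 * pi * cf (Gn n) (int j)"
          using cf_eq_integral[of "Gn n" "int j"] by simp
        have "(\<integral>\<omega>. D \<omega> * (ev C \<omega> * ?e \<omega>) \<partial>circle) = 2 * pi * g j - 2 * pi * cf (Gn n) (int j)"
          unfolding D_def left_diff_distrib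
          using Bochner_Integration.integral_diff[OF L2_circle_mult(1)[OF H'(2) B zero_less_one] L2_circle_mult(1)[OF L2_circle_ev B zero_less_one]]
          by (simp only: 1 2)
        also have "\<dots> = (\<integral>\<omega>. E \<omega> * ?e \<omega> \<partial>circle)"
          unfolding E_def left_diff_distrib
          using Bochner_Integration.integral_diff[OF L2_circle_mult(1)[OF G'(2) L2_circle_cis zero_less_one] L2_circle_mult(1)[OF L2_circle_ev L2_circle_cis zero_less_one]]
          by (simp only: 3 4)
        finally have eq: "(\<integral>\<omega>. D \<omega> * (ev C \<omega> * ?e \<omega>) \<partial>circle) = (\<integral>\<omega>. E \<omega> * ?e \<omega> \<partial>circle)" .
        have "cis (real j * \<omega>) * (ev C \<omega> * cnj (D \<omega>)) = cnj (D \<omega> * (ev C \<omega> * ?e \<omega>))" for \<omega>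
          by (simp add: cis_cnj ev_C mult_ac)
        moreover have "cis (real j * \<omega>) * cnj (E \<omega>) = cnj (E \<omega> * ?e \<omega>)" for \<omega>
          by (simp add: cis_cnj mult_ac)
        ultimately show ?thesis by (simp only: Bochner_Integration.integral_cnj eq)
      qed
      \<comment> \<open>D has only frequencies j >= 0, so these pairings see only the coefficients
        just compared.\<close>
      have "(\<integral>\<omega>. D \<omega> * (ev C \<omega> * cnj (D \<omega>)) \<partial>circle) = (\<integral>\<omega>. D \<omega> * cnj (E \<omega>) \<partial>circle)"
        using has_fourier_series_pairing[OF D fB[OF L2_circle_cnj[OF L2D]]]
          has_fourier_series_pairing[OF D L2_circle_cnj[OF L2E]]
        unfolding coeff by (rule sums_unique2)
      moreover have "D \<omega> * (ev C \<omega> * cnj (D \<omega>)) = complex_of_real (spectral_density c \<omega> * (cmod (D \<omega>))\<^sup>2)" for \<omega>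
        unfolding of_real_mult complex_norm_square by (simp add: ev_C)
      ultimately have eq: "complex_of_real (\<integral>\<omega>. spectral_density c \<omega> * (cmod (D \<omega>))\<^sup>2 \<partial>circle) = (\<integral>\<omega>. D \<omega> * cnj (E \<omega>) \<partial>circle)"
        by (simp only: integral_complex_of_real)
      have iD: "integrable circle (\<lambda>\<omega>. (cmod (D \<omega>))\<^sup>2)" using L2D by (simp add: L2_circle_def)
      have [measurable]: "D \<in> borel_measurable circle" using L2D by (simp add: L2_circle_def)
      have "m * I D = (\<integral>\<omega>. m * (cmod (D \<omega>))\<^sup>2 \<partial>circle)" by (simp add: I_def)
      also have "\<dots> \<le> (\<integral>\<omega>. spectral_density c \<omega> * (cmod (D \<omega>))\<^sup>2 \<partial>circle)"
      proof (rule integral_mono)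
        show "integrable circle (\<lambda>\<omega>. m * (cmod (D \<omega>))\<^sup>2)" using iD by simp
        show "integrable circle (\<lambda>\<omega>. spectral_density c \<omega> * (cmod (D \<omega>))\<^sup>2)"
          by (rule Bochner_Integration.integrable_bound[of _ "\<lambda>\<omega>. M * (cmod (D \<omega>))\<^sup>2"])
             (use iD f_le f_pos in \<open>auto intro!: AE_I2 mult_right_mono simp: abs_mult less_imp_le order_trans[OF _ abs_ge_self]\<close>)
        show "m * (cmod (D \<omega>))\<^sup>2 \<le> spectral_density c \<omega> * (cmod (D \<omega>))\<^sup>2" for \<omega>
          by (intro mult_right_mono f_ge) simp
      qed
      also have "\<dots> \<le> norm (\<integral>\<omega>. D \<omega> * cnj (E \<omega>) \<partial>circle)"
        unfolding eq[symmetric] by simp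
      \<comment> \<open>The parameter t = m lets half of m I(D) be absorbed on the left, leaving
        I(D) <= I(E) / m^2.\<close>
      also have "\<dots> \<le> (m * I D + I E / m) / 2"
        using L2_circle_mult(2)[OF L2D L2_circle_cnj[OF L2E] m_pos] by (simp add: I_def)
      finally have "m * I D \<le> I E / m" by simp
      then show ?thesis
        using m_pos by (simp add: D_def[abs_def] E_def[abs_def] power2_eq_square field_simps)
    qed
    then show "\<forall>\<^sub>F n in sequentially. norm (I (\<lambda>\<omega>. H \<omega> - ev (Hn n) \<omega>)) \<le> I (\<lambda>\<omega>. G \<omega> - ev (Gn n) \<omega>) / m\<^sup>2"
      by (simp add: I_def)
  qed
  define Q where "Q \<omega> = N \<omega> / complex_of_real (spectral_density c \<omega>)" for \<omega>
  have inv_le: "norm (1 / complex_of_real (spectral_density c \<omega>)) \<le> 1 / m" for \<omega>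
    using f_ge[of \<omega>] f_pos[of \<omega>] m_pos by (simp add: norm_divide divide_simps)
  have L2_div: "(\<lambda>\<omega>. F \<omega> / complex_of_real (spectral_density c \<omega>)) \<in> L2_circle" if "F \<in> L2_circle" for F
    using L2_circle_bounded_mult[OF that, of "\<lambda>\<omega>. 1 / complex_of_real (spectral_density c \<omega>)" "1 / m"] inv_le by simp
  have L2Q: "Q \<in> L2_circle" unfolding Q_def by (rule L2_div[OF N'(2)])
  \<comment> \<open>H and Q are L2 limits of the same sequence \<open>Hn\<close>; here the
    difference is the remainder of the series for N, divided by f >= m.\<close>
  have conv2: "(\<lambda>n. I (\<lambda>\<omega>. Q \<omega> - ev (Hn n) \<omega>)) \<longlonglongrightarrow> 0"
  proof (rule Lim_null_comparison)
    have "(\<lambda>n. I (\<lambda>\<omega>. N \<omega> - (\<Sum>l<n. u l \<omega>)) / m\<^sup>2) \<longlonglongrightarrow> 0 / m\<^sup>2"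
      using N'(4) m_pos unfolding I_def by (intro tendsto_divide tendsto_const) auto
    then show "(\<lambda>n. I (\<lambda>\<omega>. N \<omega> - (\<Sum>l<n. u l \<omega>)) / m\<^sup>2) \<longlonglongrightarrow> 0" by simp
    have "I (\<lambda>\<omega>. Q \<omega> - ev (Hn n) \<omega>) \<le> I (\<lambda>\<omega>. N \<omega> - (\<Sum>l<n. u l \<omega>)) / m\<^sup>2" for n
    proof -
      have L2R: "(\<lambda>\<omega>. N \<omega> - (\<Sum>l<n. u l \<omega>)) \<in> L2_circle" by (rule L2_circle_diff[OF N'(2,3)])
      have L2R': "(\<lambda>\<omega>. Q \<omega> - ev (Hn n) \<omega>) \<in> L2_circle" by (rule L2_circle_diff[OF L2Q L2_circle_ev])
      have "I (\<lambda>\<omega>. Q \<omega> - ev (Hn n) \<omega>) \<le> (\<integral>\<omega>. (cmod (N \<omega> - (\<Sum>l<n. u l \<omega>)))\<^sup>2 / m\<^sup>2 \<partial>circle)"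
        unfolding I_def
      proof (rule integral_mono_AE)
        show "AE \<omega> in circle. (cmod (Q \<omega> - ev (Hn n) \<omega>))\<^sup>2 \<le> (cmod (N \<omega> - (\<Sum>l<n. u l \<omega>)))\<^sup>2 / m\<^sup>2"
          using Hn_eq[of n]
        proof eventually_elim
          case (elim \<omega>)
          have "Q \<omega> - ev (Hn n) \<omega> = (N \<omega> - (\<Sum>l<n. u l \<omega>)) * (1 / complex_of_real (spectral_density c \<omega>))"
            by (simp add: elim Q_def diff_divide_distrib)
          then have "cmod (Q \<omega> - ev (Hn n) \<omega>) \<le> cmod (N \<omega> - (\<Sum>l<n. u l \<omega>)) * (1 / m)"
            by (simp only: norm_mult) (intro mult_left_mono inv_le norm_ge_zero)
          then have "(cmod (Q \<omega> - ev (Hn n) \<omega>))\<^sup>2 \<le> (cmod (N \<omega> - (\<Sum>l<n. u l \<omega>)) * (1 / m))\<^sup>2"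
            by (rule power_mono) simp
          then show ?case by (simp add: power_divide)
        qed
      qed (use L2R L2R' in \<open>auto simp: L2_circle_def\<close>)
      then show ?thesis by (simp add: I_def)
    qed
    then show "\<forall>\<^sub>F n in sequentially. norm (I (\<lambda>\<omega>. Q \<omega> - ev (Hn n) \<omega>)) \<le> I (\<lambda>\<omega>. N \<omega> - (\<Sum>l<n. u l \<omega>)) / m\<^sup>2"
      by (simp add: I_def)
  qed
  show ?thesis
    using L2_limit_unique[OF H'(2) L2Q L2_circle_ev conv1[unfolded I_def] conv2[unfolded I_def]] by (simp add: Q_def)
qed

end

section \<open>The error bound\<close>

text \<open>The coefficient at j enters the l-th tail only for l < j, hence at most j times: the sum
  over l costs one power of the weight.\<close>

lemma sum_norm1_tail_le:
  assumes "wsum 1 x"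
  shows "(\<Sum>l<n. norm1 (tail l x)) \<le> wnorm 1 x"
proof -
  have tail_le: "norm1 (tail l x) \<le> norm1 (proj {int l<..} x)" for l
  proof -
    have "norm1 (harmonic (- int l)) = 1"
      using wsumI_finite(2)[of "{- int l}" "harmonic (- int l)" 0] by simp
    moreover have "tail l x = - (harmonic (- int l) * proj {int l<..} x)"
      by (rule l1_eqI) (simp add: cf_tail cf_harmonic_times)
    ultimately show ?thesis
      using norm1_simps(3)[of "harmonic (- int l)" "proj {int l<..} x"] by (simp add: norm1_simps(5))
  qed
  let ?f = "\<lambda>l j. norm (cf (proj {int l<..} x) j)"
  have hs: "((\<lambda>j. \<Sum>l<n. ?f l j) has_sum (\<Sum>l<n. norm1 (proj {int l<..} x))) UNIV"
  proof (induction n)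
    case (Suc n)
    have "(?f n has_sum norm1 (proj {int n<..} x)) UNIV"
      using cf_summable[of "proj {int n<..} x"] by (simp add: wnorm_def has_sum_infsum)
    from has_sum_add[OF Suc this] show ?case by simp
  qed simp
  have "(\<Sum>l<n. norm1 (proj {int l<..} x)) \<le> wnorm 1 x"
    unfolding wnorm_def[of 1]
  proof (rule has_sum_mono[OF hs has_sum_infsum[OF assms[unfolded wsum_def]]])
    fix j
    have "(\<Sum>l<n. ?f l j) = (\<Sum>l\<in>{l. l < n \<and> int l < j}. norm (cf x j))"
      by (rule sum.mono_neutral_cong_right) auto
    also have "\<dots> = real (card {l. l < n \<and> int l < j}) * norm (cf x j)" by simp
    also have "\<dots> \<le> weight 1 j * norm (cf x j)"
    proof (rule mult_right_mono)
      have "card {l. l < n \<and> int l < j} \<le> card {..<nat j}"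
        by (rule card_mono) auto
      then show "real (card {l. l < n \<and> int l < j}) \<le> weight 1 j"
        by (simp add: weight_def)
    qed simp
    finally show "(\<Sum>l<n. ?f l j) \<le> weight 1 j * norm (cf x j)" .
  qed
  moreover have "(\<Sum>l<n. norm1 (tail l x)) \<le> (\<Sum>l<n. norm1 (proj {int l<..} x))"
    by (intro sum_mono tail_le)
  ultimately show ?thesis by linarith
qed

lemma tail_diff: "tail l (x - y) = tail l x - tail l y"
  by (rule l1_eqI) (simp add: cf_tail)

text \<open>The pointwise bound involves all three limits at the same \<omega>, so one subsequence
  must serve them together; it is extracted from the sum of the three squared errors.\<close>

lemma L2_sums_AE_subseq:
  assumes u: "L2_sums u F" and v: "L2_sums v G" and w: "L2_sums w H"
  shows "\<exists>r :: nat \<Rightarrow> nat. AE \<omega> in circle. (\<lambda>n. \<Sum>j<r n. u j \<omega>) \<longlonglongrightarrow> F \<omega> \<and> (\<lambda>n. \<Sum>j<r n. v j \<omega>) \<longlonglongrightarrow> G \<omega> \<and>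
       (\<lambda>n. \<Sum>j<r n. w j \<omega>) \<longlonglongrightarrow> H \<omega>"
proof -
  define d where "d = (\<lambda>(u :: nat \<Rightarrow> real \<Rightarrow> complex) F n \<omega>. (cmod (F \<omega> - (\<Sum>j<n. u j \<omega>)))\<^sup>2)"
  have i: "integrable circle (d u F n)" and lim: "(\<lambda>n. \<integral>\<omega>. d u F n \<omega> \<partial>circle) \<longlonglongrightarrow> 0"
    if "L2_sums u F" for u F n
    using L2_circle_diff[OF L2_sumsD(2,3)[OF that]] L2_sumsD(4)[OF that]
    by (auto simp: d_def L2_circle_def)
  have d0: "0 \<le> d u F n \<omega>" for u F n \<omega> by (simp add: d_def)
  let ?s = "\<lambda>n \<omega>. d u F n \<omega> + d v G n \<omega> + d w H n \<omega>"
  have "(\<lambda>n. \<integral>\<omega>. norm (?s n \<omega>) \<partial>circle) \<longlonglongrightarrow> 0"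
    using tendsto_add[OF tendsto_add[OF lim[OF u] lim[OF v]] lim[OF w]] by (simp add: d0 i u v w)
  from tendsto_L1_AE_subseq[OF _ this]
  obtain r where r: "AE \<omega> in circle. (\<lambda>n. ?s (r n) \<omega>) \<longlonglongrightarrow> 0" by (auto simp: i u v w)
  have conv: "(\<lambda>n. \<Sum>j<r n. u j \<omega>) \<longlonglongrightarrow> F \<omega>" if "(\<lambda>n. d u F (r n) \<omega>) \<longlonglongrightarrow> 0" for u F \<omega>
  proof -
    have "(\<lambda>n. cmod (F \<omega> - (\<Sum>j<r n. u j \<omega>))) \<longlonglongrightarrow> 0"
      using tendsto_real_sqrt[OF that] by (simp add: d_def)
    then have "(\<lambda>n. F \<omega> - (\<Sum>j<r n. u j \<omega>)) \<longlonglongrightarrow> 0" by (rule tendsto_norm_zero_cancel)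
    from tendsto_diff[OF tendsto_const[of "F \<omega>"] this] show ?thesis by simp
  qed
  have sq: "(\<lambda>n. a n) \<longlonglongrightarrow> 0" if "s \<longlonglongrightarrow> 0" "\<And>n. 0 \<le> a n" "\<And>n. a n \<le> s n" for a s :: "nat \<Rightarrow> real"
    by (rule Lim_null_comparison[OF always_eventually that(1)]) (use that in auto)
  show ?thesis
  proof (rule exI[of _ r])
    show "AE \<omega> in circle. (\<lambda>n. \<Sum>j<r n. u j \<omega>) \<longlonglongrightarrow> F \<omega> \<and> (\<lambda>n. \<Sum>j<r n. v j \<omega>) \<longlonglongrightarrow> G \<omega> \<and>
       (\<lambda>n. \<Sum>j<r n. w j \<omega>) \<longlonglongrightarrow> H \<omega>"
      using r
    proof eventually_elim
      case (elim \<omega>)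
      show ?case
        by (intro conjI conv sq[OF elim]) (auto simp: d0 intro: add_increasing add_increasing2)
    qed
  qed
qed

lemma inj_on_cis: "inj_on cis {0..<2 * pi}"
proof (rule inj_onI)
  fix x y assume "x \<in> {0..<2 * pi}" "y \<in> {0..<2 * pi}" "cis x = cis y"
  then show "x = y"
    using Arg2pi_unique[of 1 x "cis x"] Arg2pi_unique[of 1 y "cis y"] by (simp add: cis_conv_exp)
qed

text \<open>A polynomial with value 1 at 0 has finitely many roots, and \<open>cis\<close> is
  injective on the half-open interval, so the zero set is finite.\<close>

lemma AE_ar_filter_nonzero: "AE \<omega> in circle. ar_filter p a \<omega> \<noteq> 0"
proof -
  define P where "P = 1 - (\<Sum>j=1..p. monom (complex_of_real (a j)) j)"
  have P: "poly P (cis \<omega>) = ar_filter p a \<omega>" for \<omega>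
    by (simp add: P_def ar_filter_def poly_sum poly_monom Complex.DeMoivre)
  have "poly P 0 = 1" by (simp add: P_def poly_sum poly_monom)
  then have "P \<noteq> 0" by auto
  then have fin: "finite {z. poly P z = 0}" by (rule poly_roots_finite)
  define Z where "Z = {\<omega> \<in> {0..<2 * pi}. ar_filter p a \<omega> = 0}"
  have "Z = cis -` {z. poly P z = 0} \<inter> {0..<2 * pi}" by (auto simp: Z_def P)
  then have "finite Z" using finite_vimage_IntI[OF fin inj_on_cis] by simp
  then have "Z \<in> null_sets circle"
    unfolding circle_def by (subst null_sets_restrict_space)
      (auto simp: Z_def negligible_iff_null_sets[symmetric] negligible_finite)
  then have "AE \<omega> in circle. \<omega> \<notin> Z" by (rule AE_not_in)
  then show ?thesis
    by (rule AE_mp) (auto simp: Z_def space_circle intro!: AE_I2)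
qed

text \<open>The pointwise core, applied with \<phi>, \<alpha> the values of \<Phi> and of the fitted
  filter, S a partial sum of G, and R, R' the tail sums.\<close>

lemma rational_difference_bound:
  fixes \<phi> \<alpha> S R R' :: complex and s e m X :: real
  assumes s: "s > 0" and m: "m > 0" and e: "m \<le> e" and es: "\<bar>e - s\<bar> \<le> C2 * X" and d: "norm (\<phi> - \<alpha>) \<le> C1 * X"
    and F: "norm \<phi> \<le> F" and A: "norm \<alpha> \<le> A" and R: "norm R \<le> r" and R': "norm (R - R') \<le> r'"
  shows "norm (\<phi> * (cnj \<phi> * S + R) / s - \<alpha> * (cnj \<alpha> * S + R') / e)
    \<le> (F * C2 / (s * m) + C1 / m) * X * (F * norm S + r) + A / m * (C1 * X * norm S + r')"
proof -
  have e0: "e > 0" using m e by linarith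
  have F0: "0 \<le> F" and A0: "0 \<le> A" using F A norm_ge_zero order_trans by blast+
  have C2X: "0 \<le> C2 * X" using es abs_ge_zero order_trans by blast
  have C1X: "0 \<le> C1 * X" using d norm_ge_zero order_trans by blast
  have r0: "0 \<le> r" "0 \<le> r'" using R R' norm_ge_zero order_trans by blast+
  have inv: "1 / e \<le> 1 / m" using e m by (simp add: frac_le)
  \<comment> \<open>Telescoping: first exchange the prefactor \<phi> / s for \<alpha> / e, which
    splits into the change of variance and the change of filter, then exchange the bracket.\<close>
  have eq: "\<phi> * (cnj \<phi> * S + R) / s - \<alpha> * (cnj \<alpha> * S + R') / e
      = (\<phi> * (complex_of_real (e - s) * (1 / (s * e))) + (\<phi> - \<alpha>) * (1 / e)) * (cnj \<phi> * S + R)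
        + \<alpha> * (1 / e) * (cnj (\<phi> - \<alpha>) * S + (R - R'))"
    using s e0 by (simp add: field_simps)
  have n1: "norm (\<phi> * (complex_of_real (e - s) * (1 / (s * e)))) \<le> F * (C2 * X * (1 / (s * m)))"
  proof -
    have "norm (\<phi> * (complex_of_real (e - s) * (1 / (s * e)))) = norm \<phi> * (\<bar>e - s\<bar> * (1 / (s * e)))"
      using s e0 by (simp add: norm_mult norm_divide del: of_real_diff)
    also have "\<dots> \<le> F * (C2 * X * (1 / (s * m)))"
      using s m e e0 es F F0 C2X by (intro mult_mono) (auto intro!: divide_left_mono mult_left_mono)
    finally show ?thesis .
  qed
  have n2: "norm ((\<phi> - \<alpha>) * (1 / e)) \<le> C1 * X * (1 / m)"
  proof -
    have "norm ((\<phi> - \<alpha>) * (1 / e)) = norm (\<phi> - \<alpha>) * (1 / e)"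
      using e0 by (simp add: norm_divide)
    also have "\<dots> \<le> C1 * X * (1 / m)" using d inv C1X e0 by (intro mult_mono) auto
    finally show ?thesis .
  qed
  have n3: "norm (cnj \<phi> * S + R) \<le> F * norm S + r"
    using norm_triangle_ineq[of "cnj \<phi> * S" R] R mult_right_mono[OF F, of "norm S"] by (simp add: norm_mult)
  have n4: "norm (cnj (\<phi> - \<alpha>) * S + (R - R')) \<le> C1 * X * norm S + r'"
    using norm_triangle_ineq[of "cnj (\<phi> - \<alpha>) * S" "R - R'"] R' mult_right_mono[OF d, of "norm S"]
    by (simp add: norm_mult del: complex_cnj_diff)
  have n5: "norm (\<alpha> * (1 / e)) \<le> A * (1 / m)"
  proof -
    have "norm (\<alpha> * (1 / e)) = norm \<alpha> * (1 / e)" using e0 by (simp add: norm_divide)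
    also have "\<dots> \<le> A * (1 / m)" using A A0 inv e0 by (intro mult_mono) auto
    finally show ?thesis .
  qed
  have "norm ((\<phi> * (complex_of_real (e - s) * (1 / (s * e))) + (\<phi> - \<alpha>) * (1 / e)) * (cnj \<phi> * S + R)
        + \<alpha> * (1 / e) * (cnj (\<phi> - \<alpha>) * S + (R - R')))
      \<le> (F * (C2 * X * (1 / (s * m))) + C1 * X * (1 / m)) * (F * norm S + r) + A * (1 / m) * (C1 * X * norm S + r')"
    by (intro order_trans[OF norm_triangle_ineq] add_mono order_trans[OF eq_refl[OF norm_mult]] mult_mono
        order_trans[OF norm_triangle_ineq] n1 n2 n3 n4 n5) (use F0 C2X C1X s m A0 in auto)
  then show ?thesis unfolding eq by (simp add: field_simps)
qed

context spectral_bounds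
begin

lemma final_bound:
  assumes fac: "l1_factorization C \<Phi> \<Psi> s" and w: "wsum K \<Phi>"
  shows "\<exists>B. \<forall>p a phi phi_tail g G N Np.
      p \<ge> 1 \<longrightarrow> best_ar c p a \<longrightarrow> (AE \<omega> in circle. phi \<omega> = ev \<Phi> \<omega>) \<longrightarrow>
      (\<forall>l. AE \<omega> in circle. phi_tail l \<omega> = ev (tail l \<Phi>) \<omega>) \<longrightarrow>
      (AE \<omega> in circle. spectral_density c \<omega> = s / (cmod (phi \<omega>))\<^sup>2) \<longrightarrow>
      has_fourier_series G g \<longrightarrow>
      L2_sums (\<lambda>l \<omega>. g l * (cis (real l * \<omega>) + inverse (cnj (phi \<omega>)) * cnj (phi_tail l \<omega>))) N \<longrightarrow>
      L2_sums (\<lambda>l \<omega>. g l * (cis (real l * \<omega>) +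
                 inverse (cnj (ar_filter p a \<omega>)) * cnj (ar_tail p a l \<omega>))) Np \<longrightarrow>
      (AE \<omega> in circle.
         cmod (N \<omega> / complex_of_real (spectral_density c \<omega>) - Np \<omega> / complex_of_real (ar_density c p a \<omega>))
           \<le> B * (real p powr (- K + 1) * (SUP s. cmod (g s)) + real p powr (- K) * cmod (G \<omega>)))"
proof -
  interpret l1_factorization C \<Phi> \<Psi> s by fact
  obtain C1 C2 where C12: "C1 \<ge> 0" "C2 \<ge> 0"
    and close: "\<And>p a. p \<ge> 1 \<Longrightarrow> best_ar c p a \<Longrightarrow> norm1 (ar_poly p a - \<Phi>) \<le> C1 * real p powr (- K)"
    and close': "\<And>p a. p \<ge> 1 \<Longrightarrow> best_ar c p a \<Longrightarrow> \<bar>ar_error c p a - s\<bar> \<le> C2 * real p powr (- K)"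
    using best_ar_close[OF fac w] by metis
  have w1: "wsum 1 \<Phi>"
    unfolding wsum_def
  proof (rule summable_on_comparison_test[OF w[unfolded wsum_def]])
    show "weight 1 n * norm (cf \<Phi> n) \<le> weight K n * norm (cf \<Phi> n)" for n
      unfolding weight_def using K by (intro mult_right_mono powr_mono) auto
  qed simp
  \<comment> \<open>In \<open>W'\<close>, 2 C1 comes from the indices 0..p, where 1 + j <= 2 p, and
    \<open>wnorm K \<Phi>\<close> from the tail of \<Phi> beyond p.\<close>
  define F W W' where "F = norm1 \<Phi>" and "W = wnorm 1 \<Phi>" and "W' = 2 * C1 + wnorm K \<Phi>"
  define \<kappa> where "\<kappa> = F * C2 / (s * m) + C1 / m"
  define A where "A = F + C1"
  \<comment> \<open>The first two terms multiply p^(-K) |S|, the last two p^(1 - K) sup |g_s|; their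
    sum serves both.\<close>
  define B where "B = \<kappa> * F + A / m * C1 + \<kappa> * W + A / m * W'"
  have nonneg: "0 \<le> F" "0 \<le> W" "0 \<le> W'" "0 \<le> \<kappa>" "0 \<le> A / m" "0 \<le> A"
    using C12 s_pos m_pos by (auto simp: F_def W_def W'_def \<kappa>_def A_def)
  show ?thesis
  proof (intro exI[of _ B] allI impI)
    fix p :: nat and a :: "nat \<Rightarrow> real" and phi :: "real \<Rightarrow> complex" and phi_tail :: "nat \<Rightarrow> real \<Rightarrow> complex"
      and g :: "nat \<Rightarrow> complex" and G N Np :: "real \<Rightarrow> complex"
    assume p: "p \<ge> 1" and best: "best_ar c p a"
      and phi: "AE \<omega> in circle. phi \<omega> = ev \<Phi> \<omega>" and phi_tail: "\<forall>l. AE \<omega> in circle. phi_tail l \<omega> = ev (tail l \<Phi>) \<omega>"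
      and f_phi: "AE \<omega> in circle. spectral_density c \<omega> = s / (cmod (phi \<omega>))\<^sup>2"
      and G: "has_fourier_series G g"
      and N: "L2_sums (\<lambda>l \<omega>. g l * (cis (real l * \<omega>) + inverse (cnj (phi \<omega>)) * cnj (phi_tail l \<omega>))) N"
      and Np: "L2_sums (\<lambda>l \<omega>. g l * (cis (real l * \<omega>) +
                 inverse (cnj (ar_filter p a \<omega>)) * cnj (ar_tail p a l \<omega>))) Np"
    define X where "X = real p powr (- K)"
    have X: "0 < X" "X \<le> 1"
      using p K powr_mono[of "- K" 0 "real p"] by (auto simp: X_def)
    have pX: "real p powr (- K + 1) = real p * X" unfolding X_def powr_add using p by simp
    define \<gamma> where "\<gamma> = (SUP s. cmod (g s))"
    \<comment> \<open>A real \<open>SUP\<close> is an upper bound only of a bounded set, so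
      boundedness of g is established first.\<close>
    have "bdd_above (range (\<lambda>l. cmod (g l)))"
    proof -
      obtain b where "\<And>l. cmod (g l) \<le> b" using has_fourier_series_bounded[OF G] by blast
      then show ?thesis by (intro bdd_aboveI2)
    qed
    then have g_le: "cmod (g l) \<le> \<gamma>" for l unfolding \<gamma>_def by (rule cSUP_upper[OF UNIV_I])
    have \<gamma>0: "0 \<le> \<gamma>" using g_le[of 0] norm_ge_zero order_trans by blast
    define E where "E = ar_error c p a"
    have mE: "m \<le> E" unfolding E_def by (rule ar_error_ge)
    have Es: "\<bar>E - s\<bar> \<le> C2 * X" unfolding E_def X_def by (rule close'[OF p best])
    define P where "P = ar_poly p a"
    have PC: "norm1 (P - \<Phi>) \<le> C1 * X" unfolding P_def X_def by (rule close[OF p best])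
    then have PC': "norm1 (\<Phi> - P) \<le> C1 * X" using norm1_simps(5)[of "P - \<Phi>"] by simp
    have wdiff: "wsum 1 (\<Phi> - P)" "wnorm 1 (\<Phi> - P) \<le> real p * X * W'"
    proof -
      \<comment> \<open>The fitted filter vanishes beyond p, so there the difference is \<Phi>
        alone; up to p the closeness in \<open>norm1\<close> is used.\<close>
      define Y where "Y = proj {..int p} (\<Phi> - P)"
      have Y: "cf Y n = 0" if "n \<notin> {0..int p}" for n
        using that \<Phi>_causal by (auto simp: Y_def P_def cf_ar_poly)
      have eq: "\<Phi> - P = Y + proj {int p<..} \<Phi>"
        by (rule l1_eqI) (auto simp: Y_def P_def cf_ar_poly)
      have wY: "wsum 1 Y" "wnorm 1 Y = (\<Sum>n\<in>{0..int p}. weight 1 n * norm (cf Y n))"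
        "norm1 Y = (\<Sum>n\<in>{0..int p}. weight 0 n * norm (cf Y n))"
        by (rule wsumI_finite[of "{0..int p}"], simp, rule Y, assumption)+
      have "wnorm 1 Y \<le> 2 * real p * norm1 Y"
        unfolding wY sum_distrib_left
        by (intro sum_mono) (use p in \<open>auto simp: weight_def mult.assoc[symmetric] intro!: mult_right_mono\<close>)
      also have "norm1 Y \<le> C1 * X" unfolding Y_def using norm1_simps(4) PC' by (rule order_trans)
      finally have Y_le: "wnorm 1 Y \<le> 2 * real p * (C1 * X)" by (simp add: mult_left_mono)
      have t: "wsum 1 (proj {int p<..} \<Phi>)" "wnorm 1 (proj {int p<..} \<Phi>) \<le> real p * X * wnorm K \<Phi>"
        using wnorm_proj_tail_le[of 1 K \<Phi> p] w p K pX by (auto simp: add.commute)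
      show "wsum 1 (\<Phi> - P)" unfolding eq by (intro wsum_add wY t)
      have "wnorm 1 (\<Phi> - P) \<le> wnorm 1 Y + wnorm 1 (proj {int p<..} \<Phi>)"
        unfolding eq by (intro wsum_add wY t)
      with Y_le t(2) show "wnorm 1 (\<Phi> - P) \<le> real p * X * W'"
        by (simp add: W'_def algebra_simps)
    qed
    obtain r where r: "AE \<omega> in circle.
        (\<lambda>n. \<Sum>l<r n. g l * (cis (real l * \<omega>) + inverse (cnj (phi \<omega>)) * cnj (phi_tail l \<omega>))) \<longlonglongrightarrow> N \<omega> \<and>
        (\<lambda>n. \<Sum>l<r n. g l * (cis (real l * \<omega>) + inverse (cnj (ar_filter p a \<omega>)) * cnj (ar_tail p a l \<omega>))) \<longlonglongrightarrow> Np \<omega> \<and>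
        (\<lambda>n. \<Sum>l<r n. g l * cis (real l * \<omega>)) \<longlonglongrightarrow> G \<omega>"
      using L2_sums_AE_subseq[OF N Np G[unfolded has_fourier_series_def]] ..
    have tails: "AE \<omega> in circle. \<forall>l. phi_tail l \<omega> = ev (tail l \<Phi>) \<omega>"
      using phi_tail by (simp add: AE_all_countable)
    show "AE \<omega> in circle. cmod (N \<omega> / complex_of_real (spectral_density c \<omega>) - Np \<omega> / complex_of_real (ar_density c p a \<omega>))
        \<le> B * (real p powr (- K + 1) * (SUP s. cmod (g s)) + real p powr (- K) * cmod (G \<omega>))"
      using r tails phi f_phi AE_ar_filter_nonzero[of p a]
    proof eventually_elim
      case (elim \<omega>)
      define S where "S n = (\<Sum>l<n. g l * cis (real l * \<omega>))" for n
      define R where "R n = (\<Sum>l<n. g l * cnj (ev (tail l \<Phi>) \<omega>))" for n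
      define R' where "R' n = (\<Sum>l<n. g l * cnj (ev (tail l P) \<omega>))" for n
      define \<phi> where "\<phi> = ev \<Phi> \<omega>"
      define \<alpha> where "\<alpha> = ev P \<omega>"
      have \<phi>0: "\<phi> \<noteq> 0" using elim(3,4) f_pos[of \<omega>] by (auto simp: \<phi>_def)
      have \<alpha>0: "\<alpha> \<noteq> 0" using elim(5) by (simp add: \<alpha>_def P_def ev_ar_poly)
      have sum_eq: "(\<Sum>l<n. g l * (cis (real l * \<omega>) + inverse z * t l)) = S n + inverse z * (\<Sum>l<n. g l * t l)" for n z t
        by (simp add: S_def sum.distrib distrib_left sum_distrib_left mult_ac)
      have f_eq: "complex_of_real (spectral_density c \<omega>) = s / (\<phi> * cnj \<phi>)"
        using elim(3,4) by (simp add: \<phi>_def flip: complex_norm_square)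
      have fp_eq: "complex_of_real (ar_density c p a \<omega>) = E / (\<alpha> * cnj \<alpha>)"
        by (simp add: ar_density_def E_def \<alpha>_def P_def ev_ar_poly flip: complex_norm_square)
      have limN: "(\<lambda>n. S (r n) + inverse (cnj \<phi>) * R (r n)) \<longlonglongrightarrow> N \<omega>"
        using elim(1,2,3) by (simp add: sum_eq R_def \<phi>_def)
      have limNp: "(\<lambda>n. S (r n) + inverse (cnj \<alpha>) * R' (r n)) \<longlonglongrightarrow> Np \<omega>"
        using elim(1) by (simp add: sum_eq R'_def \<alpha>_def P_def ev_ar_poly ev_tail_ar_poly)
      have limS: "(\<lambda>n. S (r n)) \<longlonglongrightarrow> G \<omega>" using elim(1) by (simp add: S_def)
      have bound: "norm ((S n + inverse (cnj \<phi>) * R n) / complex_of_real (spectral_density c \<omega>)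
            - (S n + inverse (cnj \<alpha>) * R' n) / complex_of_real (ar_density c p a \<omega>))
          \<le> B * (real p * X * \<gamma> + X * norm (S n))" for n
      proof -
        have sum_le: "norm (\<Sum>l<n. g l * cnj (ev (y l) \<omega>)) \<le> \<gamma> * (\<Sum>l<n. norm1 (y l))" for y
          unfolding sum_distrib_left
          by (intro order_trans[OF norm_sum] sum_mono)
             (auto simp: norm_mult intro!: mult_mono g_le norm_ev_le \<gamma>0)
        have R: "norm (R n) \<le> \<gamma> * W"
          unfolding R_def W_def
          by (rule order_trans[OF sum_le]) (intro mult_left_mono sum_norm1_tail_le w1 \<gamma>0)
        have "R n - R' n = (\<Sum>l<n. g l * cnj (ev (tail l (\<Phi> - P)) \<omega>))"
          by (simp add: R_def R'_def tail_diff right_diff_distrib sum_subtractf)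
        also have "norm \<dots> \<le> \<gamma> * wnorm 1 (\<Phi> - P)"
          by (rule order_trans[OF sum_le]) (intro mult_left_mono sum_norm1_tail_le wdiff \<gamma>0)
        also have "\<dots> \<le> \<gamma> * (real p * X * W')" by (intro mult_left_mono wdiff \<gamma>0)
        finally have R': "norm (R n - R' n) \<le> \<gamma> * (real p * X * W')" .
        have d: "norm (\<phi> - \<alpha>) \<le> C1 * X"
          using order_trans[OF norm_ev_le[of "\<Phi> - P" \<omega>] PC'] by (simp add: \<phi>_def \<alpha>_def)
        have \<phi>F: "norm \<phi> \<le> F" unfolding \<phi>_def F_def by (rule norm_ev_le)
        have "C1 * X \<le> C1" using C12 X mult_left_le[of X C1] by simp
        then have \<alpha>A: "norm \<alpha> \<le> A"
          using norm_triangle_ineq4[of \<phi> "\<phi> - \<alpha>"] d \<phi>F unfolding A_def by simp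
        have "norm (\<phi> * (cnj \<phi> * S n + R n) / s - \<alpha> * (cnj \<alpha> * S n + R' n) / E)
            \<le> \<kappa> * X * (F * norm (S n) + \<gamma> * W) + A / m * (C1 * X * norm (S n) + \<gamma> * (real p * X * W'))"
          unfolding \<kappa>_def
          by (rule rational_difference_bound[OF s_pos m_pos mE Es d \<phi>F \<alpha>A R R'])
        also have "\<dots> = (\<kappa> * F + A / m * C1) * (X * norm (S n)) + \<kappa> * W * (X * \<gamma>) + A / m * W' * (real p * X * \<gamma>)"
          by (simp add: algebra_simps)
        also have "\<dots> \<le> (\<kappa> * F + A / m * C1) * (X * norm (S n)) + \<kappa> * W * (real p * X * \<gamma>) + A / m * W' * (real p * X * \<gamma>)"
        proof -
          \<comment> \<open>The term without the factor p is of smaller order and is merged into the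
            first error term.\<close>
          have "X * \<gamma> \<le> real p * X * \<gamma>"
            using mult_right_mono[of 1 "real p" "X * \<gamma>"] p X \<gamma>0 by (simp add: mult_ac)
          then have "\<kappa> * W * (X * \<gamma>) \<le> \<kappa> * W * (real p * X * \<gamma>)"
            by (rule mult_left_mono) (use nonneg in simp)
          then show ?thesis by (intro add_right_mono add_left_mono)
        qed
        also have "\<dots> \<le> B * (real p * X * \<gamma> + X * norm (S n))"
        proof -
          have "0 \<le> (\<kappa> * W + A / m * W') * (X * norm (S n))" "0 \<le> (\<kappa> * F + A / m * C1) * (real p * X * \<gamma>)"
            using nonneg C12 X \<gamma>0 m_pos by (auto intro!: mult_nonneg_nonneg add_nonneg_nonneg divide_nonneg_pos)
          then show ?thesis unfolding B_def by (simp add: algebra_simps)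
        qed
        finally have "norm (\<phi> * (cnj \<phi> * S n + R n) / s - \<alpha> * (cnj \<alpha> * S n + R' n) / E)
            \<le> B * (real p * X * \<gamma> + X * norm (S n))" .
        moreover have "(S n + inverse (cnj \<phi>) * R n) / complex_of_real (spectral_density c \<omega>) = \<phi> * (cnj \<phi> * S n + R n) / s"
          unfolding f_eq using \<phi>0 s_pos by (simp add: field_simps)
        moreover have "(S n + inverse (cnj \<alpha>) * R' n) / complex_of_real (ar_density c p a \<omega>) = \<alpha> * (cnj \<alpha> * S n + R' n) / E"
          unfolding fp_eq using \<alpha>0 mE m_pos by (simp add: field_simps)
        ultimately show ?thesis by simp
      qed
      have "(\<lambda>n. norm ((S (r n) + inverse (cnj \<phi>) * R (r n)) / complex_of_real (spectral_density c \<omega>)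
            - (S (r n) + inverse (cnj \<alpha>) * R' (r n)) / complex_of_real (ar_density c p a \<omega>)))
          \<longlonglongrightarrow> norm (N \<omega> / complex_of_real (spectral_density c \<omega>) - Np \<omega> / complex_of_real (ar_density c p a \<omega>))"
        using f_pos[of \<omega>] fp_eq \<alpha>0 mE m_pos by (intro tendsto_intros limN limNp) auto
      moreover have "(\<lambda>n. B * (real p * X * \<gamma> + X * norm (S (r n)))) \<longlonglongrightarrow> B * (real p * X * \<gamma> + X * norm (G \<omega>))"
        by (intro tendsto_intros limS)
      ultimately have "norm (N \<omega> / complex_of_real (spectral_density c \<omega>) - Np \<omega> / complex_of_real (ar_density c p a \<omega>))
          \<le> B * (real p * X * \<gamma> + X * norm (G \<omega>))"
        by (rule LIMSEQ_le) (use bound in blast)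
      then show ?case by (simp only: pX X_def[symmetric] \<gamma>_def)
    qed
  qed
qed

end

theorem theorem3p1:
  fixes c :: "int \<Rightarrow> real" and K :: real
  assumes "\<And>r. c (- r) = c r"
    and "positive_definite_seq c"
    and "K > 1"
    and "(\<lambda>r::int. \<bar>real_of_int r\<bar> powr K * \<bar>c r\<bar>) summable_on UNIV"
    and "0 < (INF \<omega>. ereal (spectral_density c \<omega>))"
    and "(SUP \<omega>. ereal (spectral_density c \<omega>)) < \<infinity>"
  shows "\<exists>C::real.
    \<forall>(\<sigma>2::real) (\<psi>::nat \<Rightarrow> real) (\<phi>::nat \<Rightarrow> real)
     (psi::real \<Rightarrow> complex) (phi::real \<Rightarrow> complex) (phi_tail::nat \<Rightarrow> real \<Rightarrow> complex)
     (p::nat) (a::nat \<Rightarrow> real)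
     (g::nat \<Rightarrow> complex) (h::nat \<Rightarrow> complex)
     (G::real \<Rightarrow> complex) (H::real \<Rightarrow> complex)
     (N::real \<Rightarrow> complex) (Np::real \<Rightarrow> complex).
      spectral_factorization c \<sigma>2 \<psi> \<phi> psi phi \<longrightarrow>
      (\<forall>l. has_fourier_series (phi_tail l)
             (\<lambda>s. if s = 0 then 0 else complex_of_real (\<phi> (l + s)))) \<longrightarrow>
      p \<ge> 1 \<longrightarrow> best_ar c p a \<longrightarrow>
      g \<in> l2_plus \<longrightarrow> h \<in> l2_plus \<longrightarrow>
      (\<forall>l. (\<lambda>j. h j * complex_of_real (c (int l - int j))) sums g l) \<longrightarrow>
      has_fourier_series G g \<longrightarrow>
      has_fourier_series H h \<longrightarrow>
      L2_sums (\<lambda>l \<omega>. g l * (cis (real l * \<omega>) + inverse (cnj (phi \<omega>)) * cnj (phi_tail l \<omega>))) N \<longrightarrow>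
      L2_sums (\<lambda>l \<omega>. g l * (cis (real l * \<omega>) +
                 inverse (cnj (ar_filter p a \<omega>)) * cnj (ar_tail p a l \<omega>))) Np \<longrightarrow>
      (AE \<omega> in circle.
         H \<omega> = N \<omega> / complex_of_real (spectral_density c \<omega>) \<and>
         cmod (H \<omega> - Np \<omega> / complex_of_real (ar_density c p a \<omega>))
           \<le> C * (real p powr (- K + 1) * (SUP s. cmod (g s)) + real p powr (- K) * cmod (G \<omega>)))"
proof -
  obtain m where m: "0 < ereal m" "ereal m < (INF \<omega>. ereal (spectral_density c \<omega>))"
    using ereal_dense2[OF assms(5)] by auto
  obtain M where M: "(SUP \<omega>. ereal (spectral_density c \<omega>)) < ereal M"
    using ereal_dense2[OF assms(6)] by auto
  interpret spectral_bounds c K m M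
  proof
    show "m \<le> spectral_density c \<omega>" for \<omega>
      using less_le_trans[OF m(2) INF_lower[of \<omega> UNIV "\<lambda>\<omega>. ereal (spectral_density c \<omega>)"]] by simp
    show "spectral_density c \<omega> \<le> M" for \<omega>
      using le_less_trans[OF SUP_upper[of \<omega> UNIV "\<lambda>\<omega>. ereal (spectral_density c \<omega>)"] M] by simp
  qed (use assms m in auto)
  show ?thesis
  \<comment> \<open>The constant precedes the quantified factorization. If there is none the claim
    is vacuous; otherwise the constant is taken from one of them.\<close>
  proof (cases "\<exists>\<sigma>2 \<psi> \<phi> psi phi. spectral_factorization c \<sigma>2 \<psi> \<phi> psi phi")
    case False
    then show ?thesis by (intro exI[of _ 0] allI impI) blast
  next
    case True
    then obtain \<sigma>0 \<psi>0 \<phi>0 psi0 phi0 where "spectral_factorization c \<sigma>0 \<psi>0 \<phi>0 psi0 phi0" by blast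
    from spectral_factorization_l1[OF this]
    obtain \<Phi>0 \<Psi>0 where fac0: "l1_factorization C \<Phi>0 \<Psi>0 \<sigma>0" and w0: "wsum K \<Phi>0" by blast
    show ?thesis
    proof (rule exE[OF final_bound[OF fac0 w0]])
      fix B
      assume B: "\<forall>p a phi phi_tail g G N Np.
      p \<ge> 1 \<longrightarrow> best_ar c p a \<longrightarrow> (AE \<omega> in circle. phi \<omega> = ev \<Phi>0 \<omega>) \<longrightarrow>
      (\<forall>l. AE \<omega> in circle. phi_tail l \<omega> = ev (tail l \<Phi>0) \<omega>) \<longrightarrow>
      (AE \<omega> in circle. spectral_density c \<omega> = \<sigma>0 / (cmod (phi \<omega>))\<^sup>2) \<longrightarrow>
      has_fourier_series G g \<longrightarrow>
      L2_sums (\<lambda>l \<omega>. g l * (cis (real l * \<omega>) + inverse (cnj (phi \<omega>)) * cnj (phi_tail l \<omega>))) N \<longrightarrow>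
      L2_sums (\<lambda>l \<omega>. g l * (cis (real l * \<omega>) +
                 inverse (cnj (ar_filter p a \<omega>)) * cnj (ar_tail p a l \<omega>))) Np \<longrightarrow>
      (AE \<omega> in circle.
         cmod (N \<omega> / complex_of_real (spectral_density c \<omega>) - Np \<omega> / complex_of_real (ar_density c p a \<omega>))
           \<le> B * (real p powr (- K + 1) * (SUP s. cmod (g s)) + real p powr (- K) * cmod (G \<omega>)))"
      show ?thesis
      proof (intro exI[of _ B] allI impI)
        fix \<sigma>2 :: real and \<psi> \<phi> :: "nat \<Rightarrow> real" and psi phi :: "real \<Rightarrow> complex"
          and phi_tail :: "nat \<Rightarrow> real \<Rightarrow> complex" and p :: nat and a :: "nat \<Rightarrow> real"
          and g h :: "nat \<Rightarrow> complex" and G H N Np :: "real \<Rightarrow> complex"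
        assume sf: "spectral_factorization c \<sigma>2 \<psi> \<phi> psi phi"
          and tl: "\<forall>l. has_fourier_series (phi_tail l) (\<lambda>s. if s = 0 then 0 else complex_of_real (\<phi> (l + s)))"
          and p: "p \<ge> 1" and best: "best_ar c p a"
          and sol: "\<forall>l. (\<lambda>j. h j * complex_of_real (c (int l - int j))) sums g l"
          and G: "has_fourier_series G g" and H: "has_fourier_series H h"
          and N: "L2_sums (\<lambda>l \<omega>. g l * (cis (real l * \<omega>) + inverse (cnj (phi \<omega>)) * cnj (phi_tail l \<omega>))) N"
          and Np: "L2_sums (\<lambda>l \<omega>. g l * (cis (real l * \<omega>) +
                   inverse (cnj (ar_filter p a \<omega>)) * cnj (ar_tail p a l \<omega>))) Np"
        obtain \<Phi> \<Psi> where \<Phi>: "l1_factorization C \<Phi> \<Psi> \<sigma>2 \<and> wsum K \<Phi> \<and> (AE \<omega> in circle. phi \<omega> = ev \<Phi> \<omega>) \<and>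
            (\<forall>j>0. cf \<Phi> (int j) = - complex_of_real (\<phi> j))"
          using spectral_factorization_l1[OF sf] by (elim exE)
        then have fac: "l1_factorization C \<Phi> \<Psi> \<sigma>2" and phi: "AE \<omega> in circle. phi \<omega> = ev \<Phi> \<omega>"
          and cf\<Phi>: "\<And>j. j > 0 \<Longrightarrow> cf \<Phi> (int j) = - complex_of_real (\<phi> j)"
          by simp_all
        \<comment> \<open>Uniqueness carries the constant over to the arbitrary factorization data
          at hand.\<close>
        have eq: "\<Phi> = \<Phi>0" "\<sigma>2 = \<sigma>0" using l1_factorization_unique[OF fac fac0] by auto
        have phi_tail: "AE \<omega> in circle. phi_tail l \<omega> = ev (tail l \<Phi>) \<omega>" for l
          by (rule phi_tail_ev[OF cf\<Phi> tl[THEN spec]])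
        have f_phi: "AE \<omega> in circle. spectral_density c \<omega> = \<sigma>2 / (cmod (phi \<omega>))\<^sup>2"
        proof -
          have "AE \<omega> in circle. phi \<omega> = inverse (psi \<omega>) \<and> spectral_density c \<omega> = \<sigma>2 * (cmod (psi \<omega>))\<^sup>2 \<and>
              spectral_density c \<omega> = \<sigma>2 / (cmod (phi \<omega>))\<^sup>2"
            using sf by (simp add: spectral_factorization_def)
          then show ?thesis by eventually_elim (elim conjE)
        qed
        have "AE \<omega> in circle. H \<omega> = N \<omega> / complex_of_real (spectral_density c \<omega>)"
          by (rule Toeplitz_solution[OF fac phi phi_tail f_phi sol[rule_format] G H N])
        moreover have "AE \<omega> in circle. cmod (N \<omega> / complex_of_real (spectral_density c \<omega>) - Np \<omega> / complex_of_real (ar_density c p a \<omega>))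
          \<le> B * (real p powr (- K + 1) * (SUP s. cmod (g s)) + real p powr (- K) * cmod (G \<omega>))"
          by (rule B[rule_format, OF p best phi[unfolded eq] phi_tail[unfolded eq] f_phi[unfolded eq] G N Np])
        ultimately show "AE \<omega> in circle. H \<omega> = N \<omega> / complex_of_real (spectral_density c \<omega>) \<and>
           cmod (H \<omega> - Np \<omega> / complex_of_real (ar_density c p a \<omega>))
             \<le> B * (real p powr (- K + 1) * (SUP s. cmod (g s)) + real p powr (- K) * cmod (G \<omega>))"
          by eventually_elim simp
      qed
    qed
  qed
qed

end
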